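(* Let $R$ be an ordered field and let $N$ be a lattice (finitely generated free abelian group). Then every rational fan in $N_{R}=N\otimes_{\mathbb{Z}}R$ has a rational completion, i.e. for every rational fan $\Sigma$ in $N_R$ there is a rational fan $\overline{\Sigma}$ in $N_R$ with $\Sigma\subset\overline{\Sigma}$ such that the union of the cones of $\overline{\Sigma}$ is $N_R$.
   Context: Let $M=\operatorname{Hom}(N,\mathbb{Z})$ with natural pairing $\langle\cdot,\cdot\rangle\colon M\times N_R\to R$. A rational cone in $N_R$ is a set of the form $\{w\in N_R\mid\langle u,w\rangle\ge0\text{ for all }u\in L\}$ with $L\subset M$ finite. A polyhedral complex in $N_R$ is a finite collection of polyhedra (over $R$), closed under taking faces, such that any two members intersect either in the empty set or in a common face of both. A fan is a nonempty polyhedral complex consisting of strongly convex cones (cones containing no line). A fan is rational if all its cones are rational. *)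

theory Defs
  imports Complex_Main "HOL-Library.Poly_Mapping" "HOL-Algebra.Free_Abelian_Groups"
begin

section \<open>Lattices and their duals\<close>

definition additive_group :: "'n::ab_group_add monoid" where
  "additive_group = \<lparr>carrier = UNIV, monoid.mult = (+), one = 0\<rparr>"

text \<open>The rank may be 0, in which case the type has a single element.\<close>

definition fg_free_abelian :: "'n::ab_group_add itself \<Rightarrow> bool" where
  "fg_free_abelian _ \<longleftrightarrow>
     (\<exists>d::nat. free_Abelian_group {..<d} \<cong> (additive_group :: 'n monoid))"

typedef (overloaded) 'n dual = "{u :: 'n::ab_group_add \<Rightarrow> int. Modules.additive u}"
  by (rule exI[of _ "\<lambda>_. 0"]) (simp add: Modules.additive_def)

setup_lifting type_definition_dual


section \<open>The extension of scalars of an abelian group\<close>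

text \<open>
  The tensor product over the integers is the free abelian group on pairs modulo the
  subgroup generated by the bilinearity relations. Being balanced over the integers is a
  consequence of biadditivity.
\<close>

inductive_set tensor_relations :: "('n::ab_group_add \<times> 'r::ab_group_add \<Rightarrow>\<^sub>0 int) set" where
  zero: "0 \<in> tensor_relations"
| add_left: "frag_of (m + n, r) - frag_of (m, r) - frag_of (n, r) \<in> tensor_relations"
| add_right: "frag_of (n, r + s) - frag_of (n, r) - frag_of (n, s) \<in> tensor_relations"
| diff: "x \<in> tensor_relations \<Longrightarrow> y \<in> tensor_relations \<Longrightarrow> x - y \<in> tensor_relations"

lemma tensor_relations_minus: "x \<in> tensor_relations \<Longrightarrow> - x \<in> tensor_relations"
  using tensor_relations.diff[OF tensor_relations.zero] by fastforce

lemma tensor_relations_add: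
  "x \<in> tensor_relations \<Longrightarrow> y \<in> tensor_relations \<Longrightarrow> x + y \<in> tensor_relations"
  using tensor_relations.diff[of x "- y"] tensor_relations_minus[of y] by simp

definition tensor_eq ::
    "('n::ab_group_add \<times> 'r::ab_group_add \<Rightarrow>\<^sub>0 int) \<Rightarrow> ('n \<times> 'r \<Rightarrow>\<^sub>0 int) \<Rightarrow> bool" where
  "tensor_eq x y \<longleftrightarrow> x - y \<in> tensor_relations"

lemma equivp_tensor_eq: "equivp tensor_eq"
proof (rule equivpI)
  show "reflp tensor_eq"
    by (simp add: reflp_def tensor_eq_def tensor_relations.zero)
  show "symp tensor_eq"
    using tensor_relations_minus by (fastforce simp: symp_def tensor_eq_def)
  show "transp tensor_eq"
    using tensor_relations_add by (fastforce simp: transp_def tensor_eq_def)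
qed

quotient_type (overloaded) ('n, 'r) tensor =
    "'n::ab_group_add \<times> 'r::ab_group_add \<Rightarrow>\<^sub>0 int" / tensor_eq
  by (rule equivp_tensor_eq)

instantiation tensor :: (ab_group_add, ab_group_add) ab_group_add
begin

lift_definition zero_tensor :: "('a, 'b) tensor" is 0 .

lift_definition plus_tensor :: "('a, 'b) tensor \<Rightarrow> ('a, 'b) tensor \<Rightarrow> ('a, 'b) tensor" is "(+)"
proof -
  fix x x' y y' :: "'a \<times> 'b \<Rightarrow>\<^sub>0 int"
  assume "tensor_eq x x'" "tensor_eq y y'"
  then show "tensor_eq (x + y) (x' + y')"
    using tensor_relations_add[of "x - x'" "y - y'"] by (simp only: tensor_eq_def add_diff_add)
qed

lift_definition minus_tensor :: "('a, 'b) tensor \<Rightarrow> ('a, 'b) tensor \<Rightarrow> ('a, 'b) tensor" is "(-)"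
proof -
  fix x x' y y' :: "'a \<times> 'b \<Rightarrow>\<^sub>0 int"
  assume "tensor_eq x x'" "tensor_eq y y'"
  moreover have "x - y - (x' - y') = (x - x') - (y - y')"
    by (simp add: algebra_simps)
  ultimately show "tensor_eq (x - y) (x' - y')"
    by (simp only: tensor_eq_def tensor_relations.diff)
qed

lift_definition uminus_tensor :: "('a, 'b) tensor \<Rightarrow> ('a, 'b) tensor" is uminus
  using tensor_relations_minus by (fastforce simp: tensor_eq_def)

instance
  by standard
    (transfer; simp add: tensor_eq_def tensor_relations.zero algebra_simps)+

end

lift_definition pure_tensor :: "'n::ab_group_add \<Rightarrow> 'r::ab_group_add \<Rightarrow> ('n, 'r) tensor"
  is "\<lambda>n r. frag_of (n, r)" .

lemma tensor_relations_extend: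
  fixes c :: "'r::comm_ring_1"
  assumes "x \<in> tensor_relations"
  shows "frag_extend (\<lambda>(n, s). frag_of (n, c * s)) x \<in> tensor_relations"
  using assms
proof induction
  case zero
  show ?case by (simp add: tensor_relations.zero)
next
  case (add_left m n r)
  show ?case by (simp add: frag_extend_diff tensor_relations.add_left)
next
  case (add_right n r s)
  show ?case by (simp add: frag_extend_diff distrib_left tensor_relations.add_right)
next
  case (diff x y)
  then show ?case by (simp add: frag_extend_diff tensor_relations.diff)
qed

lift_definition scale_tensor ::
    "'r::comm_ring_1 \<Rightarrow> ('n::ab_group_add, 'r) tensor \<Rightarrow> ('n, 'r) tensor" (infixr \<open>*\<^sub>N\<close> 75)
  is "\<lambda>c. frag_extend (\<lambda>(n, s). frag_of (n, c * s))"
  unfolding tensor_eq_def by (metis frag_extend_diff tensor_relations_extend)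

lemma scale_pure_tensor: "c *\<^sub>N pure_tensor n s = pure_tensor n (c * s)"
  by transfer (simp add: tensor_eq_def tensor_relations.zero)

lemma scale_tensor_add: "c *\<^sub>N (v + w) = c *\<^sub>N v + c *\<^sub>N w"
  by transfer (simp add: frag_extend_add tensor_eq_def tensor_relations.zero)

lemma scale_tensor_diff: "c *\<^sub>N (v - w) = c *\<^sub>N v - c *\<^sub>N w"
  by transfer (simp add: frag_extend_diff tensor_eq_def tensor_relations.zero)

lemma pure_tensor_add_left: "pure_tensor (m + n) r = pure_tensor m r + pure_tensor n r"
  using tensor_relations.add_left[of m n r]
  by (simp add: pure_tensor.abs_eq plus_tensor.abs_eq tensor.abs_eq_iff tensor_eq_def diff_diff_eq)

lemma pure_tensor_add_right: "pure_tensor n (r + s) = pure_tensor n r + pure_tensor n s"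
  using tensor_relations.add_right[of n r s]
  by (simp add: pure_tensor.abs_eq plus_tensor.abs_eq tensor.abs_eq_iff tensor_eq_def diff_diff_eq)

lemma tensor_induct [case_names zero pure diff]:
  assumes "P 0" and "\<And>n r. P (pure_tensor n r)" and "\<And>v w. P v \<Longrightarrow> P w \<Longrightarrow> P (v - w)"
  shows "P w"
proof -
  have "P (abs_tensor x)" for x
  proof (rule frag_induction[of x UNIV "\<lambda>x. P (abs_tensor x)"])
    show "P (abs_tensor 0)"
      using assms(1) by (simp add: zero_tensor_def)
    show "P (abs_tensor (frag_of p))" for p
      using assms(2)[of "fst p" "snd p"] by (simp add: pure_tensor.abs_eq)
    show "P (abs_tensor (a - b))" if "P (abs_tensor a)" "P (abs_tensor b)" for a b
      using assms(3)[OF that] by (simp add: minus_tensor.abs_eq)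
  qed simp
  then show ?thesis by (metis tensor.abs_induct)
qed

interpretation tensor: vector_space "scale_tensor :: 'r::field \<Rightarrow> ('n::ab_group_add, 'r) tensor \<Rightarrow> _"
proof
  fix c d :: 'r and v w :: "('n, 'r) tensor"
  have zero: "e *\<^sub>N (0 :: ('n, 'r) tensor) = 0" for e
    using scale_tensor_add[of e 0 0] by simp
  show "c *\<^sub>N (v + w) = c *\<^sub>N v + c *\<^sub>N w"
    by (rule scale_tensor_add)
  show "(c + d) *\<^sub>N v = c *\<^sub>N v + d *\<^sub>N v"
    by (induction v rule: tensor_induct)
      (simp_all add: zero scale_pure_tensor scale_tensor_diff distrib_right pure_tensor_add_right)
  show "c *\<^sub>N d *\<^sub>N v = (c * d) *\<^sub>N v"
    by (induction v rule: tensor_induct)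
      (simp_all add: zero scale_pure_tensor scale_tensor_diff mult.assoc)
  show "1 *\<^sub>N v = v"
    by (induction v rule: tensor_induct)
      (simp_all add: zero scale_pure_tensor scale_tensor_diff)
qed

text \<open>The pairing sends \<open>(u, n \<otimes> r)\<close> to \<open>u n * r\<close>.\<close>

definition pairing_rep :: "('n \<Rightarrow> int) \<Rightarrow> ('n::ab_group_add \<times> 'r::comm_ring_1 \<Rightarrow>\<^sub>0 int) \<Rightarrow> 'r" where
  "pairing_rep u x = (\<Sum>p\<in>Poly_Mapping.keys x.
     of_int (Poly_Mapping.lookup x p) * (of_int (u (fst p)) * snd p))"

lemma pairing_rep_superset:
  assumes "finite S" "Poly_Mapping.keys x \<subseteq> S"
  shows "pairing_rep u x =
    (\<Sum>p\<in>S. of_int (Poly_Mapping.lookup x p) * (of_int (u (fst p)) * snd p))"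
  unfolding pairing_rep_def using assms
  by (intro sum.mono_neutral_left) (auto simp: in_keys_iff)

lemma pairing_rep_diff: "pairing_rep u (x - y) = pairing_rep u x - pairing_rep u y"
proof -
  let ?S = "Poly_Mapping.keys x \<union> Poly_Mapping.keys y"
  have "Poly_Mapping.keys (x - y) \<subseteq> ?S"
    by (rule keys_diff)
  then show ?thesis
    by (simp add: pairing_rep_superset[of ?S] lookup_minus algebra_simps sum_subtractf)
qed

lemma pairing_rep_relations:
  assumes "Modules.additive u" "x \<in> tensor_relations"
  shows "pairing_rep u x = 0"
  using assms(2)
proof induction
  case (add_left m n r)
  show ?case unfolding pairing_rep_diff
    by (simp add: pairing_rep_def Modules.additive.add[OF assms(1)] algebra_simps)
next
  case (add_right n r s)
  show ?case unfolding pairing_rep_diff by (simp add: pairing_rep_def algebra_simps)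
qed (simp_all add: pairing_rep_diff, simp add: pairing_rep_def)

lift_definition pairing :: "'n::ab_group_add dual \<Rightarrow> ('n, 'r::comm_ring_1) tensor \<Rightarrow> 'r"
  is pairing_rep
  unfolding tensor_eq_def
  by (metis pairing_rep_diff pairing_rep_relations eq_iff_diff_eq_0)

lemma pairing_pure_tensor:
  "pairing u (pure_tensor n r) = of_int (Rep_dual u n) * r"
  by transfer (simp add: pairing_rep_def)

lemma pairing_diff: "pairing u (v - w) = pairing u v - pairing u w"
  by transfer (rule pairing_rep_diff)


section \<open>Polyhedra, cones and fans\<close>

abbreviation linear_functional :: "(('n::ab_group_add, 'r::field) tensor \<Rightarrow> 'r) \<Rightarrow> bool" where
  "linear_functional l \<equiv> Vector_Spaces.linear (*\<^sub>N) (*) l"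

lemma linear_functional_pairing:
  "linear_functional (pairing u :: ('n::ab_group_add, 'r::field) tensor \<Rightarrow> 'r)"
proof -
  have zero: "pairing u (0 :: ('n, 'r) tensor) = 0"
    using pairing_diff[of u 0 "0 :: ('n, 'r) tensor"] by simp
  have add: "pairing u (v + w) = pairing u v + pairing u w" for v w :: "('n, 'r) tensor"
    using pairing_diff[of u v "- w"] pairing_diff[of u 0 w] zero by simp
  have "pairing u (c *\<^sub>N v) = c * pairing u v" for c and v :: "('n, 'r) tensor"
    by (induction v rule: tensor_induct)
      (simp_all add: zero scale_pure_tensor scale_tensor_diff pairing_pure_tensor pairing_diff
        algebra_simps)
  with add show ?thesis
    by unfold_locales (simp_all add: algebra_simps)
qed

text \<open>Polyhedra and polyhedral cones are cut out by arbitrary \<open>R\<close>-linear functionals, with no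
  rationality condition.\<close>

definition polyhedron_over :: "('n::ab_group_add, 'r::linordered_field) tensor set \<Rightarrow> bool" where
  "polyhedron_over P \<longleftrightarrow> (\<exists>H. finite H \<and> (\<forall>(l, b)\<in>H. linear_functional l) \<and>
     P = {w. \<forall>(l, b)\<in>H. l w \<ge> b})"

definition polyhedral_cone :: "('n::ab_group_add, 'r::linordered_field) tensor set \<Rightarrow> bool" where
  "polyhedral_cone C \<longleftrightarrow> (\<exists>L. finite L \<and> (\<forall>l\<in>L. linear_functional l) \<and>
     C = {w. \<forall>l\<in>L. l w \<ge> 0})"

definition rational_cone :: "('n::ab_group_add, 'r::linordered_field) tensor set \<Rightarrow> bool" where
  "rational_cone C \<longleftrightarrow> (\<exists>L. finite L \<and> C = {w. \<forall>u\<in>L. pairing u w \<ge> 0})"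

definition strongly_convex :: "('n::ab_group_add, 'r::linordered_field) tensor set \<Rightarrow> bool" where
  "strongly_convex C \<longleftrightarrow> \<not> (\<exists>w v. v \<noteq> 0 \<and> (\<forall>t. w + t *\<^sub>N v \<in> C))"

text \<open>Faces are nonempty, and every nonempty polyhedron is a face of itself (take the zero
  functional). The empty set is not a face, since otherwise a fan, all of whose members are
  cones, could not be closed under taking faces.\<close>

definition is_face_of ::
    "('n::ab_group_add, 'r::linordered_field) tensor set \<Rightarrow> ('n, 'r) tensor set \<Rightarrow> bool" where
  "is_face_of F P \<longleftrightarrow> F \<noteq> {} \<and>
     (\<exists>l. linear_functional l \<and> F = {w\<in>P. \<forall>v\<in>P. l w \<le> l v})"

definition polyhedral_complex ::
    "('n::ab_group_add, 'r::linordered_field) tensor set set \<Rightarrow> bool" where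
  "polyhedral_complex \<Sigma> \<longleftrightarrow> finite \<Sigma> \<and> (\<forall>P\<in>\<Sigma>. polyhedron_over P) \<and>
     (\<forall>P\<in>\<Sigma>. \<forall>F. is_face_of F P \<longrightarrow> F \<in> \<Sigma>) \<and>
     (\<forall>P\<in>\<Sigma>. \<forall>Q\<in>\<Sigma>. P \<inter> Q = {} \<or> is_face_of (P \<inter> Q) P \<and> is_face_of (P \<inter> Q) Q)"

definition fan :: "('n::ab_group_add, 'r::linordered_field) tensor set set \<Rightarrow> bool" where
  "fan \<Sigma> \<longleftrightarrow> polyhedral_complex \<Sigma> \<and> \<Sigma> \<noteq> {} \<and>
     (\<forall>C\<in>\<Sigma>. polyhedral_cone C \<and> strongly_convex C)"

definition rational_fan :: "('n::ab_group_add, 'r::linordered_field) tensor set set \<Rightarrow> bool" where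
  "rational_fan \<Sigma> \<longleftrightarrow> fan \<Sigma> \<and> (\<forall>C\<in>\<Sigma>. rational_cone C)"

definition rational_completion ::
    "('n::ab_group_add, 'r::linordered_field) tensor set set \<Rightarrow> ('n, 'r) tensor set set \<Rightarrow> bool" where
  "rational_completion \<Sigma> \<Sigma>' \<longleftrightarrow> rational_fan \<Sigma>' \<and> \<Sigma> \<subseteq> \<Sigma>' \<and> \<Union>\<Sigma>' = UNIV"

end

theory Submission
  imports Defs
begin

text \<open>
  The cones of the given fan \<open>\<Sigma>\<close> are inserted one at a time, faces first, into a complete fan \<open>\<Gamma>\<close>
  that contains the cones \<open>K\<^sub>0\<close> inserted so far. Let \<open>\<sigma>\<close> be the next cone; its proper faces lie in \<open>K\<^sub>0\<close>
  and its relative interior avoids the support of \<open>K\<^sub>0\<close>.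

  All subdivisions come from one construction: a refinement of a subfan extends to the whole fan by
  treating the remaining cones in order of dimension and coning each one off from a rational point
  of its relative interior. Cones of the subfan that are not refined survive.

  Choosing these points in \<open>\<sigma>\<close> whenever possible makes \<open>\<sigma>\<close> a union of cones; coning off once more
  makes the cones that meet the relative interior of \<open>\<sigma>\<close> contain no cone of \<open>K\<^sub>0\<close> except faces of
  \<open>\<sigma>\<close>. Now let \<open>H\<close> consist of functionals defining \<open>\<sigma>\<close> and of functionals separating \<open>\<sigma>\<close> from
  the cones of \<open>\<Gamma>\<close> that miss its relative interior. In the arrangement of \<open>H\<close> the set \<open>\<sigma>\<close> is a single
  cell, and its star \<open>P\<close> is a convex neighbourhood of the relative interior of \<open>\<sigma>\<close> that meets the support
  of \<open>K\<^sub>0\<close> only in the boundary of \<open>\<sigma>\<close>. Hence \<open>\<Gamma>\<close> can be refined near \<open>P\<close> by the arrangement without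
  touching \<open>K\<^sub>0\<close>. The part of \<open>\<Gamma>\<close> outside the interior of \<open>P\<close> is kept. It refines the boundary of the
  fan of cells in \<open>P\<close>, and this refinement extends over \<open>P\<close> without subdividing \<open>\<sigma>\<close>.
\<close>

text \<open>
  \<open>M\<close> stands for the functionals and \<open>N\<close> for the vectors that come from the lattice. That \<open>u n\<close> is an
  integer for \<open>u \<in> M\<close> and \<open>n \<in> N\<close> enters only through \<open>mult_M\<close> and \<open>scale_N\<close>.
\<close>

locale rational_space = vector_space scale
  for scale :: "'r::linordered_field \<Rightarrow> 'v::ab_group_add \<Rightarrow> 'v" (infixr \<open>*s\<close> 75) +
  fixes M :: "('v \<Rightarrow> 'r) set" and N :: "'v set"
  assumes M_add: "u \<in> M \<Longrightarrow> u (x + y) = u x + u y"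
    and M_scale: "u \<in> M \<Longrightarrow> u (c *s x) = c * u x"
    and zero_M: "(\<lambda>_. 0) \<in> M"
    and add_M: "u \<in> M \<Longrightarrow> w \<in> M \<Longrightarrow> (\<lambda>x. u x + w x) \<in> M"
    and uminus_M: "u \<in> M \<Longrightarrow> (\<lambda>x. - u x) \<in> M"
    and zero_N: "0 \<in> N"
    and add_N: "m \<in> N \<Longrightarrow> n \<in> N \<Longrightarrow> m + n \<in> N"
    and uminus_N: "n \<in> N \<Longrightarrow> - n \<in> N"
    and mult_M: "u \<in> M \<Longrightarrow> w \<in> M \<Longrightarrow> n \<in> N \<Longrightarrow> (\<lambda>x. u n * w x) \<in> M"
    and scale_N: "u \<in> M \<Longrightarrow> m \<in> N \<Longrightarrow> n \<in> N \<Longrightarrow> u m *s n \<in> N"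
    and dual_bases: "\<exists>I e \<epsilon>. finite (I :: nat set) \<and> e ` I \<subseteq> N \<and> \<epsilon> ` I \<subseteq> M \<and>
      (\<forall>x. x = (\<Sum>i\<in>I. \<epsilon> i x *s e i))"
begin

lemma M_zero: "u \<in> M \<Longrightarrow> u 0 = 0"
  using M_add[of u 0 0] by simp

lemma M_minus: "u \<in> M \<Longrightarrow> u (- x) = - u x"
  using M_add[of u x "- x"] M_zero[of u] by (simp add: eq_neg_iff_add_eq_0 add.commute)

lemma M_diff: "u \<in> M \<Longrightarrow> u (x - y) = u x - u y"
  using M_add[of u x "- y"] M_minus[of u y] by simp

lemmas M_linear = M_add M_scale M_zero M_minus M_diff

lemma sum_M: "finite L \<Longrightarrow> L \<subseteq> M \<Longrightarrow> (\<lambda>x. \<Sum>u\<in>L. u x) \<in> M"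
  by (induction L rule: finite_induct) (auto simp: zero_M intro: add_M)

lemma half_add_half: "(1/2) *s x + (1/2) *s x = x"
  by (metis field_sum_of_halves scale_left_distrib scale_one)


subsection \<open>Cones, faces and relative interiors\<close>

definition is_cone :: "'v set \<Rightarrow> bool" where
  "is_cone C \<longleftrightarrow> 0 \<in> C \<and> (\<forall>x\<in>C. \<forall>y\<in>C. x + y \<in> C) \<and> (\<forall>x\<in>C. \<forall>c\<ge>0. c *s x \<in> C)"

definition rat_cone :: "'v set \<Rightarrow> bool" where
  "rat_cone C \<longleftrightarrow> (\<exists>L. finite L \<and> L \<subseteq> M \<and> C = {x. \<forall>u\<in>L. 0 \<le> u x})"

definition pointed :: "'v set \<Rightarrow> bool" where
  "pointed C \<longleftrightarrow> (\<forall>x. x \<in> C \<longrightarrow> - x \<in> C \<longrightarrow> x = 0)"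

text \<open>For rational cones these are the exposed faces, see \<open>face_rat_cone\<close> and \<open>face_hyperplane\<close>.\<close>

definition face :: "'v set \<Rightarrow> 'v set \<Rightarrow> bool" where
  "face F C \<longleftrightarrow> is_cone F \<and> F \<subseteq> C \<and> (\<forall>x\<in>C. \<forall>y\<in>C. x + y \<in> F \<longrightarrow> x \<in> F)"

text \<open>For polyhedral cones this is the usual relative interior. The algebraic form avoids
  topology over \<open>'r\<close> and turns membership into a supply of backward steps.\<close>

definition rel_int :: "'v set \<Rightarrow> 'v set" where
  "rel_int C = {p \<in> C. \<forall>x\<in>C. \<exists>t>0. p - t *s x \<in> C}"

text \<open>For a cone \<open>C\<close> and \<open>x \<in> C\<close> this is the smallest face of
  \<open>C\<close> containing \<open>x\<close>, by \<open>face_face_at\<close>,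
  \<open>mem_face_at\<close> and \<open>face_at_subset\<close>.\<close>

definition face_at :: "'v set \<Rightarrow> 'v \<Rightarrow> 'v set" where
  "face_at C x = {y \<in> C. \<exists>t>0. x - t *s y \<in> C}"

text \<open>Serves two purposes: adding a generator in \<open>fin_gen\<close> and building a cone
  over \<open>C\<close> with apex direction \<open>p\<close> in \<open>cone_off\<close>.\<close>

definition adjoin :: "'v \<Rightarrow> 'v set \<Rightarrow> 'v set" where
  "adjoin p C = {y + t *s p | y t. y \<in> C \<and> 0 \<le> t}"

lemma cone_zero: "is_cone C \<Longrightarrow> 0 \<in> C"
  and cone_add: "is_cone C \<Longrightarrow> x \<in> C \<Longrightarrow> y \<in> C \<Longrightarrow> x + y \<in> C"
  and cone_scale: "is_cone C \<Longrightarrow> x \<in> C \<Longrightarrow> 0 \<le> c \<Longrightarrow> c *s x \<in> C"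
  by (auto simp: is_cone_def)

lemma cone_scale_iff: "is_cone C \<Longrightarrow> 0 < c \<Longrightarrow> c *s x \<in> C \<longleftrightarrow> x \<in> C"
  using cone_scale[of C "c *s x" "1 / c"] cone_scale[of C x c] by auto

lemma is_cone_Int: "is_cone C \<Longrightarrow> is_cone D \<Longrightarrow> is_cone (C \<inter> D)"
  by (auto simp: is_cone_def)

lemma rat_cone_is_cone: "rat_cone C \<Longrightarrow> is_cone C"
  unfolding rat_cone_def is_cone_def by (auto simp: M_linear subset_iff)

lemma rat_cone_Int:
  assumes "rat_cone C" "rat_cone D"
  shows "rat_cone (C \<inter> D)"
proof -
  obtain K L where "finite K" "K \<subseteq> M" "C = {x. \<forall>u\<in>K. 0 \<le> u x}"
    and "finite L" "L \<subseteq> M" "D = {x. \<forall>u\<in>L. 0 \<le> u x}"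
    using assms unfolding rat_cone_def by blast
  then show ?thesis
    unfolding rat_cone_def by (intro exI[of _ "K \<union> L"]) auto
qed

lemma pointed_subset: "pointed C \<Longrightarrow> D \<subseteq> C \<Longrightarrow> pointed D"
  by (auto simp: pointed_def)

lemma face_subset: "face F C \<Longrightarrow> F \<subseteq> C"
  and face_is_cone: "face F C \<Longrightarrow> is_cone F"
  by (auto simp: face_def)

lemma faceD: "face F C \<Longrightarrow> x \<in> C \<Longrightarrow> y \<in> C \<Longrightarrow> x + y \<in> F \<Longrightarrow> x \<in> F"
  by (auto simp: face_def)

lemma face_refl: "is_cone C \<Longrightarrow> face C C"
  by (auto simp: face_def)

lemma face_trans:
  assumes "face E F" "face F C"
  shows "face E C"
proof -
  have "x \<in> E" if "x \<in> C" "y \<in> C" "x + y \<in> E" for x y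
  proof -
    have "x + y \<in> F" "y + x \<in> F" using that assms by (auto simp: add.commute dest: face_subset)
    then have "x \<in> F" "y \<in> F" using faceD[OF assms(2)] that by blast+
    then show "x \<in> E" using faceD[OF assms(1)] that by blast
  qed
  then show ?thesis
    using face_is_cone[OF assms(1)] face_subset[OF assms(1)] face_subset[OF assms(2)]
    unfolding face_def by auto
qed

lemma face_Int:
  assumes "face E C" "face F D"
  shows "face (E \<inter> F) (C \<inter> D)"
  unfolding face_def
proof (intro conjI ballI impI)
  show "is_cone (E \<inter> F)" "E \<inter> F \<subseteq> C \<inter> D"
    using assms by (auto intro!: is_cone_Int dest: face_is_cone face_subset)
  fix x y assume "x \<in> C \<inter> D" "y \<in> C \<inter> D" "x + y \<in> E \<inter> F"
  then show "x \<in> E \<inter> F"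
    using faceD[OF assms(1)] faceD[OF assms(2)] by blast
qed

text \<open>A positive multiple of each \<open>y \<in> D\<close> is a summand of \<open>x\<close>
  within \<open>D\<close>, so the face property pulls it into \<open>F\<close>.\<close>

lemma face_contains:
  assumes "face F C" "D \<subseteq> C" "is_cone D" "x \<in> rel_int D" "x \<in> F"
  shows "D \<subseteq> F"
proof
  fix y assume y: "y \<in> D"
  obtain t where t: "t > 0" "x - t *s y \<in> D"
    using assms(4) y unfolding rel_int_def by auto
  moreover have "t *s y \<in> D" using assms(3) y t by (simp add: cone_scale)
  ultimately have "t *s y \<in> F"
    using faceD[OF assms(1), of "t *s y" "x - t *s y"] assms(2,5) by auto
  then show "y \<in> F" using t face_is_cone[OF assms(1)] by (simp add: cone_scale_iff)
qed

section \<open>Relative interiors and minimal faces\<close>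

lemma rel_int_subset: "rel_int C \<subseteq> C"
  by (auto simp: rel_int_def)

lemma cone_step_less:
  assumes "is_cone C" "x - t *s y \<in> C" "y \<in> C" "s \<le> t"
  shows "x - s *s y \<in> C"
proof -
  have "x - s *s y = (x - t *s y) + (t - s) *s y"
    by (simp add: scale_left_diff_distrib)
  then show ?thesis
    using assms by (metis cone_add cone_scale diff_ge_0_iff_ge)
qed

lemma cone_step_pos:
  assumes "is_cone C" "x - t *s y \<in> C" "0 < t" "0 < c"
  shows "c *s x - (c * t) *s y \<in> C"
  using cone_scale[OF assms(1,2), of c] assms by (simp add: scale_right_diff_distrib)

lemma rel_int_add:
  assumes "is_cone C" "p \<in> rel_int C" "y \<in> C"
  shows "p + y \<in> rel_int C"
  unfolding rel_int_def
proof safe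
  show "p + y \<in> C" using assms rel_int_subset by (blast intro: cone_add)
  fix x assume "x \<in> C"
  then obtain t where t: "t > 0" "p - t *s x \<in> C"
    using assms(2) by (auto simp: rel_int_def)
  have "p + y - t *s x = (p - t *s x) + y" by simp
  then show "\<exists>t>0. p + y - t *s x \<in> C"
    using t assms by (metis cone_add)
qed

lemma rel_int_scale:
  assumes "is_cone C" "p \<in> rel_int C" "0 < c"
  shows "c *s p \<in> rel_int C"
  unfolding rel_int_def
proof safe
  show "c *s p \<in> C" using assms rel_int_subset by (auto intro!: cone_scale)
  fix x assume "x \<in> C"
  then obtain t where t: "t > 0" "p - t *s x \<in> C"
    using assms(2) by (auto simp: rel_int_def)
  then show "\<exists>t>0. c *s p - t *s x \<in> C"
    using cone_step_pos[OF assms(1) t(2,1) assms(3)] assms(3) by (intro exI[of _ "c * t"]) auto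
qed

lemma face_face_at:
  assumes C: "is_cone C" and x: "x \<in> C"
  shows "face (face_at C x) C"
  unfolding face_def
proof (intro conjI ballI impI)
  show "is_cone (face_at C x)"
    unfolding is_cone_def
  proof (intro conjI ballI allI impI)
    show "0 \<in> face_at C x"
      using C x by (auto simp: face_at_def is_cone_def intro: exI[of _ 1])
  next
    fix y z assume "y \<in> face_at C x" "z \<in> face_at C x"
    then obtain s t where st: "y \<in> C" "z \<in> C" "s > 0" "t > 0" "x - s *s y \<in> C" "x - t *s z \<in> C"
      by (auto simp: face_at_def)
    \<comment> \<open>One half of \<open>x\<close> pays for the step along \<open>y\<close>, the
      other half for the step along \<open>z\<close>.\<close>
    let ?r = "min s t / 2"
    have "x - (2 * ?r) *s y \<in> C" "x - (2 * ?r) *s z \<in> C"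
      using st C by (auto intro: cone_step_less)
    then have "(1/2) *s x - ?r *s y \<in> C" "(1/2) *s x - ?r *s z \<in> C"
      using cone_step_pos[OF C, of x "2 * ?r" _ "1/2"] st by auto
    then have "((1/2) *s x - ?r *s y) + ((1/2) *s x - ?r *s z) \<in> C"
      by (rule cone_add[OF C])
    also have "((1/2) *s x - ?r *s y) + ((1/2) *s x - ?r *s z)
        = ((1/2) *s x + (1/2) *s x) - ?r *s (y + z)"
      by (simp add: scale_right_distrib)
    finally have "x - ?r *s (y + z) \<in> C" by (simp only: half_add_half)
    then show "y + z \<in> face_at C x"
      unfolding face_at_def using st C by (auto intro!: cone_add exI[of _ ?r])
  next
    fix y and c :: 'r assume "y \<in> face_at C x" "0 \<le> c"
    then obtain s where s: "y \<in> C" "s > 0" "x - s *s y \<in> C"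
      by (auto simp: face_at_def)
    have "\<exists>t>0. x - (t * c) *s y \<in> C"
    proof (cases "c = 0")
      case True then show ?thesis using x by (intro exI[of _ 1]) simp
    next
      case False then show ?thesis
        using s \<open>0 \<le> c\<close> by (intro exI[of _ "s / c"]) simp
    qed
    then show "c *s y \<in> face_at C x"
      using s C \<open>0 \<le> c\<close> by (auto simp: face_at_def intro: cone_scale)
  qed
  show "face_at C x \<subseteq> C" by (auto simp: face_at_def)
  fix y z assume yz: "y \<in> C" "z \<in> C" "y + z \<in> face_at C x"
  then obtain t where t: "t > 0" "x - t *s (y + z) \<in> C" by (auto simp: face_at_def)
  have "x - t *s y = (x - t *s (y + z)) + t *s z"
    by (simp add: scale_right_distrib)
  then have "x - t *s y \<in> C"
    using t yz C by (metis cone_add cone_scale less_imp_le)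
  then show "y \<in> face_at C x"
    using t yz by (auto simp: face_at_def)
qed

lemma face_at_subset:
  assumes "face F C" "is_cone C" "x \<in> F"
  shows "face_at C x \<subseteq> F"
proof
  fix y assume "y \<in> face_at C x"
  then obtain t where t: "y \<in> C" "t > 0" "x - t *s y \<in> C" by (auto simp: face_at_def)
  moreover have "t *s y \<in> C" using assms(2) t by (simp add: cone_scale)
  ultimately have "t *s y \<in> F"
    using faceD[OF assms(1), of "t *s y" "x - t *s y"] assms(3) by auto
  then show "y \<in> F" using t face_is_cone[OF assms(1)] by (simp add: cone_scale_iff)
qed

lemma mem_face_at: "is_cone C \<Longrightarrow> x \<in> C \<Longrightarrow> x \<in> face_at C x"
  by (auto simp: face_at_def is_cone_def intro!: exI[of _ 1])

text \<open>Together with \<open>face_at_eq\<close> this makes each point of a cone a relative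
  interior point of exactly one face, so faces can be recovered from single points.\<close>

lemma rel_int_face_at:
  assumes C: "is_cone C" and x: "x \<in> C"
  shows "x \<in> rel_int (face_at C x)"
  unfolding rel_int_def
proof safe
  show x': "x \<in> face_at C x" using assms by (rule mem_face_at)
  fix y assume y: "y \<in> face_at C x"
  then obtain t where t: "t > 0" "x - t *s y \<in> C" "y \<in> C" by (auto simp: face_at_def)
  have f: "face (face_at C x) C" using assms by (rule face_face_at)
  have "x - t *s y \<in> face_at C x"
    by (rule faceD[OF f, of _ "t *s y"]) (use t x' C in \<open>auto intro: cone_scale\<close>)
  then show "\<exists>t>0. x - t *s y \<in> face_at C x" using t by auto
qed

lemma face_at_eq:
  assumes "face F C" "is_cone C" "x \<in> rel_int F"
  shows "face_at C x = F"
proof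
  have x: "x \<in> F" "x \<in> C"
    using assms rel_int_subset face_subset by blast+
  show "face_at C x \<subseteq> F" using assms(1,2) x(1) by (rule face_at_subset)
  show "F \<subseteq> face_at C x"
    by (rule face_contains[OF face_face_at[OF assms(2) x(2)] face_subset[OF assms(1)]
          face_is_cone[OF assms(1)] assms(3) mem_face_at[OF assms(2) x(2)]])
qed

lemma face_at_Int:
  assumes C: "is_cone C" and D: "is_cone D"
  shows "face_at (C \<inter> D) x = face_at C x \<inter> face_at D x"
proof
  show "face_at (C \<inter> D) x \<subseteq> face_at C x \<inter> face_at D x"
    by (auto simp: face_at_def)
  show "face_at C x \<inter> face_at D x \<subseteq> face_at (C \<inter> D) x"
  proof
    fix y assume "y \<in> face_at C x \<inter> face_at D x"
    then obtain s t where st: "y \<in> C" "y \<in> D" "s > 0" "t > 0" "x - s *s y \<in> C" "x - t *s y \<in> D"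
      by (auto simp: face_at_def)
    then have "x - min s t *s y \<in> C" "x - min s t *s y \<in> D"
      using C D by (auto intro: cone_step_less)
    then show "y \<in> face_at (C \<inter> D) x"
      using st by (auto simp: face_at_def intro!: exI[of _ "min s t"])
  qed
qed

section \<open>Small steps, exposing functionals and exit points\<close>

text \<open>A constraint that is strict at \<open>x\<close> leaves room for a short step, and one
  with \<open>u z \<le> 0\<close> is never violated. All step lengths up to \<open>t\<close> are
  covered so that the induction can shrink \<open>t\<close>.\<close>

lemma small_step:
  fixes L :: "('v \<Rightarrow> 'r) set"
  assumes "finite L" "\<forall>u\<in>L. 0 < u x \<or> 0 \<le> u x \<and> u z \<le> 0"
  shows "\<exists>t>0. \<forall>s. 0 \<le> s \<longrightarrow> s \<le> t \<longrightarrow> (\<forall>u\<in>L. 0 \<le> u x - s * u z)"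
  using assms
proof (induction L rule: finite_induct)
  case empty
  show ?case by (intro exI[of _ 1]) auto
next
  case (insert u L)
  then obtain t where t: "t > 0" "\<And>s. 0 \<le> s \<Longrightarrow> s \<le> t \<Longrightarrow> \<forall>u\<in>L. 0 \<le> u x - s * u z"
    by auto
  show ?case
  proof (cases "u z \<le> 0")
    case True
    then have "0 \<le> u x - s * u z" if "0 \<le> s" for s
      using insert.prems that mult_nonneg_nonpos[of s "u z"] by fastforce
    then show ?thesis using t by (intro exI[of _ t]) auto
  next
    case False
    then have u: "u x > 0" "u z > 0" using insert.prems by auto
    have "0 \<le> u x - s * u z" if "s \<le> u x / u z" for s
      using that u by (simp add: pos_le_divide_eq)
    then show ?thesis using t u by (intro exI[of _ "min t (u x / u z)"]) auto
  qed
qed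

lemma small_step_cone:
  assumes "finite L" "L \<subseteq> M" "\<forall>u\<in>L. 0 < u x \<or> 0 \<le> u x \<and> u z \<le> 0"
  shows "\<exists>t>0. \<forall>u\<in>L. 0 \<le> u (x - t *s z)"
proof -
  obtain t where "t > 0" "\<forall>u\<in>L. 0 \<le> u x - t * u z"
    using small_step[OF assms(1,3)] by (meson less_imp_le order_refl)
  then show ?thesis using assms(2) by (auto simp: M_linear subset_iff)
qed

text \<open>Add up witnesses on which the individual functionals do not vanish; nonnegativity rules
  out cancellation.\<close>

lemma ex_generic_point:
  assumes F: "is_cone F" and "finite L" "L \<subseteq> M" "\<forall>u\<in>L. \<forall>x\<in>F. 0 \<le> u x"
  shows "\<exists>x\<in>F. \<forall>u\<in>L. u x = 0 \<longrightarrow> (\<forall>y\<in>F. u y = 0)"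
  using assms(2-4)
proof (induction L rule: finite_induct)
  case empty
  show ?case using cone_zero[OF F] by auto
next
  case (insert u L)
  then obtain x where x: "x \<in> F" "\<forall>u\<in>L. u x = 0 \<longrightarrow> (\<forall>y\<in>F. u y = 0)" by auto
  show ?case
  proof (cases "\<forall>y\<in>F. u y = 0")
    case True
    then show ?thesis using x by auto
  next
    case False
    then obtain y where y: "y \<in> F" "u y \<noteq> 0" by auto
    have nonneg: "0 \<le> w x" "0 \<le> w y" if "w \<in> insert u L" for w
      using insert.prems x y that by auto
    have eq: "w (x + y) = w x + w y" if "w \<in> insert u L" for w
      using insert.prems that by (auto simp: M_linear)
    have "\<forall>w\<in>insert u L. w (x + y) = 0 \<longrightarrow> (\<forall>y\<in>F. w y = 0)"
    proof (intro ballI impI)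
      fix w z assume w: "w \<in> insert u L" "w (x + y) = 0" and z: "z \<in> F"
      have "w x = 0" "w y = 0"
        using nonneg[OF w(1)] eq[OF w(1)] w(2) by (simp_all add: add_nonneg_eq_0_iff)
      then show "w z = 0" using w(1) x(2) y(2) z by auto
    qed
    then show ?thesis using cone_add[OF F x(1) y(1)] by blast
  qed
qed

text \<open>The exposing functional is the sum of the constraints of \<open>C\<close> that vanish at
  a generic point \<open>x\<close> of \<open>F\<close>. Where the sum vanishes, each summand does,
  so a small step from \<open>x\<close> against \<open>z\<close> stays in \<open>C\<close> and
  \<open>z\<close> lies in the minimal face of \<open>x\<close>.\<close>

lemma face_rat_cone:
  assumes "rat_cone C" "face F C"
  obtains u where "u \<in> M" "\<forall>x\<in>C. 0 \<le> u x" "F = {x \<in> C. u x = 0}"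
proof -
  obtain L where L: "finite L" "L \<subseteq> M" "C = {x. \<forall>u\<in>L. 0 \<le> u x}"
    using assms(1) unfolding rat_cone_def by blast
  have F: "is_cone F" "F \<subseteq> C" using assms(2) by (auto simp: face_def)
  obtain x where x: "x \<in> F" "\<forall>u\<in>L. u x = 0 \<longrightarrow> (\<forall>y\<in>F. u y = 0)"
    using ex_generic_point[OF F(1) L(1,2)] F(2) L(3) by blast
  let ?L = "{u \<in> L. u x = 0}"
  define w where "w = (\<lambda>y. \<Sum>u\<in>?L. u y)"
  have w: "w \<in> M" unfolding w_def using L by (intro sum_M) auto
  have nonneg: "\<forall>y\<in>C. 0 \<le> w y"
    unfolding w_def using L(3) by (auto intro!: sum_nonneg)
  have "F = {y \<in> C. w y = 0}"
  proof
    show "F \<subseteq> {y \<in> C. w y = 0}"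
      using F(2) x unfolding w_def by (auto intro!: sum.neutral)
    show "{y \<in> C. w y = 0} \<subseteq> F"
    proof safe
      fix z assume z: "z \<in> C" "w z = 0"
      have nonneg: "\<forall>u\<in>?L. 0 \<le> u z" "finite ?L" using z(1) L(1) unfolding L(3) by auto
      have "u z = 0" if "u \<in> ?L" for u
        using z(2) sum_nonneg_eq_0_iff[OF nonneg(2), of "\<lambda>u. u z"] nonneg(1) that
        unfolding w_def by blast
      moreover have "0 \<le> u x" if "u \<in> L" for u
        using x(1) F(2) that unfolding L(3) by blast
      ultimately have "\<forall>u\<in>L. 0 < u x \<or> 0 \<le> u x \<and> u z \<le> 0"
        by force
      then obtain t where t: "t > 0" "x - t *s z \<in> C"
        using small_step_cone[OF L(1,2)] L(3) by blast
      then have "z \<in> face_at C x" using z by (auto simp: face_at_def)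
      then show "z \<in> F"
        using face_at_subset[OF assms(2) rat_cone_is_cone[OF assms(1)] x(1)] by blast
    qed
  qed
  then show ?thesis using that w nonneg by blast
qed

lemma rat_cone_face:
  assumes "rat_cone C" "face F C"
  shows "rat_cone F"
proof -
  obtain u where u: "u \<in> M" "\<forall>x\<in>C. 0 \<le> u x" "F = {x \<in> C. u x = 0}"
    using assms by (rule face_rat_cone)
  have "rat_cone {x. \<forall>w\<in>{u, \<lambda>x. - u x}. 0 \<le> w x}"
    unfolding rat_cone_def
    by (rule exI[of _ "{u, \<lambda>x. - u x}"]) (simp add: u(1) uminus_M)
  then have "rat_cone (C \<inter> {x. \<forall>w\<in>{u, \<lambda>x. - u x}. 0 \<le> w x})"
    by (rule rat_cone_Int[OF assms(1)])
  also have "C \<inter> {x. \<forall>w\<in>{u, \<lambda>x. - u x}. 0 \<le> w x} = F"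
    unfolding u(3) by auto
  finally show ?thesis .
qed

text \<open>Stated for any linear functional, not only for members of \<open>M\<close>, since
  \<open>is_face_of\<close> allows arbitrary ones.\<close>

lemma face_hyperplane:
  assumes "is_cone C" "\<And>x y. u (x + y) = u x + u y" "\<And>c x. u (c *s x) = c * u x"
    "\<forall>x\<in>C. 0 \<le> (u x :: 'r)"
  shows "face {x \<in> C. u x = 0} C"
proof -
  have "u 0 = 0" using assms(2)[of 0 0] by simp
  then show ?thesis
    using assms unfolding face_def is_cone_def by (auto simp: add_nonneg_eq_0_iff)
qed

text \<open>Ratio test: \<open>t\<close> is the least quotient \<open>u x / u p\<close> over the
  constraints with \<open>u p > 0\<close>. There is such a constraint because
  \<open>- p \<notin> C\<close>, and a minimizing one is violated by any further step.\<close>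

lemma exit_point:
  assumes "rat_cone C" "x \<in> C" "p \<in> C" "- p \<notin> C"
  obtains t where "0 \<le> t" "x - t *s p \<in> C" "\<And>e. e > 0 \<Longrightarrow> x - t *s p - e *s p \<notin> C"
proof -
  obtain L where L: "finite L" "L \<subseteq> M" "C = {x. \<forall>u\<in>L. 0 \<le> u x}"
    using assms(1) unfolding rat_cone_def by blast
  have lin: "u (x - t *s p) = u x - t * u p" if "u \<in> L" for u x t
    using that L(2) by (auto simp: M_linear)
  let ?Q = "{u \<in> L. u p > 0}" and ?q = "\<lambda>u. u x / u p"
  have "?Q \<noteq> {}"
  proof -
    obtain u where "u \<in> L" "u (- p) < 0"
      using assms(4) unfolding L(3) by (auto simp: not_le)
    then show ?thesis using L(2) by (auto simp: M_linear subset_iff)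
  qed
  define t where "t = Min (?q ` ?Q)"
  have fin: "finite (?q ` ?Q)" "?q ` ?Q \<noteq> {}" using L(1) \<open>?Q \<noteq> {}\<close> by auto
  have pos: "0 \<le> u x" "0 \<le> u p" if "u \<in> L" for u
    using that assms(2,3) unfolding L(3) by auto
  obtain u where u: "u \<in> L" "u p > 0" "t = u x / u p"
    using Min_in[OF fin] unfolding t_def by blast
  show ?thesis
  proof (rule that[of t])
    show "0 \<le> t" using u pos by simp
    have "0 \<le> w x - t * w p" if "w \<in> L" for w
    proof (cases "w p > 0")
      case True
      then have "t \<le> w x / w p" unfolding t_def using that fin by (intro Min_le) auto
      then show ?thesis using True by (simp add: pos_le_divide_eq)
    next
      case False
      then show ?thesis using pos[OF that] by auto
    qed
    then show "x - t *s p \<in> C" unfolding L(3) by (simp add: lin)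
    fix e :: 'r assume "e > 0"
    have "x - t *s p - e *s p = x - (t + e) *s p"
      by (simp add: scale_left_distrib diff_diff_eq)
    moreover have "u (x - (t + e) *s p) = - (e * u p)"
      using u lin[OF u(1), of x "t + e"] by (simp add: distrib_right)
    moreover have "0 < e * u p" using u \<open>e > 0\<close> by simp
    ultimately have "u (x - t *s p - e *s p) < 0" by (simp only: neg_less_0_iff_less)
    then show "x - t *s p - e *s p \<notin> C"
      unfolding L(3) using u(1) by (auto simp: not_le intro!: bexI[of _ u])
  qed
qed

text \<open>A relative interior point would allow one more step against \<open>p\<close>, so the
  last point on the way out is not one. This yields the boundary part of the decomposition used in
  coning off.\<close>

lemma pointed_exit:
  assumes "rat_cone C" "pointed C" "x \<in> C" "p \<in> C" "p \<noteq> 0"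
  obtains t where "0 \<le> t" "x - t *s p \<in> C" "x - t *s p \<notin> rel_int C"
proof -
  have "- p \<notin> C" using assms(2,4,5) unfolding pointed_def by blast
  then obtain t where "0 \<le> t" "x - t *s p \<in> C" "\<And>e. e > 0 \<Longrightarrow> x - t *s p - e *s p \<notin> C"
    using exit_point[OF assms(1,3,4)] by blast
  moreover from this have "x - t *s p \<notin> rel_int C"
    using assms(4) unfolding rel_int_def by blast
  ultimately show ?thesis using that by blast
qed


subsection \<open>Finitely generated cones\<close>

lemma adjoinI: "y \<in> C \<Longrightarrow> 0 \<le> t \<Longrightarrow> y + t *s p \<in> adjoin p C"
  by (auto simp: adjoin_def)

lemma adjoinE:
  assumes "x \<in> adjoin p C"
  obtains y t where "x = y + t *s p" "y \<in> C" "0 \<le> t"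
  using assms by (auto simp: adjoin_def)

lemma subset_adjoin: "C \<subseteq> adjoin p C"
  using adjoinI[of _ C 0 p] by auto

lemma mem_adjoin: "is_cone C \<Longrightarrow> p \<in> adjoin p C"
  using adjoinI[of 0 C 1 p] cone_zero by auto

lemma is_cone_adjoin:
  assumes C: "is_cone C"
  shows "is_cone (adjoin p C)"
  unfolding is_cone_def
proof (intro conjI ballI allI impI)
  show "0 \<in> adjoin p C" using subset_adjoin cone_zero[OF C] by blast
next
  fix x x' assume "x \<in> adjoin p C" "x' \<in> adjoin p C"
  then obtain y t y' t' where *: "x = y + t *s p" "y \<in> C" "0 \<le> t" "x' = y' + t' *s p" "y' \<in> C" "0 \<le> t'"
    by (auto elim!: adjoinE)
  then have eq: "x + x' = (y + y') + (t + t') *s p"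
    by (simp add: scale_left_distrib algebra_simps)
  show "x + x' \<in> adjoin p C"
    unfolding eq using * cone_add[OF C] by (intro adjoinI) auto
next
  fix x and c :: 'r assume "x \<in> adjoin p C" "0 \<le> c"
  then obtain y t where *: "x = y + t *s p" "y \<in> C" "0 \<le> t"
    by (auto elim!: adjoinE)
  then have eq: "c *s x = c *s y + (c * t) *s p" by (simp add: scale_right_distrib)
  show "c *s x \<in> adjoin p C"
    unfolding eq using * \<open>0 \<le> c\<close> cone_scale[OF C] by (intro adjoinI) auto
qed

lemma adjoin_subset:
  assumes "is_cone D" "C \<subseteq> D" "p \<in> D"
  shows "adjoin p C \<subseteq> D"
  using assms by (auto elim!: adjoinE intro!: cone_add cone_scale)

lemma diff_M: "u \<in> M \<Longrightarrow> w \<in> M \<Longrightarrow> (\<lambda>x. u x - w x) \<in> M"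
  using add_M[of u "\<lambda>x. - w x"] uminus_M[of w] by simp

lemma diff_N: "m \<in> N \<Longrightarrow> n \<in> N \<Longrightarrow> m - n \<in> N"
  using add_N[of m "- n"] uminus_N[of n] by simp

text \<open>Fourier--Motzkin elimination of the coefficient of \<open>v\<close>.\<close>

lemma rat_cone_adjoin:
  assumes "rat_cone C" "v \<in> N"
  shows "rat_cone (adjoin v C)"
proof -
  obtain L where L: "finite L" "L \<subseteq> M" "C = {x. \<forall>u\<in>L. 0 \<le> u x}"
    using assms(1) unfolding rat_cone_def by blast
  define Q where "Q = {u \<in> L. 0 < u v} \<times> {w \<in> L. w v < 0}"
  \<comment> \<open>This nonnegative combination of \<open>u\<close> and \<open>w\<close> vanishes
    at \<open>v\<close>. It stays in \<open>M\<close> by \<open>mult_M\<close> because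
    \<open>v \<in> N\<close>.\<close>
  define h where "h = (\<lambda>(u :: 'v \<Rightarrow> 'r, w) x. u v * w x + - (w v * u x))"
  define L' where "L' = {u \<in> L. 0 \<le> u v} \<union> h ` Q"
  have "L' \<subseteq> M"
    using L(2) assms(2) unfolding L'_def Q_def h_def
    by (auto intro!: diff_M mult_M)
  moreover have "finite L'" using L(1) unfolding L'_def Q_def by auto
  moreover have "adjoin v C = {x. \<forall>u\<in>L'. 0 \<le> u x}"
  proof (intro equalityI subsetI)
    fix x assume "x \<in> adjoin v C"
    then obtain y t where yt: "x = y + t *s v" "y \<in> C" "0 \<le> t"
      by (auto elim!: adjoinE)
    have eq: "u x = u y + t * u v" if "u \<in> L" for u
      using that L(2) yt by (auto simp: M_linear)
    have nonneg: "0 \<le> u y" if "u \<in> L" for u using that yt(2) L(3) by blast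
    have "0 \<le> u x" if "u \<in> L" "0 \<le> u v" for u
      using eq[OF that(1)] nonneg[OF that(1)] that(2) yt(3) by simp
    moreover have "0 \<le> h (u, w) x" if "(u, w) \<in> Q" for u w
    proof -
      have *: "u \<in> L" "w \<in> L" "0 < u v" "w v < 0" using that by (auto simp: Q_def)
      then have "h (u, w) x = u v * w y + (- w v) * u y"
        unfolding h_def by (simp add: eq algebra_simps)
      then show ?thesis
        using * nonneg by (metis add_nonneg_nonneg less_imp_le mult_nonneg_nonneg neg_0_le_iff_le)
    qed
    ultimately show "x \<in> {x. \<forall>u\<in>L'. 0 \<le> u x}"
      unfolding L'_def by auto
  next
    fix x assume "x \<in> {x. \<forall>u\<in>L'. 0 \<le> u x}"
    then have x: "\<And>u. u \<in> L \<Longrightarrow> 0 \<le> u v \<Longrightarrow> 0 \<le> u x"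
      and xh: "\<And>u w. u \<in> L \<Longrightarrow> w \<in> L \<Longrightarrow> 0 < u v \<Longrightarrow> w v < 0 \<Longrightarrow> 0 \<le> h (u, w) x"
      unfolding L'_def Q_def by auto
    \<comment> \<open>\<open>T\<close> collects the lower bounds on the coefficient of
      \<open>v\<close>: zero, and one bound from each constraint that is negative at
      \<open>v\<close>. The inequalities for \<open>h\<close> say that none of them exceeds an upper
      bound, so the largest lower bound is a valid coefficient.\<close>
    define T where "T = insert 0 ((\<lambda>w. w x / w v) ` {w \<in> L. w v < 0})"
    have T: "finite T" "T \<noteq> {}" using L(1) by (auto simp: T_def)
    define t where "t = Max T"
    have "0 \<le> t" unfolding t_def using T by (auto simp: T_def)
    have "0 \<le> u (x - t *s v)" if u: "u \<in> L" for u
    proof -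
      have "u (x - t *s v) = u x - t * u v" using u L(2) by (auto simp: M_linear)
      moreover have "t * u v \<le> u x"
      proof (cases "u v" "0 :: 'r" rule: linorder_cases)
        case less
        then have "u x / u v \<le> t" unfolding t_def using T u by (auto simp: T_def)
        then show ?thesis using less by (simp add: neg_divide_le_eq)
      next
        case equal
        then show ?thesis using x u by auto
      next
        case greater
        have "s \<le> u x / u v" if sT: "s \<in> T" for s
        proof (cases "s = 0")
          case True
          then show ?thesis using x u greater by simp
        next
          case False
          then obtain w where w: "w \<in> L" "w v < 0" "s = w x / w v" using sT by (auto simp: T_def)
          then have "0 \<le> h (u, w) x" using xh u greater by auto
          then have "w v * u x \<le> w x * u v" by (simp add: h_def mult.commute)
          then have "w x * (1 / w v) \<le> (u x / u v)"
            using w(2) greater by (simp add: divide_simps mult.commute)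
          then show ?thesis using w(3) by simp
        qed
        then have "t \<le> u x / u v" unfolding t_def using T by simp
        then show ?thesis using greater by (simp add: pos_le_divide_eq)
      qed
      ultimately show ?thesis by simp
    qed
    then have "x - t *s v \<in> C" unfolding L(3) by blast
    then show "x \<in> adjoin v C" using adjoinI[of "x - t *s v" C t v] \<open>0 \<le> t\<close> by simp
  qed
  ultimately show ?thesis unfolding rat_cone_def by blast
qed

section \<open>The Minkowski-Weyl theorem for rational cones\<close>

inductive fin_gen :: "'v set \<Rightarrow> bool" where
  zero: "fin_gen {0}"
| adjoin: "fin_gen C \<Longrightarrow> n \<in> N \<Longrightarrow> fin_gen (adjoin n C)"

lemma rat_cone_zero: "rat_cone {0}"
proof -
  obtain I e \<epsilon> where I: "finite (I :: nat set)" "e ` I \<subseteq> N" "\<epsilon> ` I \<subseteq> M"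
    "\<And>x. x = (\<Sum>i\<in>I. \<epsilon> i x *s e i)"
    using dual_bases by blast
  let ?L = "\<epsilon> ` I \<union> (\<lambda>i x. - \<epsilon> i x) ` I"
  have "x = 0" if "\<forall>u\<in>?L. 0 \<le> u x" for x
  proof -
    have "\<epsilon> i x = 0" if "i \<in> I" for i
      using bspec[OF \<open>\<forall>u\<in>?L. 0 \<le> u x\<close>, of "\<epsilon> i"] that
        bspec[OF \<open>\<forall>u\<in>?L. 0 \<le> u x\<close>, of "\<lambda>x. - \<epsilon> i x"] by auto
    then show ?thesis using I(4)[of x] by simp
  qed
  then have "{0} = {x. \<forall>u\<in>?L. 0 \<le> u x}" using I(3) by (auto simp: M_linear)
  moreover have "?L \<subseteq> M" using I(3) uminus_M by auto
  ultimately show ?thesis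
    unfolding rat_cone_def using I(1) by (intro exI[of _ ?L]) simp
qed

lemma fin_gen_rat_cone: "fin_gen C \<Longrightarrow> rat_cone C"
  by (induction rule: fin_gen.induct) (auto intro: rat_cone_zero rat_cone_adjoin)

text \<open>The Minkowski sum. With a reflected second cone it gives the cone of differences in
  \<open>separation\<close>.\<close>

definition set_add :: "'v set \<Rightarrow> 'v set \<Rightarrow> 'v set" where
  "set_add C D = {x + y | x y. x \<in> C \<and> y \<in> D}"

lemma set_addI: "x \<in> C \<Longrightarrow> y \<in> D \<Longrightarrow> x + y \<in> set_add C D"
  by (auto simp: set_add_def)

lemma set_add_adjoin: "set_add C (adjoin n D) = adjoin n (set_add C D)"
  unfolding set_add_def adjoin_def by (auto simp: add.assoc) (metis add.assoc)+

lemma set_add_zero: "set_add C {0} = C"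
  by (auto simp: set_add_def)

lemma fin_gen_set_add:
  assumes "fin_gen C" "fin_gen D"
  shows "fin_gen (set_add C D)"
  using assms(2,1)
  by (induction rule: fin_gen.induct) (auto simp: set_add_zero set_add_adjoin intro: fin_gen.adjoin)

lemma rat_cone_set_add:
  assumes "rat_cone C" "fin_gen D"
  shows "rat_cone (set_add C D)"
  using assms(2,1)
  by (induction rule: fin_gen.induct) (auto simp: set_add_zero set_add_adjoin intro: rat_cone_adjoin)

lemma fin_gen_image:
  assumes "fin_gen C" "\<And>x y. f (x + y) = f x + f y" "\<And>c x. f (c *s x) = c *s f x" "f ` N \<subseteq> N"
  shows "fin_gen (f ` C)"
  using assms(1)
proof (induction rule: fin_gen.induct)
  case zero
  have "f 0 = 0" using assms(2)[of 0 0] by simp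
  then show ?case by (simp add: fin_gen.zero)
next
  case (adjoin C n)
  have "f ` adjoin n C = adjoin (f n) (f ` C)"
  proof (intro equalityI subsetI)
    fix x assume "x \<in> f ` adjoin n C"
    then show "x \<in> adjoin (f n) (f ` C)"
      by (auto simp: assms(2,3) elim!: adjoinE intro!: adjoinI)
  next
    fix x assume "x \<in> adjoin (f n) (f ` C)"
    then obtain y t where "x = f (y + t *s n)" "y \<in> C" "0 \<le> t"
      by (auto simp: assms(2,3) elim!: adjoinE)
    then show "x \<in> f ` adjoin n C" by (auto intro: adjoinI)
  qed
  then show ?case using adjoin assms(4) by (auto intro: fin_gen.adjoin)
qed

text \<open>Double description, one generator \<open>v\<close> at a time: the halfspace keeps
  \<open>v\<close> if \<open>0 \<le> u v\<close>, and combinations of \<open>v\<close> with vectors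
  of \<open>D\<close> on the opposite side of the hyperplane supply the generators inside the
  hyperplane.\<close>

lemma fin_gen_halfspace:
  assumes "fin_gen C" "u \<in> M"
  shows "fin_gen {x \<in> C. 0 \<le> u x}"
  using assms
proof (induction arbitrary: u rule: fin_gen.induct)
  case zero
  then have "{x \<in> {0}. 0 \<le> u x} = {0}" by (auto simp: M_zero)
  then show ?case by (simp add: fin_gen.zero)
next
  case (adjoin D v)
  have D: "is_cone D" using adjoin.hyps fin_gen_rat_cone rat_cone_is_cone by blast
  have lin: "u (x + y) = u x + u y" "u (c *s x) = c * u x" "u 0 = 0" "u (x - y) = u x - u y" for x y c
    using adjoin.prems by (auto simp: M_linear)
  let ?D = "{x \<in> D. 0 \<le> u x}" and ?E = "{x \<in> D. 0 \<le> - u x}"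
  have fg: "fin_gen ?D" "fin_gen ?E"
    using adjoin.IH[OF adjoin.prems] adjoin.IH[OF uminus_M[OF adjoin.prems]] by auto
  \<comment> \<open>\<open>u\<close> vanishes on the images of \<open>f\<close> and
    \<open>g\<close>. \<open>f d\<close> is a nonnegative combination of \<open>d\<close> and
    \<open>v\<close> when \<open>0 < u v\<close> and \<open>u d \<le> 0\<close>, and
    \<open>g d\<close> is one when \<open>u v < 0\<close> and \<open>0 \<le> u d\<close>. Both maps
    are linear and preserve \<open>N\<close>, so \<open>fin_gen_image\<close> applies.\<close>
  define f where "f = (\<lambda>d. u v *s d - u d *s v)"
  define g where "g = (\<lambda>d. u d *s v - u v *s d)"
  have f: "f (x + y) = f x + f y" "f (c *s x) = c *s f x" "n \<in> N \<Longrightarrow> f n \<in> N" for x y c n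
    unfolding f_def using adjoin.hyps(2) adjoin.prems
    by (simp_all add: lin scale_left_distrib scale_right_distrib scale_right_diff_distrib mult.commute
        diff_N scale_N)
  have g: "g (x + y) = g x + g y" "g (c *s x) = c *s g x" "n \<in> N \<Longrightarrow> g n \<in> N" for x y c n
    unfolding g_def using adjoin.hyps(2) adjoin.prems
    by (simp_all add: lin scale_left_distrib scale_right_distrib scale_right_diff_distrib mult.commute
        diff_N scale_N)
  have fgf: "fin_gen (f ` ?E)"
    by (rule fin_gen_image[OF fg(2)]) (use f in auto)
  have fgg: "fin_gen (g ` ?D)"
    by (rule fin_gen_image[OF fg(1)]) (use g in auto)
  consider "u v = 0" | "u v > 0" | "u v < 0" by linarith
  then show ?case
  proof cases
    case 1
    then have "{x \<in> adjoin v D. 0 \<le> u x} = adjoin v ?D"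
      by (auto simp: lin elim!: adjoinE intro!: adjoinI)
    then show ?thesis using fg adjoin.hyps by (auto intro: fin_gen.adjoin)
  next
    case 2
    have "{x \<in> adjoin v D. 0 \<le> u x} = set_add (adjoin v ?D) (f ` ?E)" (is "?A = ?B")
    proof
      show "?A \<subseteq> ?B"
      proof safe
        fix x assume "x \<in> adjoin v D" "0 \<le> u x"
        then obtain d t where x: "x = d + t *s v" "d \<in> D" "0 \<le> t" by (auto elim!: adjoinE)
        show "x \<in> ?B"
        proof (cases "0 \<le> u d")
          case True
          have "f 0 \<in> f ` ?E" by (rule imageI) (simp add: cone_zero[OF D] lin)
          then show ?thesis using x True set_addI[of x "adjoin v ?D" "f 0" "f ` ?E"]
            by (auto simp: f_def lin intro!: adjoinI)
        next
          case False
          have "0 \<le> u d + t * u v" using \<open>0 \<le> u x\<close> x by (simp add: lin)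
          then have "0 \<le> (u d + t * u v) / u v" using 2 by simp
          then have t: "0 \<le> t + u d / u v" using 2 by (simp add: add_divide_distrib add.commute)
          have "f ((1 / u v) *s d) \<in> f ` ?E"
            by (rule imageI) (use x False 2 D in \<open>auto simp: lin divide_le_0_iff intro!: cone_scale\<close>)
          moreover have "0 + (t + u d / u v) *s v \<in> adjoin v ?D"
            using t cone_zero[OF D] by (intro adjoinI) (auto simp: lin)
          ultimately have "0 + (t + u d / u v) *s v + f ((1 / u v) *s d) \<in> ?B"
            by (intro set_addI)
          moreover have "0 + (t + u d / u v) *s v + f ((1 / u v) *s d) = x"
            using 2 x by (simp add: f_def lin scale_left_distrib)
          ultimately show ?thesis by simp
        qed
      qed
      show "?B \<subseteq> ?A"
      proof
        fix x assume "x \<in> ?B"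
        then obtain d t b where x: "x = d + t *s v + f b" "d \<in> D" "0 \<le> u d" "0 \<le> t" "b \<in> D" "u b \<le> 0"
          by (auto simp: set_add_def adjoin_def)
        then have eq: "x = (d + u v *s b) + (t + (- u b)) *s v"
          by (simp add: f_def scale_left_distrib scale_left_diff_distrib algebra_simps)
        have "d + u v *s b \<in> D" using x 2 by (auto intro!: cone_add[OF D] cone_scale[OF D])
        then have "x \<in> adjoin v D" unfolding eq using x by (intro adjoinI) auto
        moreover have "u x = u d + t * u v" using x by (simp add: f_def lin mult.commute)
        ultimately show "x \<in> ?A" using x 2 by auto
      qed
    qed
    then show ?thesis using fgf fg adjoin.hyps by (auto intro!: fin_gen_set_add fin_gen.adjoin)
  next
    case 3
    have "{x \<in> adjoin v D. 0 \<le> u x} = set_add ?D (g ` ?D)" (is "?A = ?B")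
    proof
      show "?A \<subseteq> ?B"
      proof safe
        fix x assume "x \<in> adjoin v D" "0 \<le> u x"
        then obtain d t where x: "x = d + t *s v" "d \<in> D" "0 \<le> t" by (auto elim!: adjoinE)
        have ux: "0 \<le> u d + t * u v" using \<open>0 \<le> u x\<close> x by (simp add: lin)
        have tv: "t * u v \<le> 0" using x(3) 3 by (simp add: mult_nonneg_nonpos)
        then have ud: "0 \<le> u d" using ux by linarith
        show "x \<in> ?B"
        proof (cases "u d = 0")
          case True
          then have "t * u v = 0" using ux tv by auto
          then have eq: "x = d + g 0" using x 3 by (simp add: g_def lin)
          have "g 0 \<in> g ` ?D" by (rule imageI) (simp add: cone_zero[OF D] lin)
          then show ?thesis unfolding eq using x(2) ud by (intro set_addI) auto
        next
          case False
          \<comment> \<open>A part of \<open>d\<close> is spent on bringing \<open>t *s v\<close>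
            back to the hyperplane. The fraction \<open>l\<close> remains, and
            \<open>0 \<le> u x\<close> makes it nonnegative.\<close>
          define l where "l = 1 + t * u v / u d"
          have l: "0 \<le> l" using ux ud False by (simp add: l_def divide_simps)
          have "g ((t / u d) *s d) \<in> g ` ?D"
            using cone_scale[OF D x(2), of "t / u d"] x(3) ud by (intro imageI) (simp add: lin)
          moreover have "l *s d \<in> ?D" using cone_scale[OF D x(2) l] l ud by (simp add: lin)
          ultimately have "l *s d + g ((t / u d) *s d) \<in> ?B" by (intro set_addI)
          moreover have "l *s d + g ((t / u d) *s d) = x"
            using False x by (simp add: g_def lin l_def scale_left_distrib mult.commute)
          ultimately show ?thesis by simp
        qed
      qed
      show "?B \<subseteq> ?A"
      proof
        fix x assume "x \<in> ?B"
        then obtain d b where x: "x = d + g b" "d \<in> D" "0 \<le> u d" "b \<in> D" "0 \<le> u b"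
          by (auto simp: set_add_def)
        then have eq: "x = (d + (- u v) *s b) + u b *s v"
          by (simp add: g_def)
        have "d + (- u v) *s b \<in> D" using x 3 by (intro cone_add[OF D] cone_scale[OF D]) auto
        then have "x \<in> adjoin v D" unfolding eq using x by (intro adjoinI) auto
        moreover have "u x = u d" using x by (simp add: g_def lin mult.commute)
        ultimately show "x \<in> ?A" using x by auto
      qed
    qed
    then show ?thesis using fgg fg by (auto intro!: fin_gen_set_add)
  qed
qed

text \<open>The vectors \<open>e i\<close> and their negatives generate: each coefficient is split
  into its positive and negative parts.\<close>

lemma fin_gen_UNIV: "fin_gen UNIV"
proof -
  obtain I e \<epsilon> where I: "finite (I :: nat set)" "e ` I \<subseteq> N" "\<And>x. x = (\<Sum>i\<in>I. \<epsilon> i x *s e i)"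
    using dual_bases by blast
  have "fin_gen {\<Sum>i\<in>I. c i *s e i | c. True}"
    using I(1,2)
  proof (induction I rule: finite_induct)
    case empty
    then show ?case by (simp add: fin_gen.zero)
  next
    case (insert i I)
    let ?S = "{\<Sum>i\<in>I. c i *s e i | c. True}"
    have "{\<Sum>j\<in>insert i I. c j *s e j | c. True} = adjoin (e i) (adjoin (- e i) ?S)" (is "?A = ?B")
    proof
      show "?A \<subseteq> ?B"
      proof safe
        fix c :: "nat \<Rightarrow> 'r"
        have *: "(\<Sum>j\<in>I. c j *s e j) \<in> ?S" by blast
        have "(\<Sum>j\<in>insert i I. c j *s e j) =
          ((\<Sum>j\<in>I. c j *s e j) + max 0 (- c i) *s (- e i)) + max 0 (c i) *s e i"
          using insert.hyps by (simp add: max_def add.commute)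
        also have "\<dots> \<in> ?B" by (intro adjoinI *) auto
        finally show "(\<Sum>j\<in>insert i I. c j *s e j) \<in> ?B" .
      qed
      show "?B \<subseteq> ?A"
      proof
        fix x assume "x \<in> ?B"
        then obtain c s t where "x = (\<Sum>j\<in>I. c j *s e j) + s *s (- e i) + t *s e i"
          unfolding adjoin_def by blast
        also have "\<dots> = (\<Sum>j\<in>I. (c(i := t - s)) j *s e j) + (t - s) *s e i"
          using insert.hyps by (auto simp: scale_left_diff_distrib intro!: sum.cong)
        also have "\<dots> = (\<Sum>j\<in>insert i I. (c(i := t - s)) j *s e j)"
          using insert.hyps by (simp add: add.commute)
        finally show "x \<in> ?A" by blast
      qed
    qed
    then show ?case using insert by (auto intro!: fin_gen.adjoin uminus_N)
  qed
  moreover have "{\<Sum>i\<in>I. c i *s e i | c. True} = UNIV"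
  proof (intro equalityI subsetI)
    fix x show "x \<in> {\<Sum>i\<in>I. c i *s e i | c. True}"
      using I(3)[of x] by (intro CollectI exI[of _ "\<lambda>i. \<epsilon> i x"]) simp
  qed simp
  ultimately show ?thesis by simp
qed

lemma rat_cone_fin_gen:
  assumes "rat_cone C"
  shows "fin_gen C"
proof -
  obtain L where L: "finite L" "L \<subseteq> M" "C = {x. \<forall>u\<in>L. 0 \<le> u x}"
    using assms unfolding rat_cone_def by blast
  have "fin_gen {x. \<forall>u\<in>L. 0 \<le> u x}"
    using L(1,2)
  proof (induction L rule: finite_induct)
    case empty
    then show ?case by (simp add: fin_gen_UNIV)
  next
    case (insert u L)
    have "{x. \<forall>w\<in>insert u L. 0 \<le> w x} = {x \<in> {x. \<forall>u\<in>L. 0 \<le> u x}. 0 \<le> u x}" by auto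
    moreover have "fin_gen {x \<in> {x. \<forall>u\<in>L. 0 \<le> u x}. 0 \<le> u x}"
      using insert by (intro fin_gen_halfspace) auto
    ultimately show ?case by (simp only:)
  qed
  then show ?thesis using L(3) by simp
qed

section \<open>Rational interior points and separation\<close>

text \<open>The sum of the generators is a relative interior point and lies in \<open>N\<close>.
  Such points are the apex directions for coning off.\<close>

lemma rat_cone_rel_int:
  assumes "rat_cone C"
  obtains p where "p \<in> N" "p \<in> rel_int C"
proof -
  have "\<exists>p\<in>N. p \<in> rel_int C"
    using rat_cone_fin_gen[OF assms]
  proof (induction rule: fin_gen.induct)
    case zero
    have "0 \<in> rel_int {0}" unfolding rel_int_def by (auto intro: exI[of _ 1])
    then show ?case using zero_N by blast
  next
    case (adjoin C n)
    then obtain p where p: "p \<in> N" "p \<in> rel_int C" by blast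
    have C: "is_cone C" using adjoin.hyps fin_gen_rat_cone rat_cone_is_cone by blast
    have pC: "p \<in> C" using p rel_int_subset by blast
    have "p + n \<in> rel_int (adjoin n C)"
      unfolding rel_int_def
    proof safe
      show "p + n \<in> adjoin n C" using adjoinI[OF pC, of 1 n] by simp
      fix x assume "x \<in> adjoin n C"
      then obtain y t where x: "x = y + t *s n" "y \<in> C" "0 \<le> t" by (auto elim!: adjoinE)
      then obtain d where d: "d > 0" "p - d *s y \<in> C" using p by (auto simp: rel_int_def)
      \<comment> \<open>The bound \<open>d\<close> keeps the part in \<open>C\<close>, and the other
        bound keeps \<open>1 - r * t\<close> nonnegative; \<open>t + 1\<close> avoids a division by
        zero.\<close>
      define r where "r = min d (1 / (t + 1))"
      have r: "r > 0" "r \<le> d" using d x by (auto simp: r_def)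
      have "r \<le> 1 / (t + 1)" by (simp add: r_def)
      then have "r * (t + 1) \<le> 1" using x(3) by (simp add: pos_le_divide_eq)
      then have rt: "0 \<le> 1 - r * t" using r(1) by (simp add: distrib_left)
      have "p - r *s y \<in> C" using cone_step_less[OF C d(2) x(2) r(2)] .
      then have "(p - r *s y) + (1 - r * t) *s n \<in> adjoin n C" using rt by (rule adjoinI)
      moreover have "(p - r *s y) + (1 - r * t) *s n = p + n - r *s x"
        by (simp add: x scale_left_diff_distrib scale_right_distrib)
      ultimately show "\<exists>t>0. p + n - t *s x \<in> adjoin n C" using r by auto
    qed
    then show ?case using p adjoin.hyps add_N by blast
  qed
  then show ?thesis using that by blast
qed

lemma rel_int_nonempty: "rat_cone C \<Longrightarrow> rel_int C \<noteq> {}"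
  using rat_cone_rel_int by blast

lemma rat_cone_uminus:
  assumes "rat_cone C"
  shows "rat_cone (uminus ` C)"
proof -
  have "fin_gen (uminus ` C)"
    by (rule fin_gen_image[OF rat_cone_fin_gen[OF assms]]) (auto simp: uminus_N)
  then show ?thesis by (rule fin_gen_rat_cone)
qed

text \<open>Take the sum of the constraints of the cone of differences \<open>?C\<close>; on
  \<open>?C\<close> it vanishes only at vectors whose negatives also lie in \<open>?C\<close>. For
  \<open>x \<in> a\<close> with \<open>u x = 0\<close> this gives \<open>- x = a1 - b1\<close>, so
  \<open>x + a1 = b1\<close> lies in \<open>a \<inter> b\<close> and the face property puts
  \<open>x\<close> into \<open>b\<close>. The argument for \<open>b\<close> is symmetric.\<close>

lemma separation:
  assumes a: "rat_cone a" and b: "rat_cone b" and fa: "face (a \<inter> b) a" and fb: "face (a \<inter> b) b"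
  obtains u where "u \<in> M" "\<forall>x\<in>a. 0 \<le> u x" "\<forall>y\<in>b. u y \<le> 0"
    "\<forall>x\<in>a. u x = 0 \<longrightarrow> x \<in> b" "\<forall>y\<in>b. u y = 0 \<longrightarrow> y \<in> a"
proof -
  let ?C = "set_add a (uminus ` b)"
  have ca: "is_cone a" and cb: "is_cone b" using a b rat_cone_is_cone by auto
  have "rat_cone ?C"
    using a rat_cone_fin_gen[OF rat_cone_uminus[OF b]] by (rule rat_cone_set_add)
  then obtain L where L: "finite L" "L \<subseteq> M" "?C = {x. \<forall>u\<in>L. 0 \<le> u x}"
    unfolding rat_cone_def by blast
  have diff: "x - y \<in> ?C" if "x \<in> a" "y \<in> b" for x y
    using that set_addI[of x a "- y" "uminus ` b"] by simp
  have aC: "x \<in> ?C" if "x \<in> a" for x using diff[OF that cone_zero[OF cb]] by simp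
  have bC: "- y \<in> ?C" if "y \<in> b" for y using diff[OF cone_zero[OF ca] that] by simp
  define u where "u = (\<lambda>x. \<Sum>w\<in>L. w x)"
  have u: "u \<in> M" unfolding u_def using L by (intro sum_M) auto
  have nonneg: "0 \<le> u x" if "x \<in> ?C" for x
    unfolding u_def using that L(3) by (auto intro!: sum_nonneg)
  have minus: "- x \<in> ?C" if "x \<in> ?C" "u x = 0" for x
  proof -
    have "\<forall>w\<in>L. 0 \<le> w x" using that(1) L(3) by blast
    then have "\<forall>w\<in>L. w x = 0"
      using that(2) sum_nonneg_eq_0_iff[OF L(1), of "\<lambda>w. w x"] unfolding u_def by blast
    then have "\<forall>w\<in>L. 0 \<le> w (- x)" using L(2) by (auto simp: M_linear subset_iff)
    then show ?thesis using L(3) by blast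
  qed
  show ?thesis
  proof (rule that[OF u])
    show "\<forall>x\<in>a. 0 \<le> u x" using nonneg aC by blast
    show "\<forall>y\<in>b. u y \<le> 0" using nonneg[OF bC] u by (auto simp: M_linear)
    show "\<forall>x\<in>a. u x = 0 \<longrightarrow> x \<in> b"
    proof (intro ballI impI)
      fix x assume x: "x \<in> a" "u x = 0"
      then obtain a1 b1 where ab: "- x = a1 - b1" "a1 \<in> a" "b1 \<in> b"
        using minus[OF aC[OF x(1)] x(2)] unfolding set_add_def by auto
      then have "x + a1 = b1" by (simp add: algebra_simps eq_neg_iff_add_eq_0)
      then have "x + a1 \<in> a \<inter> b" using ab x cone_add[OF ca] by auto
      then show "x \<in> b" using faceD[OF fa x(1) ab(2)] by blast
    qed
    show "\<forall>y\<in>b. u y = 0 \<longrightarrow> y \<in> a"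
    proof (intro ballI impI)
      fix y assume y: "y \<in> b" "u y = 0"
      then have "y \<in> ?C" using minus[OF bC] u by (simp add: M_linear)
      then obtain a1 b1 where ab: "y = a1 - b1" "a1 \<in> a" "b1 \<in> b"
        unfolding set_add_def by auto
      then have "y + b1 = a1" by simp
      then have "y + b1 \<in> a \<inter> b" using ab cone_add[OF cb y(1) ab(3)] by auto
      then show "y \<in> a" using faceD[OF fb y(1) ab(3)] by blast
    qed
  qed
qed


subsection \<open>Fans and their refinements\<close>

definition rat_fan :: "'v set set \<Rightarrow> bool" where
  "rat_fan \<F> \<longleftrightarrow> finite \<F> \<and> \<F> \<noteq> {} \<and> (\<forall>C\<in>\<F>. rat_cone C \<and> pointed C) \<and>
     (\<forall>C\<in>\<F>. \<forall>F. face F C \<longrightarrow> F \<in> \<F>) \<and> (\<forall>C\<in>\<F>. \<forall>D\<in>\<F>. face (C \<inter> D) C)"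

definition subfan :: "'v set set \<Rightarrow> 'v set set \<Rightarrow> bool" where
  "subfan K \<F> \<longleftrightarrow> K \<noteq> {} \<and> K \<subseteq> \<F> \<and> (\<forall>C\<in>K. \<forall>F. face F C \<longrightarrow> F \<in> K)"

definition refines :: "'v set set \<Rightarrow> 'v set set \<Rightarrow> bool" where
  "refines \<F> K \<longleftrightarrow> rat_fan \<F> \<and> \<Union>\<F> = \<Union>K \<and> (\<forall>f\<in>\<F>. \<exists>k\<in>K. f \<subseteq> k)"

text \<open>In use, the members of \<open>\<F>\<close> inside \<open>C\<close> cover its boundary
  and \<open>\<F>\<close> misses its relative interior. The new cones then fill \<open>C\<close>,
  and all old cones remain.\<close>

definition cone_off :: "'v set set \<Rightarrow> 'v set \<Rightarrow> 'v \<Rightarrow> 'v set set" where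
  "cone_off \<F> C p = \<F> \<union> adjoin p ` {f \<in> \<F>. f \<subseteq> C}"

lemma fan_finite: "rat_fan \<F> \<Longrightarrow> finite \<F>"
  and fan_nonempty: "rat_fan \<F> \<Longrightarrow> \<F> \<noteq> {}"
  and fan_rat_cone: "rat_fan \<F> \<Longrightarrow> C \<in> \<F> \<Longrightarrow> rat_cone C"
  and fan_pointed: "rat_fan \<F> \<Longrightarrow> C \<in> \<F> \<Longrightarrow> pointed C"
  and fan_face: "rat_fan \<F> \<Longrightarrow> C \<in> \<F> \<Longrightarrow> face F C \<Longrightarrow> F \<in> \<F>"
  and fan_Int: "rat_fan \<F> \<Longrightarrow> C \<in> \<F> \<Longrightarrow> D \<in> \<F> \<Longrightarrow> face (C \<inter> D) C"
  unfolding rat_fan_def by blast+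

lemma fan_is_cone: "rat_fan \<F> \<Longrightarrow> C \<in> \<F> \<Longrightarrow> is_cone C"
  using fan_rat_cone rat_cone_is_cone by blast

lemma fan_Int2: "rat_fan \<F> \<Longrightarrow> C \<in> \<F> \<Longrightarrow> D \<in> \<F> \<Longrightarrow> face (C \<inter> D) D"
  using fan_Int[of \<F> D C] by (simp add: Int_commute)

lemma fan_zero: "rat_fan \<F> \<Longrightarrow> 0 \<in> \<Union>\<F>"
  using fan_nonempty fan_is_cone cone_zero by blast

lemma fan_subset_face:
  assumes "rat_fan \<F>" "C \<in> \<F>" "D \<in> \<F>" "C \<subseteq> D"
  shows "face C D"
  using fan_Int2[OF assms(1-3)] assms(4) by (simp add: Int_absorb2)

lemma fan_rel_int_subset:
  assumes "rat_fan \<F>" "C \<in> \<F>" "D \<in> \<F>" "x \<in> rel_int C" "x \<in> D"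
  shows "C \<subseteq> D"
  using face_contains[OF fan_Int[OF assms(1-3)] subset_refl fan_is_cone[OF assms(1,2)] assms(4)]
    assms(4,5) rel_int_subset by blast

lemma fan_rel_int:
  assumes "rat_fan \<F>" "D \<in> \<F>" "x \<in> D"
  obtains C where "C \<in> \<F>" "x \<in> rel_int C" "face C D"
proof -
  have "is_cone D" using assms fan_is_cone by blast
  then show ?thesis
    using that[of "face_at D x"] assms fan_face face_face_at rel_int_face_at by blast
qed

lemma subfan_rat_fan: "rat_fan \<F> \<Longrightarrow> subfan K \<F> \<Longrightarrow> rat_fan K"
  unfolding rat_fan_def subfan_def by (meson finite_subset subsetD)

lemma subfan_faces:
  assumes "rat_fan \<F>" "C \<in> \<F>"
  shows "subfan {F. face F C} \<F>"
  unfolding subfan_def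
  using assms face_refl[OF fan_is_cone[OF assms]] fan_face face_trans by blast

lemma rat_fan_Un:
  assumes "rat_fan F" "rat_fan G" "\<And>f g. f \<in> F \<Longrightarrow> g \<in> G \<Longrightarrow> face (f \<inter> g) f \<and> face (f \<inter> g) g"
  shows "rat_fan (F \<union> G)"
  unfolding rat_fan_def
proof (intro conjI ballI allI impI)
  show "finite (F \<union> G)" "F \<union> G \<noteq> {}"
    using assms fan_finite fan_nonempty by auto
  fix C assume C: "C \<in> F \<union> G"
  then show "rat_cone C" "pointed C"
    using fan_rat_cone[OF assms(1)] fan_rat_cone[OF assms(2)]
      fan_pointed[OF assms(1)] fan_pointed[OF assms(2)] by blast+
  show "E \<in> F \<union> G" if "face E C" for E
    using C that fan_face[OF assms(1)] fan_face[OF assms(2)] by blast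
  show "face (C \<inter> D) C" if "D \<in> F \<union> G" for D
    using C that fan_Int[OF assms(1)] fan_Int[OF assms(2)] assms(3)[of C D]
      assms(3)[of D C] unfolding Int_commute[of D C] by blast
qed

lemma rat_fan_meet:
  assumes "rat_fan F" "rat_fan G"
  shows "rat_fan {f \<inter> g | f g. f \<in> F \<and> g \<in> G}" (is "rat_fan ?H")
  unfolding rat_fan_def
proof (intro conjI ballI allI impI)
  have "?H = (\<lambda>(f, g). f \<inter> g) ` (F \<times> G)" by auto
  then show "finite ?H" "?H \<noteq> {}" using assms fan_finite fan_nonempty by auto
  fix C assume "C \<in> ?H"
  then obtain f g where C: "C = f \<inter> g" "f \<in> F" "g \<in> G" by blast
  show rat: "rat_cone C"
    unfolding C(1) by (intro rat_cone_Int fan_rat_cone[OF assms(1) C(2)] fan_rat_cone[OF assms(2) C(3)])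
  show "pointed C"
    using pointed_subset[OF fan_pointed[OF assms(1) C(2)]] C(1) by blast
  show "E \<in> ?H" if E: "face E C" for E
  proof -
    obtain z where z: "z \<in> rel_int E" using rel_int_nonempty[OF rat_cone_face[OF rat E]] by blast
    have fg: "is_cone f" "is_cone g" using C assms fan_is_cone by blast+
    \<comment> \<open>A face is the minimal face of any of its relative interior points, and minimal
      faces commute with intersections.\<close>
    have "E = face_at f z \<inter> face_at g z"
      using face_at_eq[OF E rat_cone_is_cone[OF rat] z] unfolding C(1) face_at_Int[OF fg] by simp
    moreover have "z \<in> f" "z \<in> g" using z E C rel_int_subset face_subset by blast+
    then have "face_at f z \<in> F" "face_at g z \<in> G"
      using fan_face[OF assms(1) C(2) face_face_at[OF fg(1)]]
        fan_face[OF assms(2) C(3) face_face_at[OF fg(2)]] by auto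
    ultimately show ?thesis by blast
  qed
  show "face (C \<inter> D) C" if "D \<in> ?H" for D
  proof -
    from that obtain f' g' where D: "D = f' \<inter> g'" "f' \<in> F" "g' \<in> G" by blast
    have "C \<inter> D = (f \<inter> f') \<inter> (g \<inter> g')" using C D by blast
    then show ?thesis
      unfolding C(1) using face_Int[OF fan_Int[OF assms(1) C(2) D(2)] fan_Int[OF assms(2) C(3) D(3)]]
      by simp
  qed
qed

section \<open>Coning off from an interior direction\<close>

text \<open>If \<open>t < t'\<close>, then \<open>y\<close> is a vector of \<open>C\<close> plus a
  positive multiple of the interior vector \<open>p\<close>, hence interior itself.\<close>

lemma boundary_decomp_less:
  assumes "is_cone C" "p \<in> rel_int C" "y' \<in> C" "y \<notin> rel_int C" "y + t *s p = y' + t' *s p"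
  shows "t' \<le> t"
proof (rule ccontr)
  assume "\<not> t' \<le> t"
  then have "(t' - t) *s p + y' \<in> rel_int C"
    using assms by (intro rel_int_add rel_int_scale) auto
  moreover have "y = (t' - t) *s p + y'"
    using assms(5) by (simp add: scale_left_diff_distrib algebra_simps)
  ultimately show False using assms by simp
qed

lemma boundary_decomp_unique:
  assumes "is_cone C" "p \<in> rel_int C" "y \<in> C - rel_int C" "y' \<in> C - rel_int C"
    "y + t *s p = y' + t' *s p"
  shows "y = y'" "t = t'"
proof -
  show "t = t'"
    using boundary_decomp_less[OF assms(1,2) _ _ assms(5)]
      boundary_decomp_less[OF assms(1,2) _ _ assms(5)[symmetric]] assms(3,4) by (auto intro: antisym)
  then show "y = y'" using assms(5) by simp
qed

text \<open>Each point of \<open>C\<close> is a boundary point plus a nonnegative multiple of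
  \<open>p\<close>, by \<open>pointed_exit\<close>, and uniquely so, by
  \<open>boundary_decomp_unique\<close>. Intersections and faces of the new cones are therefore
  governed by their bases in \<open>F\<close>.\<close>

lemma cone_off:
  assumes F: "rat_fan F" and C: "rat_cone C" "pointed C" and p: "p \<in> N" "p \<in> rel_int C"
    and disj: "rel_int C \<inter> \<Union>F = {}" and bd: "C - rel_int C \<subseteq> \<Union>{f \<in> F. f \<subseteq> C}"
  shows "rat_fan (cone_off F C p)" and "\<Union>(cone_off F C p) = \<Union>F \<union> C"
proof -
  have cC: "is_cone C" using C rat_cone_is_cone by blast
  have pC: "p \<in> C" using p rel_int_subset by blast
  have "p \<noteq> 0" using p disj fan_zero[OF F] by blast
  have cF: "is_cone f" if "f \<in> F" for f using F that fan_is_cone by blast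
  have bdF: "y \<in> C - rel_int C" if "f \<in> F" "f \<subseteq> C" "y \<in> f" for f y
    using that disj by blast
  have pF: "p \<notin> f" if "f \<in> F" for f using that disj p by blast
  note uniq = boundary_decomp_unique[OF cC p(2)]
  have new_subset: "adjoin p f \<subseteq> C" if "f \<subseteq> C" for f
    using that pC adjoin_subset[OF cC] by blast
  have old_face: "face (adjoin p f \<inter> g) (adjoin p f) \<and> face (adjoin p f \<inter> g) g"
    if f: "f \<in> F" "f \<subseteq> C" and g: "g \<in> F" for f g
  proof -
    \<comment> \<open>Points of \<open>g\<close> avoid \<open>rel_int C\<close>, so uniqueness of
      the decomposition forces the coefficient of \<open>p\<close> to be 0.\<close>
    have *: "adjoin p f \<inter> g = f \<inter> g"
    proof
      show "adjoin p f \<inter> g \<subseteq> f \<inter> g"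
      proof
        fix x assume x: "x \<in> adjoin p f \<inter> g"
        then have "x \<in> adjoin p f" by blast
        then obtain y t where y: "x = y + t *s p" "y \<in> f" "0 \<le> t" by (rule adjoinE)
        have "x \<in> C" using x subsetD[OF new_subset[OF f(2)]] by simp
        moreover have "x \<notin> rel_int C" using x g disj by auto
        ultimately have xbd: "x \<in> C - rel_int C" by simp
        have eq: "y + t *s p = x + 0 *s p" unfolding y(1) by simp
        have "t = 0" by (rule uniq(2)[OF bdF[OF f y(2)] xbd eq])
        then show "x \<in> f \<inter> g" using x y(1,2) by simp
      qed
      show "f \<inter> g \<subseteq> adjoin p f \<inter> g" using subset_adjoin by blast
    qed
    have "face f (adjoin p f)"
      unfolding face_def
    proof (intro conjI ballI impI)
      fix x x' assume "x \<in> adjoin p f" "x' \<in> adjoin p f" and xx: "x + x' \<in> f"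
      then obtain y t y' t' where y: "x = y + t *s p" "y \<in> f" "0 \<le> t" "x' = y' + t' *s p" "y' \<in> f" "0 \<le> t'"
        by (auto elim!: adjoinE)
      then have eq: "(y + y') + (t + t') *s p = (x + x') + 0 *s p"
        by (simp add: scale_left_distrib algebra_simps)
      have "t + t' = 0"
        by (rule uniq(2)[OF bdF[OF f cone_add[OF cF[OF f(1)] y(2,5)]] bdF[OF f xx] eq])
      then have "t = 0" using y by linarith
      then show "x \<in> f" using y by simp
    qed (use f cF subset_adjoin in auto)
    then show ?thesis using * fan_Int[OF F f(1) g] fan_Int2[OF F f(1) g] face_trans by metis
  qed
  have new_face: "face (adjoin p f \<inter> adjoin p g) (adjoin p f)"
    if f: "f \<in> F" "f \<subseteq> C" and g: "g \<in> F" "g \<subseteq> C" for f g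
  proof -
    have *: "adjoin p f \<inter> adjoin p g = adjoin p (f \<inter> g)"
    proof
      show "adjoin p f \<inter> adjoin p g \<subseteq> adjoin p (f \<inter> g)"
      proof
        fix x assume x: "x \<in> adjoin p f \<inter> adjoin p g"
        obtain y t where y: "x = y + t *s p" "y \<in> f" "0 \<le> t"
          using IntD1[OF x] by (rule adjoinE)
        obtain y' t' where y': "x = y' + t' *s p" "y' \<in> g"
          using IntD2[OF x] by (rule adjoinE)
        have "y = y'"
          by (rule uniq(1)[OF bdF[OF f y(2)] bdF[OF g y'(2)] trans[OF y(1)[symmetric] y'(1)]])
        then show "x \<in> adjoin p (f \<inter> g)" unfolding y(1) using y y' by (intro adjoinI) auto
      qed
    qed (auto elim!: adjoinE intro: adjoinI)
    show ?thesis
      unfolding face_def *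
    proof (intro conjI ballI impI)
      show "is_cone (adjoin p (f \<inter> g))" using f g cF by (auto intro!: is_cone_adjoin is_cone_Int)
      show "adjoin p (f \<inter> g) \<subseteq> adjoin p f" by (auto elim!: adjoinE intro: adjoinI)
      fix x x' assume "x \<in> adjoin p f" "x' \<in> adjoin p f" and xx: "x + x' \<in> adjoin p (f \<inter> g)"
      then obtain y t y' t' where y: "x = y + t *s p" "y \<in> f" "0 \<le> t" "x' = y' + t' *s p" "y' \<in> f" "0 \<le> t'"
        by (auto elim!: adjoinE)
      obtain z s where z: "x + x' = z + s *s p" "z \<in> f \<inter> g" using xx by (auto elim!: adjoinE)
      have eq: "(y + y') + (t + t') *s p = z + s *s p"
        unfolding z(1)[symmetric] y(1,4) by (simp add: scale_left_distrib algebra_simps)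
      have "z \<in> f" using z(2) by blast
      have "y + y' = z"
        by (rule uniq(1)[OF bdF[OF f cone_add[OF cF[OF f(1)] y(2,5)]] bdF[OF f \<open>z \<in> f\<close>] eq])
      then have "y + y' \<in> f \<inter> g" using z by simp
      then have "y \<in> f \<inter> g" using faceD[OF fan_Int[OF F f(1) g(1)] y(2,5)] by blast
      then show "x \<in> adjoin p (f \<inter> g)" unfolding y(1) using y(3) by (intro adjoinI)
    qed
  qed
  show "rat_fan (cone_off F C p)"
    unfolding rat_fan_def
  proof (intro conjI ballI allI impI)
    show "finite (cone_off F C p)" "cone_off F C p \<noteq> {}"
      using fan_finite[OF F] fan_nonempty[OF F] unfolding cone_off_def by auto
    fix D assume D: "D \<in> cone_off F C p"
    show "rat_cone D"
      using D F p(1) unfolding cone_off_def by (auto intro: fan_rat_cone rat_cone_adjoin)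
    show "pointed D"
      using D fan_pointed[OF F] pointed_subset[OF C(2) new_subset] unfolding cone_off_def by auto
    show "E \<in> cone_off F C p" if E: "face E D" for E
    proof (cases "D \<in> F")
      case True
      then show ?thesis using fan_face[OF F _ E] unfolding cone_off_def by blast
    next
      case False
      then obtain f where f: "f \<in> F" "f \<subseteq> C" "D = adjoin p f" using D unfolding cone_off_def by blast
      have Ef: "face (E \<inter> f) f"
        using face_Int[OF E face_refl[OF cF[OF f(1)]]] subset_adjoin[of f p] f(3)
        by (metis Int_absorb1)
      have split: "y \<in> E" "t *s p \<in> E" if "y + t *s p \<in> E" "y \<in> f" "0 \<le> t" for y t
      proof -
        have "y \<in> D" "t *s p \<in> D"
          using that f(3) cone_zero[OF cF[OF f(1)]] adjoinI[of y f 0 p] adjoinI[of 0 f t p] by auto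
        then show "y \<in> E" "t *s p \<in> E"
          using faceD[OF E] that(1) by (metis, metis add.commute)
      qed
      show ?thesis
      \<comment> \<open>A face containing \<open>p\<close> is the cone over
        \<open>E \<inter> f\<close>. Any other face lies in \<open>f\<close>, since by
        \<open>split\<close> a positive coefficient would bring \<open>p\<close> into
        \<open>E\<close>.\<close>
      proof (cases "p \<in> E")
        case True
        have "E = adjoin p (E \<inter> f)"
        proof
          show "E \<subseteq> adjoin p (E \<inter> f)"
          proof
            fix x assume x: "x \<in> E"
            then have "x \<in> adjoin p f" using face_subset[OF E] f(3) by blast
            then obtain y t where y: "x = y + t *s p" "y \<in> f" "0 \<le> t" by (rule adjoinE)
            then show "x \<in> adjoin p (E \<inter> f)" using split x by (auto intro: adjoinI)
          qed
          show "adjoin p (E \<inter> f) \<subseteq> E"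
            using True face_is_cone[OF E] by (intro adjoin_subset) auto
        qed
        then show ?thesis
          using fan_face[OF F f(1) Ef] f(2) unfolding cone_off_def by blast
      next
        case False
        have "E \<subseteq> f"
        proof
          fix x assume x: "x \<in> E"
          then have "x \<in> adjoin p f" using face_subset[OF E] f(3) by blast
          then obtain y t where y: "x = y + t *s p" "y \<in> f" "0 \<le> t" by (rule adjoinE)
          then have "t *s p \<in> E" using split x by blast
          then have "t = 0" using False y(3) face_is_cone[OF E] by (metis cone_scale_iff order_le_less)
          then show "x \<in> f" using y by simp
        qed
        then have "E \<inter> f = E" by blast
        then show ?thesis using fan_face[OF F f(1) Ef] unfolding cone_off_def by simp
      qed
    qed
    show "face (D \<inter> E) D" if E: "E \<in> cone_off F C p" for E
    proof -
      consider "D \<in> F" "E \<in> F" | f where "f \<in> F" "f \<subseteq> C" "D = adjoin p f" "E \<in> F"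
        | g where "g \<in> F" "g \<subseteq> C" "E = adjoin p g" "D \<in> F"
        | f g where "f \<in> F" "f \<subseteq> C" "D = adjoin p f" "g \<in> F" "g \<subseteq> C" "E = adjoin p g"
        using D E unfolding cone_off_def by blast
      then show ?thesis
      proof cases
        case 1 then show ?thesis using fan_Int[OF F] by blast
      next
        case 2 then show ?thesis using old_face by blast
      next
        case 3 then show ?thesis using old_face[of g D] by (simp add: Int_commute)
      next
        case 4 then show ?thesis using new_face by blast
      qed
    qed
  qed
  have "C \<subseteq> \<Union>(cone_off F C p)"
  proof
    fix x assume x: "x \<in> C"
    obtain t where t: "0 \<le> t" "x - t *s p \<in> C" "x - t *s p \<notin> rel_int C"
      using pointed_exit[OF C x pC \<open>p \<noteq> 0\<close>] by blast
    then obtain f where f: "f \<in> F" "f \<subseteq> C" "x - t *s p \<in> f" using bd by blast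
    then have "x \<in> adjoin p f" using adjoinI[OF f(3) t(1), of p] by simp
    then show "x \<in> \<Union>(cone_off F C p)" using f unfolding cone_off_def by blast
  qed
  moreover have "\<Union>(cone_off F C p) \<subseteq> \<Union>F \<union> C" "\<Union>F \<subseteq> \<Union>(cone_off F C p)"
    using new_subset unfolding cone_off_def by blast+
  ultimately show "\<Union>(cone_off F C p) = \<Union>F \<union> C" by blast
qed

section \<open>Extending a refinement from a subfan\<close>

text \<open>A minimal member of \<open>\<F> - K'\<close> has all its proper faces in
  \<open>K'\<close>, so the cones can be added faces first.\<close>

lemma subfan_induct [consumes 2, case_names base step]:
  assumes "rat_fan \<F>" "subfan K \<F>" and base: "Q K"
    and step: "\<And>K' C. subfan K' \<F> \<Longrightarrow> K \<subseteq> K' \<Longrightarrow> C \<in> \<F> \<Longrightarrow> C \<notin> K' \<Longrightarrow>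
      (\<And>F. face F C \<Longrightarrow> F \<noteq> C \<Longrightarrow> F \<in> K') \<Longrightarrow> Q K' \<Longrightarrow> Q (insert C K')"
  shows "Q \<F>"
proof -
  have "Q \<F>" if "subfan K' \<F>" "K \<subseteq> K'" "Q K'" for K'
    using that
  proof (induction "card (\<F> - K')" arbitrary: K' rule: less_induct)
    case less
    have fin: "finite (\<F> - K')" using fan_finite[OF assms(1)] by simp
    have sub: "K' \<subseteq> \<F>" using less.prems by (auto simp: subfan_def)
    show ?case
    proof (cases "\<F> - K' = {}")
      case True
      then show ?thesis using less.prems sub by (metis Diff_eq_empty_iff subset_antisym)
    next
      case False
      then obtain C where C: "C \<in> \<F>" "C \<notin> K'" and min: "\<And>D. D \<in> \<F> - K' \<Longrightarrow> D \<subseteq> C \<Longrightarrow> C = D"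
        using finite_has_minimal[OF fin] by blast
      have faces: "F \<in> K'" if "face F C" "F \<noteq> C" for F
        using min[of F] that C fan_face[OF assms(1)] face_subset by blast
      have "subfan (insert C K') \<F>"
        using less.prems(1) C faces unfolding subfan_def by blast
      moreover have "Q (insert C K')"
        using step[OF less.prems(1,2) C faces less.prems(3)] by blast
      moreover have "card (\<F> - insert C K') < card (\<F> - K')"
        by (rule psubset_card_mono[OF fin]) (use C in blast)
      ultimately show ?thesis using less.hyps[of "insert C K'"] less.prems(2) by blast
    qed
  qed
  then show ?thesis using assms(2) base by blast
qed

text \<open>The cone of \<open>F\<close> carrying \<open>x\<close> in its relative interior lies in
  some \<open>k' \<in> K\<close>. It meets the face \<open>k' \<inter> k\<close> of
  \<open>k'\<close> in that interior point, so it is contained in it.\<close>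

lemma refines_cell:
  assumes "rat_fan K" "refines F K" "k \<in> K" "x \<in> k"
  obtains f where "f \<in> F" "x \<in> rel_int f" "f \<subseteq> k"
proof -
  have F: "rat_fan F" "\<Union>F = \<Union>K" using assms(2) by (auto simp: refines_def)
  then obtain g where "g \<in> F" "x \<in> g" using assms by blast
  then obtain f where f: "f \<in> F" "x \<in> rel_int f" using fan_rel_int[OF F(1)] by blast
  then obtain k' where k': "k' \<in> K" "f \<subseteq> k'" using assms(2) by (auto simp: refines_def)
  have "f \<subseteq> k' \<inter> k"
    by (rule face_contains[OF fan_Int[OF assms(1) k'(1) assms(3)] k'(2) fan_is_cone[OF F(1) f(1)] f(2)])
      (use f k' assms rel_int_subset in auto)
  then show ?thesis using that f by blast
qed

lemma refines_refl: "rat_fan K \<Longrightarrow> refines K K"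
  by (auto simp: refines_def)

lemma subfan_rel_int_disjoint:
  assumes "rat_fan \<F>" "subfan K \<F>" "C \<in> \<F>" "C \<notin> K"
  shows "rel_int C \<inter> \<Union>K = {}"
proof (rule ccontr)
  assume "rel_int C \<inter> \<Union>K \<noteq> {}"
  then obtain x k where x: "x \<in> rel_int C" "k \<in> K" "x \<in> k" by blast
  moreover have "k \<in> \<F>" using x assms by (auto simp: subfan_def)
  ultimately have "face C k"
    using assms fan_rel_int_subset fan_subset_face by metis
  then show False using assms x by (auto simp: subfan_def)
qed

text \<open>When \<open>C\<close> is reached, its proper faces are already refined, so
  \<open>cone_off\<close> applies. The invariant \<open>I\<close> records what a good choice of
  \<open>p\<close> can secure; its proof may assume that the new family is a fan.\<close>

theorem extend_refinement:
  assumes \<F>: "rat_fan \<F>" and K: "subfan K \<F>" and K': "refines K' K" and I: "I K'"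
    and step: "\<And>F C. rat_fan F \<Longrightarrow> K' \<subseteq> F \<Longrightarrow> I F \<Longrightarrow> C \<in> \<F> \<Longrightarrow> C \<notin> K \<Longrightarrow>
      rel_int C \<inter> \<Union>F = {} \<Longrightarrow> \<exists>p\<in>N. p \<in> rel_int C \<and> (rat_fan (cone_off F C p) \<longrightarrow> I (cone_off F C p))"
  shows "\<exists>\<F>'. refines \<F>' \<F> \<and> K' \<subseteq> \<F>' \<and> I \<F>'"
  using \<F> K
proof (induction rule: subfan_induct)
  case base
  then show ?case using K' I by blast
next
  case (step K1 C)
  then obtain F where F: "refines F K1" "K' \<subseteq> F" "I F" by blast
  then have fF: "rat_fan F" and UF: "\<Union>F = \<Union>K1" by (auto simp: refines_def)
  have K1: "rat_fan K1" using subfan_rat_fan[OF \<F> step(1)] .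
  have cC: "rat_cone C" "pointed C" "is_cone C"
    using step(3) \<F> fan_rat_cone fan_pointed fan_is_cone by blast+
  have disj: "rel_int C \<inter> \<Union>F = {}"
    unfolding UF by (rule subfan_rel_int_disjoint[OF \<F> step(1,3,4)])
  \<comment> \<open>A boundary point lies in its minimal face, which is proper and hence in
    \<open>K1\<close>; \<open>refines_cell\<close> finds a cone of \<open>F\<close> inside that
    face.\<close>
  have bd: "C - rel_int C \<subseteq> \<Union>{f \<in> F. f \<subseteq> C}"
  proof
    fix x assume x: "x \<in> C - rel_int C"
    have fx: "face (face_at C x) C" using cC(3) x by (auto intro: face_face_at)
    have "face_at C x \<noteq> C" using rel_int_face_at[OF cC(3), of x] x by auto
    then have "face_at C x \<in> K1" using step(5) fx by blast
    then obtain f where "f \<in> F" "x \<in> rel_int f" "f \<subseteq> face_at C x"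
      using refines_cell[OF K1 F(1) _ mem_face_at[OF cC(3)]] x by blast
    then show "x \<in> \<Union>{f \<in> F. f \<subseteq> C}" using face_subset[OF fx] rel_int_subset by blast
  qed
  have "C \<notin> K" using step by blast
  then obtain p where p: "p \<in> N" "p \<in> rel_int C" "rat_fan (cone_off F C p) \<longrightarrow> I (cone_off F C p)"
    using assms(5)[OF fF F(2,3) step(3) _ disj] by blast
  have new: "rat_fan (cone_off F C p)" "\<Union>(cone_off F C p) = \<Union>F \<union> C"
    using cone_off[OF fF cC(1,2) p(1,2) disj bd] by auto
  have pC: "p \<in> C" using p(2) rel_int_subset by blast
  have "\<exists>k\<in>insert C K1. f \<subseteq> k" if f: "f \<in> cone_off F C p" for f
  proof (cases "f \<in> F")
    case True
    then obtain k where "k \<in> K1" "f \<subseteq> k" using F(1) unfolding refines_def by blast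
    then show ?thesis by blast
  next
    case False
    then obtain g where "g \<subseteq> C" "f = adjoin p g" using f unfolding cone_off_def by blast
    then show ?thesis using adjoin_subset[OF cC(3) _ pC] by simp
  qed
  then have "refines (cone_off F C p) (insert C K1)"
    using new UF unfolding refines_def by auto
  moreover have "K' \<subseteq> cone_off F C p" using F(2) unfolding cone_off_def by blast
  ultimately show ?case using new(1) p(3) by blast
qed


subsection \<open>Hyperplane arrangements\<close>

text \<open>The closed cell of the arrangement with \<open>x\<close> in its relative interior, if
  \<open>H\<close> is a finite subset of \<open>M\<close>. Indexing cells by points makes them
  minimal faces, see \<open>face_at_cell\<close>.\<close>

definition cell :: "('v \<Rightarrow> 'r) set \<Rightarrow> 'v \<Rightarrow> 'v set" where
  "cell H x = {z. \<forall>h\<in>H. (0 \<le> h x \<longrightarrow> 0 \<le> h z) \<and> (h x \<le> 0 \<longrightarrow> h z \<le> 0)}"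

lemma mem_cell: "x \<in> cell H x"
  by (auto simp: cell_def)

lemma UN_cell: "\<Union>(range (cell H)) = UNIV"
  using mem_cell by blast

lemma cell_halfspaces:
  "cell H x = {z. \<forall>u\<in>{h \<in> H. 0 \<le> h x} \<union> (\<lambda>h z. - h z) ` {h \<in> H. h x \<le> 0}. 0 \<le> u z}"
  unfolding cell_def ball_Un ball_simps by auto

lemma rat_cone_cell:
  assumes "finite H" "H \<subseteq> M"
  shows "rat_cone (cell H x)"
proof -
  let ?L = "{h \<in> H. 0 \<le> h x} \<union> (\<lambda>h z. - h z) ` {h \<in> H. h x \<le> 0}"
  have "finite ?L" "?L \<subseteq> M" using assms uminus_M by auto
  then show ?thesis
    unfolding rat_cone_def by (intro exI[of _ ?L] conjI cell_halfspaces)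
qed

text \<open>Passing to the minimal face of \<open>z\<close> only turns the constraints that vanish
  at \<open>z\<close> into equations. Hence every face of a cell is a cell.\<close>

lemma face_at_cell:
  assumes H: "finite H" "H \<subseteq> M" and z: "z \<in> cell H x"
  shows "face_at (cell H x) z = cell H z"
proof
  show "face_at (cell H x) z \<subseteq> cell H z"
  proof
    fix w assume "w \<in> face_at (cell H x) z"
    then obtain t where w: "w \<in> cell H x" "t > 0" "z - t *s w \<in> cell H x"
      by (auto simp: face_at_def)
    have "(0 \<le> h z \<longrightarrow> 0 \<le> h w) \<and> (h z \<le> 0 \<longrightarrow> h w \<le> 0)" if "h \<in> H" for h
    proof -
      have *: "0 \<le> h x \<longrightarrow> 0 \<le> h z \<and> 0 \<le> h w \<and> 0 \<le> h z - t * h w"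
        "h x \<le> 0 \<longrightarrow> h z \<le> 0 \<and> h w \<le> 0 \<and> h z - t * h w \<le> 0"
        using w z that H(2) unfolding cell_def by (auto simp: M_linear subset_iff)
      \<comment> \<open>When \<open>h z = 0\<close>, the sign condition of the cell holds both for
        \<open>h w\<close> and for its negative multiple \<open>- t * h w\<close>.\<close>
      have "h w = 0" if "h z = 0"
        using * that w(2) by (auto simp: zero_le_mult_iff mult_le_0_iff)
      then show ?thesis using * by (metis linorder_linear order_antisym)
    qed
    then show "w \<in> cell H z" by (auto simp: cell_def)
  qed
  show "cell H z \<subseteq> face_at (cell H x) z"
  proof
    fix w assume w: "w \<in> cell H z"
    let ?L = "{h \<in> H. 0 \<le> h x} \<union> (\<lambda>h z. - h z) ` {h \<in> H. h x \<le> 0}"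
    have L: "finite ?L" "?L \<subseteq> M" using H uminus_M by auto
    have "\<forall>u\<in>?L. 0 < u z \<or> 0 \<le> u z \<and> u w \<le> 0"
      using z w unfolding cell_def by fastforce
    from small_step_cone[OF L this] obtain t where "t > 0" "z - t *s w \<in> cell H x"
      unfolding cell_halfspaces by blast
    moreover have "w \<in> cell H x" using z w unfolding cell_def by auto
    ultimately show "w \<in> face_at (cell H x) z" by (auto simp: face_at_def)
  qed
qed

text \<open>Finiteness holds because a cell depends only on which members of \<open>H\<close> are
  nonnegative and which are nonpositive at its index point. Pointedness comes from
  \<open>sep\<close>, closure under faces from \<open>face_at_cell\<close>.\<close>

lemma rat_fan_cells:
  assumes H: "finite H" "H \<subseteq> M" and sep: "\<And>x. \<forall>h\<in>H. h x = 0 \<Longrightarrow> x = 0"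
  shows "rat_fan (range (cell H))"
  unfolding rat_fan_def
proof (intro conjI ballI allI impI)
  have "range (cell H) \<subseteq>
      (\<lambda>(A, B). {z. (\<forall>h\<in>A. 0 \<le> h z) \<and> (\<forall>h\<in>B. h z \<le> 0)}) ` (Pow H \<times> Pow H)"
  proof
    fix C assume "C \<in> range (cell H)"
    then obtain x where "C = cell H x" by blast
    then have "C = (\<lambda>(A, B). {z. (\<forall>h\<in>A. 0 \<le> h z) \<and> (\<forall>h\<in>B. h z \<le> 0)})
        ({h \<in> H. 0 \<le> h x}, {h \<in> H. h x \<le> 0})"
      by (auto simp: cell_def)
    then show "C \<in> (\<lambda>(A, B). {z. (\<forall>h\<in>A. 0 \<le> h z) \<and> (\<forall>h\<in>B. h z \<le> 0)}) ` (Pow H \<times> Pow H)"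
      by (rule image_eqI) auto
  qed
  then show "finite (range (cell H))"
    by (rule finite_subset) (use H in auto)
  show "range (cell H) \<noteq> {}" by simp
  fix C assume "C \<in> range (cell H)"
  then obtain x where C: "C = cell H x" by blast
  show rat: "rat_cone C" unfolding C using H by (rule rat_cone_cell)
  show "pointed C"
    unfolding pointed_def
  proof (intro allI impI sep ballI)
    fix z h assume z: "z \<in> C" "- z \<in> C" and h: "h \<in> H"
    have "h (- z) = - h z" using h H(2) by (auto simp: M_linear)
    then show "h z = 0"
      using z h unfolding C cell_def by (cases "0 \<le> h x") force+
  qed
  show "E \<in> range (cell H)" if E: "face E C" for E
  proof -
    obtain z where z: "z \<in> rel_int E" using rel_int_nonempty[OF rat_cone_face[OF rat E]] by blast
    then have "z \<in> cell H x" using rel_int_subset face_subset[OF E] C by blast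
    then show ?thesis
      using face_at_cell[OF H] face_at_eq[OF E rat_cone_is_cone[OF rat] z] C by blast
  qed
  show "face (C \<inter> D) C" if "D \<in> range (cell H)" for D
  proof -
    from that obtain y where D: "D = cell H y" by blast
    have "is_cone C" "is_cone D"
      unfolding C D using rat_cone_cell[OF H] rat_cone_is_cone by auto
    moreover have "a \<in> C \<inter> D" if "a \<in> C" "b \<in> C" "a + b \<in> C \<inter> D" for a b
    proof -
      have "(0 \<le> h y \<longrightarrow> 0 \<le> h a) \<and> (h y \<le> 0 \<longrightarrow> h a \<le> 0)" if h: "h \<in> H" for h
      proof -
        have "h (a + b) = h a + h b" using h H(2) by (auto simp: M_linear)
        \<comment> \<open>On \<open>C\<close> the values \<open>h a\<close> and \<open>h b\<close>
          have a common weak sign, so the sign condition on their sum passes to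
          \<open>h a\<close>.\<close>
        then have "0 \<le> h x \<longrightarrow> 0 \<le> h a \<and> 0 \<le> h b" "h x \<le> 0 \<longrightarrow> h a \<le> 0 \<and> h b \<le> 0"
          "0 \<le> h y \<longrightarrow> 0 \<le> h a + h b" "h y \<le> 0 \<longrightarrow> h a + h b \<le> 0"
          using \<open>a \<in> C\<close> \<open>b \<in> C\<close> \<open>a + b \<in> C \<inter> D\<close> h unfolding C D cell_def by auto
        then show ?thesis by linarith
      qed
      then show ?thesis using \<open>a \<in> C\<close> unfolding D cell_def by blast
    qed
    ultimately show ?thesis unfolding face_def by (auto intro: is_cone_Int)
  qed
qed


subsection \<open>Adding one cone to a fan with a completion\<close>

text \<open>A backward step along \<open>p\<close> shows that the coefficient of \<open>p\<close> is
  positive. Backward steps along vectors of \<open>g\<close> keep the boundary part in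
  \<open>g\<close>, by uniqueness of the decomposition.\<close>

lemma rel_int_adjoin:
  assumes C: "is_cone C" "p \<in> rel_int C" and g: "is_cone g" "g \<subseteq> C - rel_int C"
    and x: "x \<in> rel_int (adjoin p g)"
  obtains y t where "x = y + t *s p" "y \<in> rel_int g" "t > 0"
proof -
  obtain e where e: "e > 0" "x - e *s p \<in> adjoin p g"
    using x mem_adjoin[OF g(1)] unfolding rel_int_def by blast
  obtain y s where y: "x - e *s p = y + s *s p" "y \<in> g" "0 \<le> s"
    using e(2) by (rule adjoinE)
  have eq: "x = y + (s + e) *s p"
    using y(1) by (simp add: scale_left_distrib algebra_simps)
  have "y \<in> rel_int g"
    unfolding rel_int_def
  proof safe
    fix z assume z: "z \<in> g"
    then obtain d where d: "d > 0" "x - d *s z \<in> adjoin p g"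
      using x subset_adjoin[of g p] unfolding rel_int_def by blast
    obtain y' t where y': "x - d *s z = y' + t *s p" "y' \<in> g" "0 \<le> t"
      using d(2) by (rule adjoinE)
    have eq': "y + (s + e) *s p = (y' + d *s z) + t *s p"
      using y'(1) unfolding eq by (simp add: algebra_simps)
    have "y' + d *s z \<in> g" using y'(2) z d(1) by (intro cone_add[OF g(1)] cone_scale[OF g(1)]) auto
    then have "y = y' + d *s z"
      using boundary_decomp_unique(1)[OF C _ _ eq'] y(2) g(2) by blast
    then have "y - d *s z \<in> g" using y'(2) by simp
    then show "\<exists>t>0. y - t *s z \<in> g" using d(1) by blast
  qed (rule y(2))
  moreover have "s + e > 0" using y(3) e(1) by simp
  ultimately show ?thesis using that eq by blast
qed

context
  fixes \<Sigma> K0 :: "'v set set" and \<sigma> :: "'v set"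
  assumes \<Sigma>: "rat_fan \<Sigma>" and K0: "subfan K0 \<Sigma>" and \<sigma>: "\<sigma> \<in> \<Sigma>" "\<sigma> \<notin> K0"
    and proper_faces: "\<And>F. face F \<sigma> \<Longrightarrow> F \<noteq> \<sigma> \<Longrightarrow> F \<in> K0"
begin

lemma K0_fan: "rat_fan K0"
  using \<Sigma> K0 by (rule subfan_rat_fan)

lemma \<sigma>_cone: "rat_cone \<sigma>" "is_cone \<sigma>" "pointed \<sigma>"
  using \<Sigma> \<sigma>(1) fan_rat_cone fan_is_cone fan_pointed by blast+

lemma K0_rel_int: "\<kappa> \<in> K0 \<Longrightarrow> \<kappa> \<inter> rel_int \<sigma> = {}"
  using subfan_rel_int_disjoint[OF \<Sigma> K0 \<sigma>] by blast

lemma K0_subfan: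
  assumes "K0 \<subseteq> \<Gamma>"
  shows "subfan K0 \<Gamma>"
  using assms K0 unfolding subfan_def by blast

lemma boundary:
  assumes "x \<in> \<sigma>" "x \<notin> rel_int \<sigma>"
  shows "face_at \<sigma> x \<in> K0" "face (face_at \<sigma> x) \<sigma>" "x \<in> face_at \<sigma> x"
proof -
  show f: "face (face_at \<sigma> x) \<sigma>" "x \<in> face_at \<sigma> x"
    using assms \<sigma>_cone face_face_at mem_face_at by auto
  have "face_at \<sigma> x \<noteq> \<sigma>" using rel_int_face_at[OF \<sigma>_cone(2) assms(1)] assms(2) by auto
  then show "face_at \<sigma> x \<in> K0" using f proper_faces by blast
qed

text \<open>A relative interior point \<open>z\<close> of \<open>g \<inter> \<sigma>\<close> lies on
  the boundary of \<open>\<sigma>\<close>, so all of \<open>g \<inter> \<sigma>\<close> lies in the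
  proper face \<open>face_at \<sigma> z\<close>. That face belongs to \<open>K0\<close>, hence to
  the fan containing \<open>g\<close>.\<close>

lemma face_Int_boundary:
  assumes \<Gamma>: "rat_fan \<Gamma>" "K0 \<subseteq> \<Gamma>" "g \<in> \<Gamma>" and disj: "g \<inter> rel_int \<sigma> = {}"
  shows "face (g \<inter> \<sigma>) g" "face (g \<inter> \<sigma>) \<sigma>"
proof -
  have rat: "rat_cone (g \<inter> \<sigma>)" using \<Gamma> fan_rat_cone \<sigma>_cone rat_cone_Int by blast
  then obtain z where z: "z \<in> rel_int (g \<inter> \<sigma>)" using rel_int_nonempty by blast
  then have z': "z \<in> \<sigma>" "z \<notin> rel_int \<sigma>" using rel_int_subset disj by blast+
  let ?f = "face_at \<sigma> z"
  note f = boundary[OF z']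
  have "g \<inter> \<sigma> \<subseteq> ?f"
    by (rule face_contains[OF f(2) _ rat_cone_is_cone[OF rat] z f(3)]) simp
  then have eq: "g \<inter> \<sigma> = g \<inter> ?f" using face_subset[OF f(2)] by blast
  have "?f \<in> \<Gamma>" using f(1) \<Gamma>(2) by blast
  then show "face (g \<inter> \<sigma>) g" "face (g \<inter> \<sigma>) \<sigma>"
    unfolding eq using fan_Int[OF \<Gamma>(1,3)] fan_Int2[OF \<Gamma>(1,3)] face_trans[OF _ f(2)] by blast+
qed

section \<open>Subdividing along the new cone and isolating it\<close>

text \<open>If \<open>rel_int C\<close> meets \<open>\<sigma>\<close>, the apex direction
  \<open>p\<close> is taken in \<open>\<sigma>\<close>. A new cone whose relative interior meets
  \<open>\<sigma>\<close> then has a base whose relative interior meets \<open>\<sigma>\<close>, so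
  the invariant passes from the base to the cone.\<close>

lemma subdivide_cone:
  assumes \<Gamma>: "rat_fan \<Gamma>" "K0 \<subseteq> \<Gamma>" "\<Union>\<Gamma> = UNIV"
  obtains \<Gamma>' where "rat_fan \<Gamma>'" "K0 \<subseteq> \<Gamma>'" "\<Union>\<Gamma>' = UNIV"
    "\<And>f x. f \<in> \<Gamma>' \<Longrightarrow> x \<in> rel_int f \<Longrightarrow> x \<in> \<sigma> \<Longrightarrow> f \<subseteq> \<sigma>"
proof -
  define I where "I = (\<lambda>F. \<forall>f\<in>F. \<forall>x\<in>rel_int f. x \<in> \<sigma> \<longrightarrow> f \<subseteq> \<sigma>)"
  have I0: "I K0"
    unfolding I_def
  proof (intro ballI impI)
    fix f x assume "f \<in> K0" "x \<in> rel_int f" "x \<in> \<sigma>"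
    moreover have "f \<in> \<Sigma>" using \<open>f \<in> K0\<close> K0 by (auto simp: subfan_def)
    ultimately show "f \<subseteq> \<sigma>" using fan_rel_int_subset[OF \<Sigma> _ \<sigma>(1)] by blast
  qed
  have step: "\<exists>p\<in>N. p \<in> rel_int C \<and> (rat_fan (cone_off F C p) \<longrightarrow> I (cone_off F C p))"
    if F: "rat_fan F" "K0 \<subseteq> F" "I F" and C: "C \<in> \<Gamma>" and disj: "rel_int C \<inter> \<Union>F = {}" for F C
  proof -
    have cC: "rat_cone C" "is_cone C" using \<Gamma>(1) C fan_rat_cone fan_is_cone by blast+
    \<comment> \<open>By \<open>rel_int_adjoin\<close> only the base point \<open>y\<close> and the
      direction \<open>p\<close> need to be checked. The assumption that the point is in
      \<open>rel_int C\<close> comes for free and makes the check vacuous when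
      \<open>rel_int C\<close> misses \<open>\<sigma>\<close>.\<close>
    have new: "I (cone_off F C p)"
      if p: "p \<in> rel_int C" and *: "\<And>g y t. g \<in> F \<Longrightarrow> g \<subseteq> C \<Longrightarrow> y \<in> rel_int g \<Longrightarrow> t > 0 \<Longrightarrow>
        y + t *s p \<in> \<sigma> \<Longrightarrow> y + t *s p \<in> rel_int C \<Longrightarrow> y \<in> \<sigma> \<and> p \<in> \<sigma>" for p
      unfolding I_def
    proof (intro ballI impI)
      fix f x assume f: "f \<in> cone_off F C p" and x: "x \<in> rel_int f" "x \<in> \<sigma>"
      show "f \<subseteq> \<sigma>"
      proof (cases "f \<in> F")
        case True
        then show ?thesis using x F(3) unfolding I_def by blast
      next
        case False
        then obtain g where g: "g \<in> F" "g \<subseteq> C" "f = adjoin p g" using f unfolding cone_off_def by blast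
        have cg: "is_cone g" using F(1) g(1) by (rule fan_is_cone)
        have bd: "g \<subseteq> C - rel_int C" using g disj by blast
        obtain y t where y: "x = y + t *s p" "y \<in> rel_int g" "t > 0"
          using rel_int_adjoin[OF cC(2) p cg bd] x(1) g(3) by blast
        have "y \<in> C" using y(2) g(2) rel_int_subset by blast
        then have "x \<in> rel_int C"
          using rel_int_add[OF cC(2) rel_int_scale[OF cC(2) p y(3)], of y] y(1) by (simp add: add.commute)
        then have "y \<in> \<sigma> \<and> p \<in> \<sigma>" using *[OF g(1,2) y(2,3)] x(2) y(1) by simp
        moreover from this have "g \<subseteq> \<sigma>" using F(3) g(1) y(2) unfolding I_def by blast
        ultimately show ?thesis using g(3) adjoin_subset[OF \<sigma>_cone(2)] by simp
      qed
    qed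
    show ?thesis
    proof (cases "rel_int C \<inter> \<sigma> = {}")
      case True
      obtain p where "p \<in> N" "p \<in> rel_int C" using rat_cone_rel_int[OF cC(1)] by blast
      then show ?thesis using new[of p] True by blast
    next
      case False
      then obtain q where q: "q \<in> rel_int C" "q \<in> \<sigma>" by blast
      then have qC: "q \<in> C" using rel_int_subset by blast
      \<comment> \<open>Being interior to \<open>C \<inter> \<sigma>\<close>, the vector
        \<open>p\<close> is a positive multiple of \<open>q\<close> plus a vector of
        \<open>C\<close>, hence also interior to \<open>C\<close>.\<close>
      obtain p where p: "p \<in> N" "p \<in> rel_int (C \<inter> \<sigma>)"
        using rat_cone_rel_int[OF rat_cone_Int[OF cC(1) \<sigma>_cone(1)]] by blast
      then have p\<sigma>: "p \<in> C" "p \<in> \<sigma>" using rel_int_subset by blast+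
      obtain t where t: "t > 0" "p - t *s q \<in> C"
        using p(2) q qC unfolding rel_int_def by blast
      have pri: "p \<in> rel_int C"
        using rel_int_add[OF cC(2) rel_int_scale[OF cC(2) q(1) t(1)] t(2)] by simp
      have "p \<noteq> 0" using pri disj fan_zero[OF F(1)] by blast
      have "I (cone_off F C p)"
      proof (rule new[OF pri])
        fix g y and t :: 'r
        assume g: "g \<in> F" "g \<subseteq> C" "y \<in> rel_int g" "t > 0" and x: "y + t *s p \<in> \<sigma>"
        \<comment> \<open>The exit point lies on the boundary of \<open>\<sigma>\<close>, hence in
          the support of \<open>K0\<close>, hence outside \<open>rel_int C\<close>. It therefore
          cannot come before \<open>y\<close>, and \<open>y\<close> is the exit point plus a
          nonnegative multiple of \<open>p\<close>.\<close>
        obtain s where s: "0 \<le> s" "y + t *s p - s *s p \<in> \<sigma>" "y + t *s p - s *s p \<notin> rel_int \<sigma>"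
          using pointed_exit[OF \<sigma>_cone(1,3) x p\<sigma>(2) \<open>p \<noteq> 0\<close>] by blast
        have "y + t *s p - s *s p \<in> \<Union>F"
          using boundary[OF s(2,3)] F(2) by blast
        then have nri: "y + t *s p - s *s p \<notin> rel_int C" using disj by blast
        have "t \<le> s"
        proof (rule ccontr)
          assume "\<not> t \<le> s"
          moreover have "y \<in> C" using g rel_int_subset by blast
          ultimately have "(t - s) *s p + y \<in> rel_int C"
            using rel_int_add[OF cC(2) rel_int_scale[OF cC(2) pri]] by simp
          moreover have "(t - s) *s p + y = y + t *s p - s *s p"
            by (simp add: scale_left_diff_distrib)
          ultimately show False using nri by simp
        qed
        then have "(y + t *s p - s *s p) + (s - t) *s p \<in> \<sigma>"
          using s(2) p\<sigma>(2) by (intro cone_add[OF \<sigma>_cone(2)] cone_scale[OF \<sigma>_cone(2)]) auto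
        moreover have "(y + t *s p - s *s p) + (s - t) *s p = y"
          by (simp add: scale_left_diff_distrib)
        ultimately show "y \<in> \<sigma> \<and> p \<in> \<sigma>" using p\<sigma>(2) by simp
      qed
      then show ?thesis using p(1) pri by blast
    qed
  qed
  have "\<exists>\<Gamma>'. refines \<Gamma>' \<Gamma> \<and> K0 \<subseteq> \<Gamma>' \<and> I \<Gamma>'"
    by (rule extend_refinement[where I = I, OF \<Gamma>(1) K0_subfan[OF \<Gamma>(2)] refines_refl[OF K0_fan] I0])
      (rule step; assumption)
  then obtain \<Gamma>' where \<Gamma>': "refines \<Gamma>' \<Gamma>" "K0 \<subseteq> \<Gamma>'" "I \<Gamma>'" by blast
  show ?thesis
    by (rule that[of \<Gamma>']) (use \<Gamma>' \<Gamma>(3) in \<open>auto simp: refines_def I_def\<close>)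
qed

text \<open>All cones of \<open>K0\<close> and all cones inside \<open>\<sigma>\<close> are kept;
  every other cone \<open>C\<close> is coned off from a direction outside \<open>\<sigma>\<close>.
  Points of \<open>\<sigma>\<close> and of the support of \<open>K0\<close> avoid
  \<open>rel_int C\<close>, so a new cone contains no more of them than its base does.\<close>

lemma separate_from_cone:
  assumes \<Gamma>: "rat_fan \<Gamma>" "K0 \<subseteq> \<Gamma>" "\<Union>\<Gamma> = UNIV"
    and sub: "\<And>f x. f \<in> \<Gamma> \<Longrightarrow> x \<in> rel_int f \<Longrightarrow> x \<in> \<sigma> \<Longrightarrow> f \<subseteq> \<sigma>"
  obtains \<Gamma>' where "rat_fan \<Gamma>'" "K0 \<subseteq> \<Gamma>'" "\<Union>\<Gamma>' = UNIV"
    "\<And>g \<kappa>. g \<in> \<Gamma>' \<Longrightarrow> \<kappa> \<in> K0 \<Longrightarrow> \<kappa> \<subseteq> g \<Longrightarrow> g \<inter> rel_int \<sigma> \<noteq> {} \<Longrightarrow> \<kappa> \<subseteq> \<sigma>"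
proof -
  define K where "K = K0 \<union> {g \<in> \<Gamma>. g \<subseteq> \<sigma>}"
  define I where "I = (\<lambda>F. \<forall>g\<in>F. \<forall>\<kappa>\<in>K0. \<kappa> \<subseteq> g \<longrightarrow> g \<inter> rel_int \<sigma> \<noteq> {} \<longrightarrow> \<kappa> \<subseteq> \<sigma>)"
  have K: "subfan K \<Gamma>"
    using K0_subfan[OF \<Gamma>(2)] fan_face[OF \<Gamma>(1)] face_subset
    unfolding subfan_def K_def by blast
  have I0: "I K"
    using K0_rel_int unfolding I_def K_def by blast
  have step: "\<exists>p\<in>N. p \<in> rel_int C \<and> (rat_fan (cone_off F C p) \<longrightarrow> I (cone_off F C p))"
    if F: "rat_fan F" "K \<subseteq> F" "I F" and C: "C \<in> \<Gamma>" "C \<notin> K" and disj: "rel_int C \<inter> \<Union>F = {}" for F C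
  proof -
    have cC: "rat_cone C" "is_cone C" using \<Gamma>(1) C fan_rat_cone fan_is_cone by blast+
    have disj\<sigma>: "rel_int C \<inter> \<sigma> = {}" using sub C unfolding K_def by blast
    obtain p where p: "p \<in> N" "p \<in> rel_int C" using rat_cone_rel_int[OF cC(1)] by blast
    have zero: "t = 0" if "y \<in> C" "0 \<le> t" "y + t *s p \<notin> rel_int C" for y t
      using rel_int_add[OF cC(2) rel_int_scale[OF cC(2) p(2)] that(1), of t] that(2,3)
      by (auto simp: add.commute order_le_less)
    have "I (cone_off F C p)"
      unfolding I_def
    proof (intro ballI impI)
      fix f \<kappa> assume f: "f \<in> cone_off F C p" and \<kappa>: "\<kappa> \<in> K0" "\<kappa> \<subseteq> f" and meet: "f \<inter> rel_int \<sigma> \<noteq> {}"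
      show "\<kappa> \<subseteq> \<sigma>"
      proof (cases "f \<in> F")
        case True
        then show ?thesis using \<kappa> meet F(3) unfolding I_def by blast
      next
        case False
        then obtain g where g: "g \<in> F" "g \<subseteq> C" "f = adjoin p g" using f unfolding cone_off_def by blast
        \<comment> \<open>A positive coefficient of \<open>p\<close> would put \<open>x\<close> into
          \<open>rel_int C\<close>.\<close>
        have drop: "x \<in> g" if x: "x \<in> f" "x \<notin> rel_int C" for x
        proof -
          have "x \<in> adjoin p g" using x(1) g(3) by simp
          then obtain y t where y: "x = y + t *s p" "y \<in> g" "0 \<le> t" by (rule adjoinE)
          have "t = 0" by (rule zero[OF _ y(3)]) (use y(1,2) g(2) x(2) in auto)
          then show ?thesis using y by simp
        qed
        have "\<kappa> \<subseteq> g"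
          using drop \<kappa> disj F(2) unfolding K_def by blast
        moreover have "g \<inter> rel_int \<sigma> \<noteq> {}"
          using drop meet disj\<sigma> rel_int_subset[of \<sigma>] by blast
        ultimately show ?thesis using g(1) \<kappa>(1) F(3) unfolding I_def by blast
      qed
    qed
    then show ?thesis using p by blast
  qed
  have "\<exists>\<Gamma>'. refines \<Gamma>' \<Gamma> \<and> K \<subseteq> \<Gamma>' \<and> I \<Gamma>'"
    by (rule extend_refinement[where I = I, OF \<Gamma>(1) K refines_refl[OF subfan_rat_fan[OF \<Gamma>(1) K]] I0])
      (rule step; assumption)
  then obtain \<Gamma>' where \<Gamma>': "refines \<Gamma>' \<Gamma>" "K \<subseteq> \<Gamma>'" "I \<Gamma>'" by blast
  show ?thesis
    by (rule that[of \<Gamma>']) (use \<Gamma>' \<Gamma>(3) in \<open>auto simp: refines_def I_def K_def\<close>)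
qed

section \<open>Refining near the new cone and replacing its star\<close>

text \<open>The condition on \<open>x\<close> in the last two conclusions describes the star of
  \<open>\<sigma>\<close> in the arrangement of \<open>H\<close>. The cones needed to cover it form
  \<open>G\<close>; intersecting them with cells leaves \<open>K0\<close> untouched because
  \<open>G\<close> meets \<open>K0\<close> only in faces of the single cell
  \<open>\<sigma>\<close>.\<close>

lemma refine_near_cone:
  assumes \<Gamma>: "rat_fan \<Gamma>" "K0 \<subseteq> \<Gamma>" "\<Union>\<Gamma> = UNIV"
    and apart: "\<And>g \<kappa>. g \<in> \<Gamma> \<Longrightarrow> \<kappa> \<in> K0 \<Longrightarrow> \<kappa> \<subseteq> g \<Longrightarrow> g \<inter> rel_int \<sigma> \<noteq> {} \<Longrightarrow> \<kappa> \<subseteq> \<sigma>"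
    and s: "s \<in> rel_int \<sigma>"
  obtains H \<Gamma>' where "finite H" "H \<subseteq> M" "\<sigma> = {x. \<forall>h\<in>H. 0 \<le> h x}"
    "rat_fan \<Gamma>'" "K0 \<subseteq> \<Gamma>'" "\<Union>\<Gamma>' = UNIV"
    "\<And>\<kappa> x. \<kappa> \<in> K0 \<Longrightarrow> x \<in> \<kappa> \<Longrightarrow> \<forall>h\<in>H. 0 < h s \<longrightarrow> 0 \<le> h x \<Longrightarrow> x \<in> \<sigma>"
    "\<And>\<gamma> x. \<gamma> \<in> \<Gamma>' \<Longrightarrow> x \<in> rel_int \<gamma> \<Longrightarrow> \<forall>h\<in>H. 0 < h s \<longrightarrow> 0 \<le> h x \<Longrightarrow> \<gamma> \<subseteq> cell H x"
proof -
  have s\<sigma>: "s \<in> \<sigma>" using s rel_int_subset by blast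
  obtain L where L: "finite L" "L \<subseteq> M" "\<sigma> = {x. \<forall>u\<in>L. 0 \<le> u x}"
    using \<sigma>_cone(1) unfolding rat_cone_def by blast
  define B where "B = {g \<in> \<Gamma>. g \<inter> rel_int \<sigma> = {}}"
  have "\<exists>u. u \<in> M \<and> (\<forall>x\<in>\<sigma>. 0 \<le> u x) \<and> (\<forall>y\<in>g. u y \<le> 0) \<and>
      (\<forall>x\<in>\<sigma>. u x = 0 \<longrightarrow> x \<in> g) \<and> (\<forall>y\<in>g. u y = 0 \<longrightarrow> y \<in> \<sigma>)" if "g \<in> B" for g
  proof -
    have g: "g \<in> \<Gamma>" "g \<inter> rel_int \<sigma> = {}" using that unfolding B_def by auto
    note f = face_Int_boundary[OF \<Gamma>(1,2) g]
    show ?thesis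
      by (rule separation[OF \<sigma>_cone(1) fan_rat_cone[OF \<Gamma>(1) g(1)]])
        (use f in \<open>auto simp: Int_commute\<close>)
  qed
  then have "\<forall>g\<in>B. \<exists>u. u \<in> M \<and> (\<forall>x\<in>\<sigma>. 0 \<le> u x) \<and> (\<forall>y\<in>g. u y \<le> 0) \<and>
      (\<forall>x\<in>\<sigma>. u x = 0 \<longrightarrow> x \<in> g) \<and> (\<forall>y\<in>g. u y = 0 \<longrightarrow> y \<in> \<sigma>)" by blast
  from bchoice[OF this] obtain u where u: "\<forall>g\<in>B. u g \<in> M \<and> (\<forall>x\<in>\<sigma>. 0 \<le> u g x) \<and>
      (\<forall>y\<in>g. u g y \<le> 0) \<and> (\<forall>x\<in>\<sigma>. u g x = 0 \<longrightarrow> x \<in> g) \<and> (\<forall>y\<in>g. u g y = 0 \<longrightarrow> y \<in> \<sigma>)"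
    by blast
  define H where "H = L \<union> u ` B"
  have H: "finite H" "H \<subseteq> M"
    using L u fan_finite[OF \<Gamma>(1)] unfolding H_def B_def by auto
  have \<sigma>_eq: "\<sigma> = {x. \<forall>h\<in>H. 0 \<le> h x}"
  proof
    show "\<sigma> \<subseteq> {x. \<forall>h\<in>H. 0 \<le> h x}" using L(3) u unfolding H_def by auto
    show "{x. \<forall>h\<in>H. 0 \<le> h x} \<subseteq> \<sigma>" unfolding L(3) H_def by auto
  qed
  have nonneg: "0 \<le> h x" if "h \<in> H" "x \<in> \<sigma>" for h x using that \<sigma>_eq by blast
  \<comment> \<open>Since \<open>s \<notin> g\<close>, the functional \<open>u g\<close> is positive
    at \<open>s\<close>, so the star condition makes it nonnegative at \<open>x\<close>. It is
    nonpositive on \<open>g\<close>, hence 0 at \<open>x\<close>, and \<open>separation\<close> puts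
    \<open>x\<close> into \<open>\<sigma>\<close>.\<close>
  have near: "x \<in> \<sigma>" if "g \<in> B" "x \<in> g" "\<forall>h\<in>H. 0 < h s \<longrightarrow> 0 \<le> h x" for g x
  proof -
    have uH: "u g \<in> H" using that(1) unfolding H_def by blast
    have "s \<notin> g" using s that(1) unfolding B_def by blast
    then have "u g s \<noteq> 0" using u that(1) s\<sigma> by blast
    moreover have "0 \<le> u g s" using u that(1) s\<sigma> by blast
    ultimately have "0 < u g s" by simp
    then have "0 \<le> u g x" using that(3) uH by blast
    then have "u g x = 0" using u that(1,2) by (meson order_antisym)
    then show ?thesis using u that(1,2) by blast
  qed
  define Y where "Y = range (cell H)"
  have Y: "rat_fan Y"
    unfolding Y_def
  proof (rule rat_fan_cells[OF H])
    fix x assume "\<forall>h\<in>H. h x = 0"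
    moreover from this have "\<forall>h\<in>H. h (- x) = 0" using H(2) by (auto simp: M_linear subset_iff)
    ultimately have "x \<in> \<sigma>" "- x \<in> \<sigma>" unfolding \<sigma>_eq by auto
    then show "x = 0" using \<sigma>_cone(3) unfolding pointed_def by blast
  qed
  have \<sigma>_cell: "\<sigma> = cell H s"
  proof
    show "\<sigma> \<subseteq> cell H s"
    proof
      fix x assume x: "x \<in> \<sigma>"
      obtain t where t: "t > 0" "s - t *s x \<in> \<sigma>" using s x unfolding rel_int_def by blast
      have "h x \<le> 0" if "h \<in> H" "h s \<le> 0" for h
      proof -
        have "0 \<le> h s - t * h x" using nonneg[OF that(1) t(2)] that(1) H(2) by (auto simp: M_linear subset_iff)
        then have "t * h x \<le> 0" using that(2) by linarith
        then show ?thesis using t(1) by (simp add: mult_le_0_iff)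
      qed
      then show "x \<in> cell H s" using nonneg x unfolding cell_def by blast
    qed
    show "cell H s \<subseteq> \<sigma>"
      using nonneg[OF _ s\<sigma>] unfolding \<sigma>_eq cell_def by blast
  qed
  then have \<sigma>Y: "\<sigma> \<in> Y" unfolding Y_def by blast
  \<comment> \<open>The proper faces of \<open>\<sigma>\<close> are included because points of the
    star in cones of \<open>B\<close> lie on the boundary of \<open>\<sigma>\<close>.\<close>
  define G where "G = {g \<in> \<Gamma>. \<exists>g'\<in>\<Gamma>. g \<subseteq> g' \<and> g' \<inter> rel_int \<sigma> \<noteq> {}} \<union> {f. face f \<sigma> \<and> f \<noteq> \<sigma>}"
  have G: "subfan G \<Gamma>"
    unfolding subfan_def
  proof (intro conjI ballI allI impI)
    obtain g where "g \<in> \<Gamma>" "s \<in> g" using \<Gamma>(3) by blast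
    then show "G \<noteq> {}" using s unfolding G_def by blast
    show "G \<subseteq> \<Gamma>" using proper_faces \<Gamma>(2) unfolding G_def by blast
    fix C F assume C: "C \<in> G" and F: "face F C"
    show "F \<in> G"
    proof (cases "face C \<sigma> \<and> C \<noteq> \<sigma>")
      case True
      then have "face F \<sigma>" "F \<noteq> \<sigma>" using face_trans[OF F] face_subset F by blast+
      then show ?thesis unfolding G_def by blast
    next
      case False
      then obtain g' where "C \<in> \<Gamma>" "g' \<in> \<Gamma>" "C \<subseteq> g'" "g' \<inter> rel_int \<sigma> \<noteq> {}"
        using C unfolding G_def by blast
      moreover from this have "F \<in> \<Gamma>" "F \<subseteq> g'"
        using fan_face[OF \<Gamma>(1) _ F] face_subset[OF F] by auto
      ultimately show ?thesis unfolding G_def by blast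
    qed
  qed
  have fG: "rat_fan G" using \<Gamma>(1) G by (rule subfan_rat_fan)
  \<comment> \<open>The intersection is a cone of \<open>K0\<close> inside a cone that meets
    \<open>rel_int \<sigma>\<close>, so \<open>apart\<close> applies.\<close>
  have G_K0: "g \<inter> \<kappa> \<subseteq> \<sigma>" if g: "g \<in> G" and \<kappa>: "\<kappa> \<in> K0" for g \<kappa>
  proof (cases "face g \<sigma>")
    case True
    then show ?thesis using face_subset by blast
  next
    case False
    then obtain g' where g': "g \<in> \<Gamma>" "g' \<in> \<Gamma>" "g \<subseteq> g'" "g' \<inter> rel_int \<sigma> \<noteq> {}"
      using g unfolding G_def by blast
    have "\<kappa> \<in> \<Gamma>" using \<kappa> \<Gamma>(2) by blast
    then have "g \<inter> \<kappa> \<in> K0"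
      using fan_Int2[OF \<Gamma>(1) g'(1)] fan_face[OF K0_fan \<kappa>] by blast
    then show ?thesis using apart[OF g'(2) _ _ g'(4)] g'(3) by blast
  qed
  define G' where "G' = {g \<inter> y | g y. g \<in> G \<and> y \<in> Y}"
  have fG': "rat_fan G'" unfolding G'_def using fG Y by (rule rat_fan_meet)
  have UG': "\<Union>G' = \<Union>G"
  proof
    show "\<Union>G' \<subseteq> \<Union>G" unfolding G'_def by blast
    show "\<Union>G \<subseteq> \<Union>G'"
    proof
      fix x assume "x \<in> \<Union>G"
      then obtain g where "g \<in> G" "x \<in> g" by blast
      then have "g \<inter> cell H x \<in> G'" "x \<in> g \<inter> cell H x"
        unfolding G'_def Y_def using mem_cell by auto
      then show "x \<in> \<Union>G'" by blast
    qed
  qed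
  have K: "subfan (G \<union> K0) \<Gamma>"
    using G K0_subfan[OF \<Gamma>(2)] unfolding subfan_def by blast
  have fK': "rat_fan (G' \<union> K0)"
  proof (rule rat_fan_Un[OF fG' K0_fan])
    fix g' \<kappa> assume "g' \<in> G'" and \<kappa>: "\<kappa> \<in> K0"
    then obtain g y where g: "g' = g \<inter> y" "g \<in> G" "y \<in> Y" unfolding G'_def by blast
    let ?f = "g \<inter> \<kappa>"
    have \<Gamma>g: "g \<in> \<Gamma>" "\<kappa> \<in> \<Gamma>" using g(2) \<kappa> G \<Gamma>(2) unfolding subfan_def by blast+
    have f: "face ?f g" "face ?f \<kappa>"
      using fan_Int[OF \<Gamma>(1) \<Gamma>g] fan_Int2[OF \<Gamma>(1) \<Gamma>g] by auto
    have "?f \<in> \<Sigma>" using fan_face[OF K0_fan \<kappa> f(2)] K0 unfolding subfan_def by blast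
    \<comment> \<open>As a face of the cell \<open>\<sigma>\<close>, the common face
      \<open>?f\<close> of \<open>g\<close> and \<open>\<kappa>\<close> is itself a cell, and
      cutting it with \<open>y\<close> yields a face.\<close>
    then have "face ?f \<sigma>"
      using fan_subset_face[OF \<Sigma> _ \<sigma>(1)] G_K0[OF g(2) \<kappa>] by blast
    then have "?f \<in> Y" using fan_face[OF Y \<sigma>Y] by blast
    then have fy: "face (?f \<inter> y) ?f" using fan_Int[OF Y _ g(3)] by blast
    have "face (?f \<inter> y) (g \<inter> y)"
      using face_Int[OF f(1) face_refl[OF fan_is_cone[OF Y g(3)]]] .
    moreover have "face (?f \<inter> y) \<kappa>" using face_trans[OF fy f(2)] .
    moreover have "g' \<inter> \<kappa> = ?f \<inter> y" using g(1) by blast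
    ultimately show "face (g' \<inter> \<kappa>) g' \<and> face (g' \<inter> \<kappa>) \<kappa>" using g(1) by simp
  qed
  have ref: "refines (G' \<union> K0) (G \<union> K0)"
    unfolding refines_def
  proof (intro conjI ballI)
    show "\<Union>(G' \<union> K0) = \<Union>(G \<union> K0)" using UG' by simp
    fix f assume "f \<in> G' \<union> K0"
    then show "\<exists>k\<in>G \<union> K0. f \<subseteq> k" unfolding G'_def by blast
  qed (rule fK')
  have "\<exists>\<Gamma>'. refines \<Gamma>' \<Gamma> \<and> G' \<union> K0 \<subseteq> \<Gamma>' \<and> True"
  proof (rule extend_refinement[where I = "\<lambda>_. True", OF \<Gamma>(1) K ref TrueI])
    fix C assume "C \<in> \<Gamma>"
    then obtain p where "p \<in> N" "p \<in> rel_int C"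
      using rat_cone_rel_int[OF fan_rat_cone[OF \<Gamma>(1)]] by blast
    then show "\<exists>p\<in>N. p \<in> rel_int C \<and> (rat_fan (cone_off F C p) \<longrightarrow> True)" for F by blast
  qed
  then obtain \<Gamma>' where \<Gamma>': "refines \<Gamma>' \<Gamma>" "G' \<union> K0 \<subseteq> \<Gamma>'" by blast
  then have f\<Gamma>': "rat_fan \<Gamma>'" "\<Union>\<Gamma>' = UNIV" using \<Gamma>(3) unfolding refines_def by auto
  show ?thesis
  proof (rule that[OF H \<sigma>_eq f\<Gamma>'(1) _ f\<Gamma>'(2)])
    show "K0 \<subseteq> \<Gamma>'" using \<Gamma>'(2) by blast
    show "x \<in> \<sigma>" if "\<kappa> \<in> K0" "x \<in> \<kappa>" "\<forall>h\<in>H. 0 < h s \<longrightarrow> 0 \<le> h x" for \<kappa> x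
      by (rule near[OF _ that(2,3)]) (use that(1) \<Gamma>(2) K0_rel_int in \<open>auto simp: B_def\<close>)
    fix \<gamma> x assume \<gamma>: "\<gamma> \<in> \<Gamma>'" "x \<in> rel_int \<gamma>" and x: "\<forall>h\<in>H. 0 < h s \<longrightarrow> 0 \<le> h x"
    \<comment> \<open>If the cone of \<open>\<Gamma>\<close> found at \<open>x\<close> misses
      \<open>rel_int \<sigma>\<close>, then \<open>near\<close> puts \<open>x\<close> on the
      boundary of \<open>\<sigma>\<close>, and the proper face there serves instead.\<close>
    obtain g where g: "g \<in> G" "x \<in> g"
    proof -
      obtain g where g: "g \<in> \<Gamma>" "x \<in> g" using \<Gamma>(3) by blast
      show ?thesis
      proof (cases "g \<inter> rel_int \<sigma> = {}")
        case True
        then have "x \<in> \<sigma>" using near[OF _ g(2) x] g(1) unfolding B_def by blast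
        moreover have "x \<notin> rel_int \<sigma>" using True g(2) by blast
        ultimately have f: "face_at \<sigma> x \<in> K0" "face (face_at \<sigma> x) \<sigma>" "x \<in> face_at \<sigma> x"
          using boundary by auto
        moreover from this have "face_at \<sigma> x \<noteq> \<sigma>" using \<sigma>(2) by metis
        ultimately have "face_at \<sigma> x \<in> G" unfolding G_def by blast
        then show ?thesis using f(3) by (rule that)
      next
        case False
        then have "g \<in> G" using g unfolding G_def by blast
        then show ?thesis using g(2) by (rule that)
      qed
    qed
    have "g \<inter> cell H x \<in> \<Gamma>'" using g(1) \<Gamma>'(2) unfolding G'_def Y_def by blast
    then have "\<gamma> \<subseteq> g \<inter> cell H x"
      using fan_rel_int_subset[OF f\<Gamma>'(1) \<gamma>(1) _ \<gamma>(2)] g(2) mem_cell by blast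
    then show "\<gamma> \<subseteq> cell H x" by blast
  qed
qed

text \<open>The cones in \<open>Out\<close> are kept, and \<open>P\<close> is filled anew by
  \<open>\<Delta>\<close>. The latter extends over the cells in \<open>P\<close> the refinement that
  \<open>Out\<close> induces where \<open>Q\<close> ends, with \<open>\<sigma>\<close> and its faces
  left whole.\<close>

lemma replace_star:
  assumes \<Gamma>: "rat_fan \<Gamma>" "K0 \<subseteq> \<Gamma>" "\<Union>\<Gamma> = UNIV"
    and H: "finite H" "H \<subseteq> M" "\<sigma> = {x. \<forall>h\<in>H. 0 \<le> h x}" and s: "s \<in> rel_int \<sigma>"
    and near: "\<And>\<kappa> x. \<kappa> \<in> K0 \<Longrightarrow> x \<in> \<kappa> \<Longrightarrow> \<forall>h\<in>H. 0 < h s \<longrightarrow> 0 \<le> h x \<Longrightarrow> x \<in> \<sigma>"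
    and fine: "\<And>\<gamma> x. \<gamma> \<in> \<Gamma> \<Longrightarrow> x \<in> rel_int \<gamma> \<Longrightarrow> \<forall>h\<in>H. 0 < h s \<longrightarrow> 0 \<le> h x \<Longrightarrow> \<gamma> \<subseteq> cell H x"
  obtains \<Gamma>' where "rat_fan \<Gamma>'" "insert \<sigma> K0 \<subseteq> \<Gamma>'" "\<Union>\<Gamma>' = UNIV"
proof -
  have s\<sigma>: "s \<in> \<sigma>" using s rel_int_subset by blast
  have lin: "h (x + y) = h x + h y" "h (c *s x) = c * h x" "h (x - y) = h x - h y" "h (- x) = - h x"
    if "h \<in> H" for h x y c
    using that H(2) by (auto simp: M_linear subset_iff)
  have nonneg: "0 \<le> h x" if "h \<in> H" "x \<in> \<sigma>" for h x using that H(3) by blast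
  \<comment> \<open>\<open>P\<close> is the closed star of \<open>\<sigma>\<close>, and
    \<open>Q\<close> is the part where the constraints positive at \<open>s\<close> are
    strict.\<close>
  define P where "P = {x. \<forall>h\<in>H. 0 < h s \<longrightarrow> 0 \<le> h x}"
  define Q where "Q = {x. \<forall>h\<in>H. 0 < h s \<longrightarrow> 0 < h x}"
  have QP: "Q \<subseteq> P" unfolding P_def Q_def by auto
  have \<sigma>P: "\<sigma> \<subseteq> P" using nonneg unfolding P_def by blast
  have zero: "h x = 0" if h: "h \<in> H" "h s = 0" and x: "x \<in> \<sigma>" for h x
  proof -
    obtain t where t: "t > 0" "s - t *s x \<in> \<sigma>" using s x unfolding rel_int_def by blast
    have "t * h x \<le> 0" using nonneg[OF h(1) t(2)] h by (simp add: lin)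
    then show ?thesis using t(1) nonneg[OF h(1) x] by (simp add: mult_le_0_iff)
  qed
  have \<sigma>_cell: "cell H s = \<sigma>"
  proof
    show "cell H s \<subseteq> \<sigma>" using nonneg[OF _ s\<sigma>] unfolding H(3) cell_def by blast
    show "\<sigma> \<subseteq> cell H s"
    proof
      fix x assume x: "x \<in> \<sigma>"
      have "h s \<le> 0 \<longrightarrow> h x \<le> 0" if "h \<in> H" for h
        using zero[OF that _ x] nonneg[OF that s\<sigma>] by force
      then show "x \<in> cell H s" using nonneg[OF _ x] unfolding cell_def by blast
    qed
  qed
  have \<sigma>Q: "\<sigma> \<inter> Q \<subseteq> rel_int \<sigma>"
  proof
    fix z assume z: "z \<in> \<sigma> \<inter> Q"
    have "\<exists>t>0. z - t *s x \<in> \<sigma>" if x: "x \<in> \<sigma>" for x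
    proof -
      have "\<forall>h\<in>H. 0 < h z \<or> 0 \<le> h z \<and> h x \<le> 0"
      proof
        fix h assume h: "h \<in> H"
        show "0 < h z \<or> 0 \<le> h z \<and> h x \<le> 0"
        proof (cases "h s = 0")
          case True
          then show ?thesis using zero[OF h True x] nonneg[OF h, of z] z by simp
        next
          case False
          then show ?thesis using nonneg[OF h s\<sigma>] h z unfolding Q_def by auto
        qed
      qed
      from small_step_cone[OF H(1,2) this] show ?thesis unfolding H(3) by blast
    qed
    then show "z \<in> rel_int \<sigma>" using z unfolding rel_int_def by blast
  qed
  have K0Q: "\<kappa> \<inter> Q = {}" if "\<kappa> \<in> K0" for \<kappa>
  proof -
    have "\<kappa> \<inter> Q \<subseteq> \<sigma> \<inter> Q" using near[OF that] QP unfolding P_def by blast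
    then show ?thesis using \<sigma>Q K0_rel_int[OF that] by blast
  qed
  have cellP: "cell H x \<subseteq> P" if "x \<in> P" for x
    using that unfolding cell_def P_def by blast
  have cellQ: "cell H x \<inter> Q = {}" if x: "x \<in> P" "x \<notin> Q" for x
  proof -
    obtain h where h: "h \<in> H" "0 < h s" "\<not> 0 < h x" using x(2) unfolding Q_def by blast
    then have "h x \<le> 0" by simp
    then have "h z \<le> 0" if "z \<in> cell H x" for z using h(1) that unfolding cell_def by blast
    then show ?thesis using h unfolding Q_def by force
  qed
  have fine': "\<gamma> \<subseteq> cell H x" if "\<gamma> \<in> \<Gamma>" "x \<in> rel_int \<gamma>" "x \<in> P" for \<gamma> x
    using fine that unfolding P_def by blast

  define Out where "Out = {\<gamma> \<in> \<Gamma>. \<gamma> \<inter> Q = {}}"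
  have K0_Out: "K0 \<subseteq> Out" using \<Gamma>(2) K0Q unfolding Out_def by blast
  have sOut: "subfan Out \<Gamma>"
    unfolding subfan_def
  proof (intro conjI ballI allI impI)
    show "Out \<noteq> {}" using K0_Out fan_nonempty[OF K0_fan] by blast
    show "Out \<subseteq> \<Gamma>" unfolding Out_def by blast
    show "F \<in> Out" if "C \<in> Out" "face F C" for C F
      using that fan_face[OF \<Gamma>(1) _ that(2)] face_subset[OF that(2)] unfolding Out_def by blast
  qed
  have fOut: "rat_fan Out" using \<Gamma>(1) sOut by (rule subfan_rat_fan)
  \<comment> \<open>If \<open>\<gamma>\<close> met \<open>Q\<close>, it would have a relative
    interior point in \<open>Q\<close>. By \<open>fine'\<close> it would lie in a cell inside
    \<open>P\<close>, so \<open>x \<in> P\<close>; then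
    \<open>\<gamma> \<subseteq> cell H x\<close>, which misses \<open>Q\<close> because
    \<open>x\<close> does.\<close>
  have Out_cover: "\<gamma> \<in> Out" if \<gamma>: "\<gamma> \<in> \<Gamma>" "x \<in> rel_int \<gamma>" and x: "x \<notin> Q" for \<gamma> x
  proof (rule ccontr)
    assume "\<gamma> \<notin> Out"
    then obtain z where z: "z \<in> \<gamma>" "z \<in> Q" using \<gamma>(1) unfolding Out_def by blast
    have c: "is_cone \<gamma>" using \<Gamma>(1) \<gamma>(1) by (rule fan_is_cone)
    let ?H = "{h \<in> H. 0 < h s}"
    have "\<forall>h\<in>?H. 0 < h z \<or> 0 \<le> h z \<and> h (- x) \<le> 0" using z(2) unfolding Q_def by blast
    from small_step_cone[OF _ _ this] obtain t where t: "t > 0" "\<forall>h\<in>?H. 0 \<le> h (z - t *s (- x))"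
      using H(1,2) by auto
    \<comment> \<open>The positive multiple of \<open>x\<close> makes \<open>w\<close> interior to
      \<open>\<gamma>\<close>. One copy of \<open>z\<close> makes up for it in the constraints, and
      the second makes them strict.\<close>
    define w where "w = t *s x + (z + z)"
    have "w \<in> rel_int \<gamma>"
      unfolding w_def using z(1) by (intro rel_int_add[OF c] rel_int_scale[OF c] cone_add[OF c] \<gamma>(2) t(1))
    moreover have "w \<in> Q"
      unfolding Q_def
    proof (intro CollectI ballI impI)
      fix h assume h: "h \<in> H" "0 < h s"
      then have "0 \<le> h z + t * h x" using t(2) by (simp add: lin)
      moreover have "0 < h z" using z(2) h unfolding Q_def by blast
      ultimately show "0 < h w" unfolding w_def using h(1) by (simp add: lin)
    qed
    ultimately have "\<gamma> \<subseteq> P" using fine'[OF \<gamma>(1), of w] cellP[of w] QP by blast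
    then have xP: "x \<in> P" using \<gamma>(2) rel_int_subset by blast
    then show False using fine'[OF \<gamma> xP] cellQ[OF xP x] z by blast
  qed

  define Y where "Y = {y \<in> range (cell H). y \<subseteq> P}"
  have fcell: "rat_fan (range (cell H))"
  proof (rule rat_fan_cells[OF H(1,2)])
    fix x assume "\<forall>h\<in>H. h x = 0"
    moreover from this have "\<forall>h\<in>H. h (- x) = 0" by (simp add: lin)
    ultimately have "x \<in> \<sigma>" "- x \<in> \<sigma>" unfolding H(3) by auto
    then show "x = 0" using \<sigma>_cone(3) unfolding pointed_def by blast
  qed
  have \<sigma>Y: "\<sigma> \<in> Y" using \<sigma>_cell \<sigma>P unfolding Y_def by blast
  have "subfan Y (range (cell H))"
    unfolding subfan_def
  proof (intro conjI ballI allI impI)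
    show "Y \<noteq> {}" using \<sigma>Y by blast
    show "Y \<subseteq> range (cell H)" unfolding Y_def by blast
    show "F \<in> Y" if "C \<in> Y" "face F C" for C F
      using that fan_face[OF fcell _ that(2)] face_subset[OF that(2)] unfolding Y_def by blast
  qed
  then have fY: "rat_fan Y" using fcell subfan_rat_fan by blast
  have UY: "\<Union>Y = P" using cellP mem_cell unfolding Y_def by blast
  \<comment> \<open>By \<open>B_cover\<close> and \<open>B_cell\<close> these cones cover
    \<open>P - Q\<close> and each of them lies in a cell that misses \<open>Q\<close>.\<close>
  define B where "B = {\<gamma> \<in> Out. \<gamma> \<subseteq> P}"
  have B_cover: "\<exists>\<gamma>\<in>B. x \<in> \<gamma>" if x: "x \<in> P" "x \<notin> Q" for x
  proof -
    obtain \<gamma> where \<gamma>: "\<gamma> \<in> \<Gamma>" "x \<in> rel_int \<gamma>" using \<Gamma>(3) fan_rel_int[OF \<Gamma>(1)] by (metis UNIV_I UnionE)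
    then have "\<gamma> \<in> B"
      using Out_cover[OF \<gamma> x(2)] fine'[OF \<gamma> x(1)] cellP[OF x(1)] unfolding B_def by blast
    then show ?thesis using \<gamma>(2) rel_int_subset by blast
  qed
  have sB: "subfan B \<Gamma>"
    unfolding subfan_def
  proof (intro conjI ballI allI impI)
    have "0 \<in> P" using cone_zero[OF \<sigma>_cone(2)] \<sigma>P by blast
    moreover have "0 \<notin> Q" using fan_zero[OF K0_fan] K0Q by blast
    ultimately show "B \<noteq> {}" using B_cover by blast
    show "B \<subseteq> \<Gamma>" unfolding B_def Out_def by blast
    show "F \<in> B" if "C \<in> B" "face F C" for C F
      using that fan_face[OF fOut _ that(2)] face_subset[OF that(2)] unfolding B_def by blast
  qed
  define Fs where "Fs = {f. face f \<sigma>}"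
  have fFs: "rat_fan Fs"
    unfolding Fs_def using \<Sigma> subfan_faces[OF \<Sigma> \<sigma>(1)] by (rule subfan_rat_fan)
  \<comment> \<open>Proper faces of \<open>\<sigma>\<close> are themselves in \<open>Out\<close>.
    For \<open>\<sigma>\<close>, its relative interior lies in \<open>Q\<close>, so members of
    \<open>Out\<close> meet it only in its boundary.\<close>
  have out_faces: "face (g \<inter> f) g \<and> face (g \<inter> f) f" if g: "g \<in> Out" and f: "f \<in> Fs" for g f
  proof (cases "f = \<sigma>")
    case True
    have gQ: "g \<in> \<Gamma>" "g \<inter> Q = {}" using g unfolding Out_def by auto
    have "rel_int \<sigma> \<subseteq> Q"
    proof
      fix z assume z: "z \<in> rel_int \<sigma>"
      then obtain t where t: "t > 0" "z - t *s s \<in> \<sigma>" using s\<sigma> unfolding rel_int_def by blast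
      show "z \<in> Q"
        unfolding Q_def
      proof (intro CollectI ballI impI)
        fix h assume h: "h \<in> H" "0 < h s"
        have "t * h s \<le> h z" using nonneg[OF h(1) t(2)] h(1) by (simp add: lin)
        moreover have "0 < t * h s" using t(1) h(2) by simp
        ultimately show "0 < h z" by linarith
      qed
    qed
    then show ?thesis unfolding True using face_Int_boundary[OF \<Gamma>(1,2) gQ(1)] gQ(2) by blast
  next
    case False
    then have "f \<in> Out" using f proper_faces K0_Out unfolding Fs_def by blast
    then show ?thesis using fan_Int[OF fOut g] fan_Int2[OF fOut g] by blast
  qed
  \<comment> \<open>\<open>B\<close> subdivides the cells that miss \<open>Q\<close>, whereas
    \<open>Fs\<close> keeps the faces of \<open>\<sigma>\<close> as they are. Starting the extension
    from both ensures that \<open>\<sigma>\<close> survives.\<close>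
  define K where "K = {y \<in> Y. y \<inter> Q = {}} \<union> Fs"
  have sK: "subfan K Y"
    unfolding subfan_def
  proof (intro conjI ballI allI impI)
    show "K \<noteq> {}" using fan_nonempty[OF fFs] unfolding K_def by blast
    show "K \<subseteq> Y" using fan_face[OF fY \<sigma>Y] unfolding K_def Fs_def by blast
    show "F \<in> K" if C: "C \<in> K" "face F C" for C F
      using C fan_face[OF fY _ C(2)] face_subset[OF C(2)] fan_face[OF fFs _ C(2)]
      unfolding K_def by blast
  qed
  have fK': "rat_fan (B \<union> Fs)"
    by (rule rat_fan_Un[OF subfan_rat_fan[OF \<Gamma>(1) sB] fFs]) (use out_faces B_def in blast)
  have B_cell: "\<exists>y\<in>Y. y \<inter> Q = {} \<and> \<gamma> \<subseteq> y" if "\<gamma> \<in> B" for \<gamma>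
  proof -
    have \<gamma>: "\<gamma> \<in> \<Gamma>" "\<gamma> \<subseteq> P" "\<gamma> \<inter> Q = {}" using that unfolding B_def Out_def by auto
    obtain x where x: "x \<in> rel_int \<gamma>" using rel_int_nonempty[OF fan_rat_cone[OF \<Gamma>(1) \<gamma>(1)]] by blast
    then have "x \<in> P" "x \<notin> Q" using \<gamma> rel_int_subset by blast+
    then show ?thesis
      using fine'[OF \<gamma>(1) x] cellP[of x] cellQ[of x] unfolding Y_def by blast
  qed
  have ref: "refines (B \<union> Fs) K"
    unfolding refines_def
  proof (intro conjI ballI)
    show "\<Union>(B \<union> Fs) = \<Union>K"
    proof
      show "\<Union>(B \<union> Fs) \<subseteq> \<Union>K" using B_cell unfolding K_def by blast
      have "\<Union>{y \<in> Y. y \<inter> Q = {}} \<subseteq> \<Union>B" using UY B_cover by blast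
      then show "\<Union>K \<subseteq> \<Union>(B \<union> Fs)" unfolding K_def by blast
    qed
    show "\<exists>k\<in>K. f \<subseteq> k" if "f \<in> B \<union> Fs" for f
      using that B_cell unfolding K_def by blast
  qed (rule fK')

  \<comment> \<open>This is the compatibility with \<open>Out\<close> that \<open>rat_fan_Un\<close>
    needs for gluing.\<close>
  define I where "I = (\<lambda>F. \<forall>g\<in>Out. \<forall>f\<in>F. face (g \<inter> f) g \<and> face (g \<inter> f) f)"
  have I0: "I (B \<union> Fs)"
    using out_faces fan_Int[OF fOut] fan_Int2[OF fOut] unfolding I_def B_def by blast
  have "\<exists>\<Delta>. refines \<Delta> Y \<and> B \<union> Fs \<subseteq> \<Delta> \<and> I \<Delta>"
  proof (rule extend_refinement[where I = I, OF fY sK ref I0])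
    fix F C
    assume F: "rat_fan F" "I F" and C: "C \<in> Y" "C \<notin> K"
    have CP: "C \<subseteq> P" using C(1) unfolding Y_def by blast
    obtain z where z: "z \<in> C" "z \<in> Q" using C unfolding K_def by blast
    obtain p where p: "p \<in> N" "p \<in> rel_int C" using rat_cone_rel_int[OF fan_rat_cone[OF fY C(1)]] by blast
    obtain t where t: "t > 0" "p - t *s z \<in> C" using p(2) z(1) unfolding rel_int_def by blast
    have pQ: "0 < h p" if h: "h \<in> H" "0 < h s" for h
    proof -
      have "0 \<le> h (p - t *s z)" using t(2) CP h unfolding P_def by blast
      moreover have "0 < t * h z" using t(1) z(2) h unfolding Q_def by simp
      ultimately show ?thesis using h(1) by (simp add: lin)
    qed
    have "I (cone_off F C p)" if fan: "rat_fan (cone_off F C p)"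
      unfolding I_def
    proof (intro ballI)
      fix g f assume g: "g \<in> Out" and f: "f \<in> cone_off F C p"
      show "face (g \<inter> f) g \<and> face (g \<inter> f) f"
      proof (cases "f \<in> F")
        case True
        then show ?thesis using F(2) g unfolding I_def by blast
      next
        case False
        then obtain e where e: "e \<in> F" "e \<subseteq> C" "f = adjoin p e" using f unfolding cone_off_def by blast
        \<comment> \<open>A point outside \<open>Q\<close> has \<open>h x \<le> 0\<close> for some
          \<open>h\<close> with \<open>0 < h s\<close>. As \<open>0 \<le> h y\<close> and
          \<open>0 < h p\<close>, the coefficient of \<open>p\<close> must vanish.\<close>
        have "g \<inter> f \<subseteq> e"
        proof
          fix x assume x: "x \<in> g \<inter> f"
          then have "x \<in> adjoin p e" using e(3) by blast
          then obtain y r where y: "x = y + r *s p" "y \<in> e" "0 \<le> r" by (rule adjoinE)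
          have "x \<notin> Q" using x g unfolding Out_def by blast
          then obtain h where h: "h \<in> H" "0 < h s" "\<not> 0 < h x" unfolding Q_def by blast
          have "0 \<le> h y" using y(2) e(2) CP h unfolding P_def by blast
          then have "r * h p \<le> 0" using h(1,3) y(1) by (simp add: lin)
          then have "r = 0" using pQ[OF h(1,2)] y(3) by (simp add: mult_le_0_iff)
          then show "x \<in> e" using y by simp
        qed
        then have eq: "g \<inter> f = g \<inter> e" using subset_adjoin[of e p] e(3) by blast
        \<comment> \<open>Here the assumption \<open>fan\<close> enters: \<open>e\<close> and
          \<open>f\<close> belong to one fan, so \<open>e \<subseteq> f\<close> makes
          \<open>e\<close> a face of \<open>f\<close>.\<close>
        have "e \<in> cone_off F C p" using e(1) unfolding cone_off_def by blast
        then have "face e f" using fan_subset_face[OF fan _ f] subset_adjoin e(3) by blast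
        then show ?thesis
          unfolding eq using F(2) g e(1) face_trans[of "g \<inter> e" e f] unfolding I_def by blast
      qed
    qed
    then show "\<exists>p\<in>N. p \<in> rel_int C \<and> (rat_fan (cone_off F C p) \<longrightarrow> I (cone_off F C p))"
      using p by blast
  qed
  then obtain \<Delta> where \<Delta>: "refines \<Delta> Y" "B \<union> Fs \<subseteq> \<Delta>" "I \<Delta>" by blast
  then have f\<Delta>: "rat_fan \<Delta>" "\<Union>\<Delta> = P" using UY unfolding refines_def by auto
  show ?thesis
  proof (rule that)
    show "rat_fan (Out \<union> \<Delta>)"
      by (rule rat_fan_Un[OF fOut f\<Delta>(1)]) (use \<Delta>(3) I_def in blast)
    show "insert \<sigma> K0 \<subseteq> Out \<union> \<Delta>"
      using K0_Out \<Delta>(2) face_refl[OF \<sigma>_cone(2)] unfolding Fs_def by blast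
    have "x \<in> \<Union>(Out \<union> \<Delta>)" for x
    proof (cases "x \<in> Q")
      case True
      then show ?thesis using f\<Delta>(2) QP by blast
    next
      case False
      obtain \<gamma> where \<gamma>: "\<gamma> \<in> \<Gamma>" "x \<in> rel_int \<gamma>" using \<Gamma>(3) fan_rel_int[OF \<Gamma>(1)] by (metis UNIV_I UnionE)
      then show ?thesis using Out_cover[OF \<gamma> False] rel_int_subset by blast
    qed
    then show "\<Union>(Out \<union> \<Delta>) = UNIV" by blast
  qed
qed

lemma insert_cone:
  assumes \<Gamma>: "rat_fan \<Gamma>" "K0 \<subseteq> \<Gamma>" "\<Union>\<Gamma> = UNIV"
  obtains \<Gamma>' where "rat_fan \<Gamma>'" "insert \<sigma> K0 \<subseteq> \<Gamma>'" "\<Union>\<Gamma>' = UNIV"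
proof -
  obtain s where s: "s \<in> rel_int \<sigma>" using rel_int_nonempty[OF \<sigma>_cone(1)] by blast
  obtain \<Gamma>1 where 1: "rat_fan \<Gamma>1" "K0 \<subseteq> \<Gamma>1" "\<Union>\<Gamma>1 = UNIV"
    "\<And>f x. f \<in> \<Gamma>1 \<Longrightarrow> x \<in> rel_int f \<Longrightarrow> x \<in> \<sigma> \<Longrightarrow> f \<subseteq> \<sigma>"
    using subdivide_cone[OF \<Gamma>] by blast
  obtain \<Gamma>2 where 2: "rat_fan \<Gamma>2" "K0 \<subseteq> \<Gamma>2" "\<Union>\<Gamma>2 = UNIV"
    "\<And>g \<kappa>. g \<in> \<Gamma>2 \<Longrightarrow> \<kappa> \<in> K0 \<Longrightarrow> \<kappa> \<subseteq> g \<Longrightarrow> g \<inter> rel_int \<sigma> \<noteq> {} \<Longrightarrow> \<kappa> \<subseteq> \<sigma>"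
    by (rule separate_from_cone[OF 1(1-3)]) (erule (2) 1(4), blast)
  obtain H \<Gamma>3 where 3: "finite H" "H \<subseteq> M" "\<sigma> = {x. \<forall>h\<in>H. 0 \<le> h x}"
    "rat_fan \<Gamma>3" "K0 \<subseteq> \<Gamma>3" "\<Union>\<Gamma>3 = UNIV"
    "\<And>\<kappa> x. \<kappa> \<in> K0 \<Longrightarrow> x \<in> \<kappa> \<Longrightarrow> \<forall>h\<in>H. 0 < h s \<longrightarrow> 0 \<le> h x \<Longrightarrow> x \<in> \<sigma>"
    "\<And>\<gamma> x. \<gamma> \<in> \<Gamma>3 \<Longrightarrow> x \<in> rel_int \<gamma> \<Longrightarrow> \<forall>h\<in>H. 0 < h s \<longrightarrow> 0 \<le> h x \<Longrightarrow> \<gamma> \<subseteq> cell H x"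
    by (rule refine_near_cone[OF 2(1-3) _ s]) (erule (3) 2(4), blast)
  show ?thesis
    by (rule replace_star[OF 3(4-6) 3(1-3) s]) (erule (2) 3(7), erule (2) 3(8), rule that)
qed

end

section \<open>Induction over the cones of the fan\<close>

text \<open>Start from the subfan \<open>{{0}}\<close>: the arrangement of functionals that cut out
  the origin is a complete fan with \<open>{0}\<close> as a cell. Each further cone is handled by
  \<open>insert_cone\<close>.\<close>

theorem completion:
  assumes \<Sigma>: "rat_fan \<Sigma>"
  obtains \<Sigma>' where "rat_fan \<Sigma>'" "\<Sigma> \<subseteq> \<Sigma>'" "\<Union>\<Sigma>' = UNIV"
proof -
  have zero: "rat_cone {0}" "is_cone {0}" using rat_cone_zero rat_cone_is_cone by auto
  obtain C where C: "C \<in> \<Sigma>" using fan_nonempty[OF \<Sigma>] by blast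
  have cC: "is_cone C" "pointed C" using fan_is_cone[OF \<Sigma> C] fan_pointed[OF \<Sigma> C] by auto
  have "face {0} C"
    unfolding face_def
  proof (intro conjI ballI impI zero)
    show "{0} \<subseteq> C" using cone_zero[OF cC(1)] by simp
    fix x y assume "x \<in> C" "y \<in> C" "x + y \<in> {0}"
    then show "x \<in> {0}" using cC(2) unfolding pointed_def by (metis add_eq_0_iff singletonD singletonI)
  qed
  then have "{0} \<in> \<Sigma>" using fan_face[OF \<Sigma> C] by blast
  then have sub: "subfan {{0}} \<Sigma>"
    unfolding subfan_def using face_is_cone face_subset cone_zero by blast
  have "\<exists>\<Gamma>. rat_fan \<Gamma> \<and> \<Sigma> \<subseteq> \<Gamma> \<and> \<Union>\<Gamma> = UNIV"
    using \<Sigma> sub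
  proof (induction rule: subfan_induct)
    case base
    obtain L where L: "finite L" "L \<subseteq> M" "{0} = {x. \<forall>u\<in>L. 0 \<le> u x}"
      using zero(1) unfolding rat_cone_def by blast
    have sep: "x = 0" if "\<forall>u\<in>L. u x = 0" for x using that L(3) by force
    have "cell L 0 = {0}"
      using L(2) sep unfolding cell_def by (auto simp: M_zero subset_iff intro: order_antisym)
    then have "{{0}} \<subseteq> range (cell L)" by force
    then show ?case using rat_fan_cells[OF L(1,2) sep] UN_cell by blast
  next
    case (step K C)
    then obtain \<Gamma> where "rat_fan \<Gamma>" "K \<subseteq> \<Gamma>" "\<Union>\<Gamma> = UNIV" by blast
    then show ?case using insert_cone[OF \<Sigma> step(1,3,4,5)] by blast
  qed
  then show ?thesis using that by blast
qed

end


subsection \<open>The rational structure of \<open>N\<^sub>R\<close>\<close>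

lemma pure_tensor_zero_left: "pure_tensor 0 r = 0"
  using pure_tensor_add_left[of 0 0 r] by simp

lemma pure_tensor_zero_right: "pure_tensor n 0 = 0"
  using pure_tensor_add_right[of n 0 0] by simp

lemma pure_tensor_diff_left: "pure_tensor (m - n) r = pure_tensor m r - pure_tensor n r"
  using pure_tensor_add_left[of "m - n" n r] by simp

lemma pure_tensor_diff_right: "pure_tensor n (r - s) = pure_tensor n r - pure_tensor n s"
  using pure_tensor_add_right[of n "r - s" s] by simp

text \<open>An integer scalar can be moved to the lattice factor. This gives \<open>scale_N\<close>,
  as pairings of lattice vectors are integers.\<close>

lemma pure_tensor_of_int: "pure_tensor n (of_int k :: 'r::ring_1) \<in> range (\<lambda>n. pure_tensor n 1)"
proof (induction k rule: int_induct[where k = 0])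
  case base
  show ?case by (metis of_int_0 pure_tensor_zero_left pure_tensor_zero_right rangeI)
next
  case (step1 i)
  from this(2) obtain m where "pure_tensor n (of_int i :: 'r) = pure_tensor m 1" by (rule rangeE)
  then have "pure_tensor n (of_int (i + 1) :: 'r) = pure_tensor (m + n) 1"
    by (simp add: pure_tensor_add_left pure_tensor_add_right)
  then show ?case by blast
next
  case (step2 i)
  from this(2) obtain m where "pure_tensor n (of_int i :: 'r) = pure_tensor m 1" by (rule rangeE)
  then have "pure_tensor n (of_int (i - 1) :: 'r) = pure_tensor (m - n) 1"
    by (simp add: pure_tensor_diff_left pure_tensor_diff_right)
  then show ?case by blast
qed

lemma pairing_linear:
  fixes v w :: "('n::ab_group_add, 'r::field) tensor"
  shows "pairing u (v + w) = pairing u v + pairing u w"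
    and "pairing u (c *\<^sub>N v) = c * pairing u v"
    and "pairing u (0 :: ('n, 'r) tensor) = 0"
proof -
  interpret l: Vector_Spaces.linear "(*\<^sub>N)" "(*)" "pairing u :: ('n, 'r) tensor \<Rightarrow> 'r"
    by (rule linear_functional_pairing)
  show "pairing u (v + w) = pairing u v + pairing u w" "pairing u (c *\<^sub>N v) = c * pairing u v"
    "pairing u (0 :: ('n, 'r) tensor) = 0"
    by (simp_all add: l.add l.scale)
qed

lemma linear_functional_eqI:
  fixes f g :: "('n::ab_group_add, 'r::field) tensor \<Rightarrow> 'r"
  assumes "f 0 = g 0" "\<And>n r. f (pure_tensor n r) = g (pure_tensor n r)"
    "\<And>v w. f (v - w) = f v - f w" "\<And>v w. g (v - w) = g v - g w"
  shows "f = g"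
proof
  fix w show "f w = g w"
    by (induction w rule: tensor_induct) (simp_all add: assms)
qed

text \<open>Pure tensors generate the space under differences, so a functional is determined by its
  values on them. The closure properties of \<open>M\<close> are checked through this
  criterion.\<close>

lemma range_pairingI:
  fixes f :: "('n::ab_group_add, 'r::field) tensor \<Rightarrow> 'r"
  assumes "Modules.additive u" "f 0 = 0" "\<And>n r. f (pure_tensor n r) = of_int (u n) * r"
    "\<And>v w. f (v - w) = f v - f w"
  shows "f \<in> range pairing"
proof -
  have "f = pairing (Abs_dual u)"
    by (rule linear_functional_eqI)
      (simp_all add: assms pairing_linear pairing_diff pairing_pure_tensor Abs_dual_inverse)
  then show ?thesis by blast
qed

lemma additive_Rep_dual: "Rep_dual u (m + n) = Rep_dual u m + Rep_dual u n"
  using Rep_dual[of u] by (simp add: Modules.additive_def)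

text \<open>Transport the standard basis and its coordinates along an isomorphism with a free
  abelian group. The expansion is checked on pure tensors, where it is linear in the lattice
  factor.\<close>

lemma tensor_dual_bases:
  assumes "fg_free_abelian TYPE('n::ab_group_add)"
  shows "\<exists>I (e :: nat \<Rightarrow> ('n, 'r::field) tensor) \<epsilon>. finite (I :: nat set) \<and>
    e ` I \<subseteq> range (\<lambda>n. pure_tensor n 1) \<and> \<epsilon> ` I \<subseteq> range pairing \<and>
    (\<forall>x. x = (\<Sum>i\<in>I. \<epsilon> i x *\<^sub>N e i))"
proof -
  obtain d :: nat where "free_Abelian_group {..<d} \<cong> (additive_group :: 'n monoid)"
    using assms unfolding fg_free_abelian_def by blast
  then obtain h where h: "h \<in> iso (free_Abelian_group {..<d}) (additive_group :: 'n monoid)"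
    unfolding is_iso_def by blast
  define k where "k = inv_into (carrier (free_Abelian_group {..<d})) h"
  have k: "k \<in> iso (additive_group :: 'n monoid) (free_Abelian_group {..<d})"
    unfolding k_def by (rule group.iso_set_sym[OF group_free_Abelian_group h])
  have h_add: "h (a + b) = h a + h b"
    if "Poly_Mapping.keys a \<subseteq> {..<d}" "Poly_Mapping.keys b \<subseteq> {..<d}" for a b
    using h that by (auto simp: iso_def hom_def additive_group_def)
  have k_add: "k (m + n) = k m + k n" for m n
    using k by (auto simp: iso_def hom_def additive_group_def)
  have "k \<in> UNIV \<rightarrow> carrier (free_Abelian_group {..<d})"
    using k by (simp add: iso_def hom_def additive_group_def)
  then have "k n \<in> carrier (free_Abelian_group {..<d})" for n by (rule funcset_mem) simp
  then have k_keys: "Poly_Mapping.keys (k n) \<subseteq> {..<d}" for n by simp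
  have "bij_betw h (carrier (free_Abelian_group {..<d})) (carrier (additive_group :: 'n monoid))"
    using h unfolding iso_def by blast
  then have "h ` carrier (free_Abelian_group {..<d}) = carrier (additive_group :: 'n monoid)"
    by (rule bij_betw_imp_surj_on)
  also have "carrier (additive_group :: 'n monoid) = UNIV" by (simp add: additive_group_def)
  finally have h_surj: "h ` carrier (free_Abelian_group {..<d}) = UNIV" .
  have h_k: "h (k n) = n" for n
    unfolding k_def by (rule f_inv_into_f) (simp only: h_surj UNIV_I)
  have h_diff: "h (a - b) = h a - h b"
    if "Poly_Mapping.keys a \<subseteq> {..<d}" "Poly_Mapping.keys b \<subseteq> {..<d}" for a b
  proof -
    have "Poly_Mapping.keys (a - b) \<subseteq> {..<d}" using that keys_diff[of a b] by blast
    from h_add[OF this that(2)] show ?thesis by (simp add: algebra_simps)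
  qed
  have h_zero: "h 0 = 0" using h_add[of 0 0] by simp
  \<comment> \<open>The support condition is carried through the induction because
    \<open>h_diff\<close> is available only on the carrier.\<close>
  have expand: "Poly_Mapping.keys c \<subseteq> {..<d} \<and>
      pure_tensor (h c) r = (\<Sum>i<d. pure_tensor (h (frag_of i)) (of_int (Poly_Mapping.lookup c i) * r))"
    if "Poly_Mapping.keys c \<subseteq> {..<d}" for c and r :: 'r
    using that
  proof (induction c rule: frag_induction)
    case zero
    then show ?case by (simp add: h_zero pure_tensor_zero_left pure_tensor_zero_right)
  next
    case (one j)
    have "(\<Sum>i<d. pure_tensor (h (frag_of i)) (of_int (Poly_Mapping.lookup (frag_of j) i) * r)) =
        (\<Sum>i<d. if i = j then pure_tensor (h (frag_of j)) r else 0)"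
      by (intro sum.cong) (auto simp: lookup_single pure_tensor_zero_right)
    then show ?case using one by simp
  next
    case (diff a b)
    then have "Poly_Mapping.keys (a - b) \<subseteq> {..<d}" using keys_diff[of a b] by blast
    then show ?case
      using diff by (simp add: h_diff pure_tensor_diff_left lookup_minus left_diff_distrib
          pure_tensor_diff_right sum_subtractf)
  qed
  define e :: "nat \<Rightarrow> ('n, 'r) tensor" where "e i = pure_tensor (h (frag_of i)) 1" for i
  define \<epsilon> :: "nat \<Rightarrow> 'n dual" where "\<epsilon> i = Abs_dual (\<lambda>n. Poly_Mapping.lookup (k n) i)" for i
  have \<epsilon>: "Rep_dual (\<epsilon> i) n = Poly_Mapping.lookup (k n) i" for i n
    unfolding \<epsilon>_def by (subst Abs_dual_inverse) (simp_all add: Modules.additive_def k_add lookup_add)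
  have "x = (\<Sum>i<d. pairing (\<epsilon> i) x *\<^sub>N e i)" for x
  proof (induction x rule: tensor_induct)
    case zero
    show ?case by (simp add: pairing_linear)
  next
    case (pure n r)
    have "pure_tensor n r = (\<Sum>i<d. pure_tensor (h (frag_of i)) (of_int (Poly_Mapping.lookup (k n) i) * r))"
      using expand[OF k_keys[of n], of r] by (simp only: h_k)
    also have "\<dots> = (\<Sum>i<d. pairing (\<epsilon> i) (pure_tensor n r) *\<^sub>N e i)"
      by (simp add: pairing_pure_tensor \<epsilon> e_def scale_pure_tensor)
    finally show ?case .
  next
    case (diff v w)
    have "(\<Sum>i<d. pairing (\<epsilon> i) (v - w) *\<^sub>N e i) =
        (\<Sum>i<d. pairing (\<epsilon> i) v *\<^sub>N e i) - (\<Sum>i<d. pairing (\<epsilon> i) w *\<^sub>N e i)"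
      by (simp only: pairing_diff tensor.scale_left_diff_distrib sum_subtractf)
    then show ?case using diff by simp
  qed
  then show ?thesis
    by (intro exI[of _ "{..<d}"] exI[of _ e] exI[of _ "\<lambda>i. pairing (\<epsilon> i)"]) (auto simp: e_def)
qed

lemma rational_space_tensor:
  assumes "fg_free_abelian TYPE('n::ab_group_add)"
  shows "rational_space ((*\<^sub>N) :: 'r::linordered_field \<Rightarrow> ('n, 'r) tensor \<Rightarrow> _)
    (range pairing) (range (\<lambda>n. pure_tensor n 1))"
proof
  fix u w :: "('n, 'r) tensor \<Rightarrow> 'r" and x y m n :: "('n, 'r) tensor" and c :: 'r
  let ?M = "range pairing :: (('n, 'r) tensor \<Rightarrow> 'r) set"
  let ?N = "range (\<lambda>n. pure_tensor n 1) :: ('n, 'r) tensor set"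
  show "u \<in> ?M \<Longrightarrow> u (x + y) = u x + u y" "u \<in> ?M \<Longrightarrow> u (c *\<^sub>N x) = c * u x"
    by (auto simp: pairing_linear)
  show "(\<lambda>_. 0) \<in> ?M"
    by (rule range_pairingI[of "\<lambda>_. 0"]) (simp_all add: Modules.additive_def)
  show "(\<lambda>x. u x + w x) \<in> ?M" if "u \<in> ?M" "w \<in> ?M"
  proof -
    from that obtain a b where "u = pairing a" "w = pairing b" by blast
    then show ?thesis
      by (intro range_pairingI[of "\<lambda>n. Rep_dual a n + Rep_dual b n"])
        (simp_all add: Modules.additive_def additive_Rep_dual pairing_linear pairing_diff
          pairing_pure_tensor algebra_simps)
  qed
  show "(\<lambda>x. - u x) \<in> ?M" if "u \<in> ?M"
  proof -
    from that obtain a where "u = pairing a" by blast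
    then show ?thesis
      by (intro range_pairingI[of "\<lambda>n. - Rep_dual a n"])
        (simp_all add: Modules.additive_def additive_Rep_dual pairing_linear pairing_diff
          pairing_pure_tensor algebra_simps)
  qed
  show "0 \<in> ?N" by (metis pure_tensor_zero_left rangeI)
  show "m + n \<in> ?N" if "m \<in> ?N" "n \<in> ?N"
    using that by (auto simp: pure_tensor_add_left[symmetric])
  show "- n \<in> ?N" if "n \<in> ?N"
  proof -
    from that obtain k where "n = pure_tensor k 1" by blast
    then have "- n = pure_tensor (- k) 1"
      using pure_tensor_diff_left[of 0 k "1 :: 'r"] by (simp add: pure_tensor_zero_left)
    then show ?thesis by blast
  qed
  show "(\<lambda>x. u n * w x) \<in> ?M" if u: "u \<in> ?M" "w \<in> ?M" "n \<in> ?N"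
  proof -
    from u obtain a b k where "u = pairing a" "w = pairing b" "n = pure_tensor k 1" by blast
    then show ?thesis
      by (intro range_pairingI[of "\<lambda>n. Rep_dual a k * Rep_dual b n"])
        (simp_all add: Modules.additive_def additive_Rep_dual pairing_linear pairing_diff
          pairing_pure_tensor algebra_simps)
  qed
  show "u m *\<^sub>N n \<in> ?N" if u: "u \<in> ?M" "m \<in> ?N" "n \<in> ?N"
  proof -
    from u obtain a k l where "u = pairing a" "m = pure_tensor k 1" "n = pure_tensor l 1" by blast
    then show ?thesis by (simp add: pairing_pure_tensor scale_pure_tensor pure_tensor_of_int)
  qed
  show "\<exists>I e \<epsilon>. finite (I :: nat set) \<and> e ` I \<subseteq> ?N \<and> \<epsilon> ` I \<subseteq> ?M \<and> (\<forall>x. x = (\<Sum>i\<in>I. \<epsilon> i x *\<^sub>N e i))"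
    by (rule tensor_dual_bases[OF assms])
qed

section \<open>Translation between the two notions of rational fan\<close>

theorem proposition4p1:
  fixes \<Sigma> :: "('n::ab_group_add, 'r::linordered_field) tensor set set"
  assumes "fg_free_abelian TYPE('n)"
    and "rational_fan \<Sigma>"
  shows "\<exists>\<Sigma>'. rational_completion \<Sigma> \<Sigma>'"
proof -
  let ?M = "range pairing :: (('n, 'r) tensor \<Rightarrow> 'r) set"
  interpret rational_space "(*\<^sub>N) :: 'r \<Rightarrow> ('n, 'r) tensor \<Rightarrow> _" ?M "range (\<lambda>n. pure_tensor n 1)"
    using assms(1) by (rule rational_space_tensor)
  have lin: "l (v + w) = l v + l w" "l (c *\<^sub>N v) = c * l v" "l 0 = 0"
    if "linear_functional l" for l :: "('n, 'r) tensor \<Rightarrow> 'r" and v w c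
  proof -
    interpret l: Vector_Spaces.linear "(*\<^sub>N)" "(*)" l by (rule that)
    show "l (v + w) = l v + l w" "l (c *\<^sub>N v) = c * l v" "l 0 = 0" by (simp_all add: l.add l.scale)
  qed
  have rat_iff: "rational_cone C \<longleftrightarrow> rat_cone C" for C :: "('n, 'r) tensor set"
  proof
    assume "rational_cone C"
    then obtain L where "finite L" "C = {w. \<forall>u\<in>L. pairing u w \<ge> 0}" unfolding rational_cone_def by blast
    then show "rat_cone C" unfolding rat_cone_def by (intro exI[of _ "pairing ` L"]) auto
  next
    assume "rat_cone C"
    then obtain L where L: "finite L" "L \<subseteq> ?M" "C = {x. \<forall>u\<in>L. 0 \<le> u x}" unfolding rat_cone_def by blast
    obtain L' where "finite L'" "L = pairing ` L'" using finite_subset_image[OF L(1,2)] by blast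
    then show "rational_cone C" unfolding rational_cone_def by (intro exI[of _ L']) (auto simp: L(3))
  qed
  \<comment> \<open>A functional that attains its minimum on a cone is nonnegative there with
    minimum 0, so its exposed face is a zero set. Conversely, \<open>face_rat_cone\<close> exposes a
    face by a member of \<open>M\<close>.\<close>
  have face_iff: "is_face_of F C \<longleftrightarrow> face F C" if C: "rat_cone C" for F C :: "('n, 'r) tensor set"
  proof
    have c: "is_cone C" using C by (rule rat_cone_is_cone)
    assume "is_face_of F C"
    then obtain l w where l: "linear_functional l" "F = {w \<in> C. \<forall>v\<in>C. l w \<le> l v}" "w \<in> F"
      unfolding is_face_of_def by blast
    have w: "w \<in> C" "\<And>v. v \<in> C \<Longrightarrow> l w \<le> l v" using l(2,3) by auto
    have nonneg: "0 \<le> l v" if "v \<in> C" for v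
      using w(2)[OF cone_add[OF c w(1) that]] lin[OF l(1)] by simp
    have "F = {v \<in> C. l v = 0}"
    proof (intro equalityI subsetI)
      fix v assume "v \<in> F"
      then have v: "v \<in> C" "l v \<le> l 0" using l(2) cone_zero[OF c] by auto
      then have "l v = 0" using nonneg[OF v(1)] lin(3)[OF l(1)] by simp
      then show "v \<in> {v \<in> C. l v = 0}" using v(1) by simp
    next
      fix v assume "v \<in> {v \<in> C. l v = 0}"
      then show "v \<in> F" unfolding l(2) using nonneg by simp
    qed
    then show "face F C" using face_hyperplane[OF c, of l] lin[OF l(1)] nonneg by simp
  next
    assume F: "face F C"
    obtain u where u: "u \<in> ?M" "\<forall>x\<in>C. 0 \<le> u x" "F = {x \<in> C. u x = 0}"
      using face_rat_cone[OF C F] by blast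
    have z: "0 \<in> F" using face_is_cone[OF F] by (rule cone_zero)
    have "F = {w \<in> C. \<forall>v\<in>C. u w \<le> u v}"
    proof (intro equalityI subsetI)
      fix v assume "v \<in> {w \<in> C. \<forall>v\<in>C. u w \<le> u v}"
      then have v: "v \<in> C" "u v \<le> u 0" using z u(3) by auto
      then have "u v = 0" using u(2) z u(3) by (auto intro: order_antisym)
      then show "v \<in> F" using v(1) u(3) by simp
    qed (use u in auto)
    moreover have "linear_functional u" using u(1) linear_functional_pairing by auto
    ultimately show "is_face_of F C" using z unfolding is_face_of_def by blast
  qed
  have strongly_iff: "strongly_convex C \<longleftrightarrow> pointed C" if C: "rat_cone C" for C :: "('n, 'r) tensor set"
  proof
    have c: "is_cone C" using C by (rule rat_cone_is_cone)
    assume sc: "strongly_convex C"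
    show "pointed C"
      unfolding pointed_def
    proof (intro allI impI)
      fix v assume v: "v \<in> C" "- v \<in> C"
      have "0 + t *\<^sub>N v \<in> C" for t
      proof (cases "0 \<le> t")
        case True
        then show ?thesis using cone_scale[OF c v(1)] by simp
      next
        case False
        then show ?thesis using cone_scale[OF c v(2), of "- t"] by simp
      qed
      then show "v = 0" using sc unfolding strongly_convex_def by blast
    qed
  next
    obtain L where L: "finite L" "L \<subseteq> ?M" "C = {x. \<forall>u\<in>L. 0 \<le> u x}" using C unfolding rat_cone_def by blast
    assume p: "pointed C"
    show "strongly_convex C"
      unfolding strongly_convex_def
    proof
      assume "\<exists>w v. v \<noteq> 0 \<and> (\<forall>t. w + t *\<^sub>N v \<in> C)"
      then obtain w v where v: "v \<noteq> 0" "\<And>t. w + t *\<^sub>N v \<in> C" by blast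
      have "u v = 0" if u: "u \<in> L" for u
      proof (rule ccontr)
        assume "u v \<noteq> 0"
        moreover have "0 \<le> u w + t * u v" for t
          using v(2)[of t] u L by (auto simp: M_linear subset_iff)
        \<comment> \<open>This value of \<open>t\<close> makes the right-hand side equal to
          -1.\<close>
        from this[of "- (u w + 1) / u v"] have "0 \<le> u w + - (u w + 1) / u v * u v" .
        ultimately show False by simp
      qed
      then have uv: "\<forall>u\<in>L. u v = 0" by blast
      then have "\<forall>u\<in>L. u (- v) = 0" using L(2) by (metis M_minus neg_equal_0_iff_equal subsetD)
      with uv have "\<forall>u\<in>L. 0 \<le> u v \<and> 0 \<le> u (- v)" by (metis order_refl)
      then have "v \<in> C" "- v \<in> C" unfolding L(3) by blast+
      then show False using p v(1) unfolding pointed_def by blast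
    qed
  qed
  have cone_poly: "polyhedral_cone C" "polyhedron_over C" if "rational_cone C" for C :: "('n, 'r) tensor set"
  proof -
    obtain L where L: "finite L" "C = {w. \<forall>u\<in>L. pairing u w \<ge> 0}"
      using \<open>rational_cone C\<close> unfolding rational_cone_def by blast
    show "polyhedral_cone C"
      unfolding polyhedral_cone_def
      by (intro exI[of _ "pairing ` L"]) (auto simp: L linear_functional_pairing)
    show "polyhedron_over C"
      unfolding polyhedron_over_def
      by (intro exI[of _ "(\<lambda>u. (pairing u, 0)) ` L"]) (auto simp: L linear_functional_pairing)
  qed
  have \<Sigma>: "rat_fan \<Sigma>"
    unfolding rat_fan_def
  proof (intro conjI ballI allI impI)
    have fan: "fan \<Sigma>" "polyhedral_complex \<Sigma>" and rat: "\<And>C. C \<in> \<Sigma> \<Longrightarrow> rat_cone C"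
      using assms(2) rat_iff unfolding rational_fan_def fan_def by auto
    show "finite \<Sigma>" "\<Sigma> \<noteq> {}" using fan unfolding fan_def polyhedral_complex_def by auto
    fix C assume C: "C \<in> \<Sigma>"
    show "rat_cone C" using C by (rule rat)
    show "pointed C" using fan(1) C strongly_iff[OF rat[OF C]] unfolding fan_def by blast
    show "F \<in> \<Sigma>" if "face F C" for F
      using fan(2) C face_iff[OF rat[OF C]] that unfolding polyhedral_complex_def by blast
    show "face (C \<inter> D) C" if D: "D \<in> \<Sigma>" for D
    proof -
      \<comment> \<open>This excludes the empty intersection that a polyhedral complex
        permits.\<close>
      have "0 \<in> C \<inter> D" using cone_zero[OF rat_cone_is_cone[OF rat]] C D by blast
      then have "is_face_of (C \<inter> D) C" using fan(2) C D unfolding polyhedral_complex_def by blast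
      then show ?thesis using face_iff[OF rat[OF C]] by blast
    qed
  qed
  obtain \<Sigma>' where \<Sigma>': "rat_fan \<Sigma>'" "\<Sigma> \<subseteq> \<Sigma>'" "\<Union>\<Sigma>' = UNIV"
    using completion[OF \<Sigma>] by blast
  have rat: "rat_cone C" if "C \<in> \<Sigma>'" for C using fan_rat_cone[OF \<Sigma>'(1) that] .
  have "polyhedral_complex \<Sigma>'"
    unfolding polyhedral_complex_def
  proof (intro conjI ballI allI impI)
    show "finite \<Sigma>'" using \<Sigma>'(1) by (rule fan_finite)
    fix C assume C: "C \<in> \<Sigma>'"
    show "polyhedron_over C" using cone_poly(2) rat_iff rat[OF C] by blast
    show "F \<in> \<Sigma>'" if "is_face_of F C" for F
      using fan_face[OF \<Sigma>'(1) C] that face_iff[OF rat[OF C]] by blast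
    show "C \<inter> D = {} \<or> is_face_of (C \<inter> D) C \<and> is_face_of (C \<inter> D) D" if D: "D \<in> \<Sigma>'" for D
      using fan_Int[OF \<Sigma>'(1) C D] fan_Int2[OF \<Sigma>'(1) C D] face_iff[OF rat[OF C]] face_iff[OF rat[OF D]]
      by blast
  qed
  then have "fan \<Sigma>'"
    unfolding fan_def
    using fan_nonempty[OF \<Sigma>'(1)] cone_poly(1) rat_iff rat strongly_iff fan_pointed[OF \<Sigma>'(1)] by blast
  then have "rational_fan \<Sigma>'" unfolding rational_fan_def using rat_iff rat by blast
  then show ?thesis using \<Sigma>'(2,3) unfolding rational_completion_def by blast
qed

end
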